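(* Let $(M^m,g)$ be a compact $\Phi$-SSU manifold, with $B$ the second fundamental form of an isometric immersion $M\to\mathbb{R}^{r}$ realizing the $\Phi$-SSU condition. Let $$a=\min_{X\in UM,\,Y\in UM}\frac{-\langle Q^M_x(X),X\rangle_M}{8\,|B(X,X)|_{\mathbb{R}^r}\,|B(Y,Y)|_{\mathbb{R}^r}}>0,$$ where $UM$ is the unit tangent bundle of $M$ and $x\in M$ is the base point. Let $F:[0,\infty)\to[0,\infty)$ be a strictly increasing convex $C^2$ function with $t\,F''(t)<a\,F'(t)$ for all $t>0$, and let the potential $H$ on $M$ satisfy $\nabla^2H\le0$. Let $(N,g_N)$ be any Riemannian manifold. If $u:(N,g_N)\to(M,g)$ is a $\Phi_{sym}$-stable $F$-symphonic map with potential $H$, then $u$ is constant.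
   Context: A Riemannian manifold $M^m$ is $\Phi$-superstrongly unstable ($\Phi$-SSU) if there is an isometric immersion of $M^m$ in $\mathbb{R}^{m+p}$, $p>0$, with second fundamental form $B$ such that for all unit tangent vectors $X$ to $M$ at every point $x\in M$, $$\langle Q^M_x(X),X\rangle_M=\sum_{i=1}^m\big(4\langle B(X,\epsilon_i),B(X,\epsilon_i)\rangle-\langle B(X,X),B(\epsilon_i,\epsilon_i)\rangle\big)<0,$$ where $\{\epsilon_i\}_{i=1}^m$ is a local orthonormal frame of $M$. For $u:(N,g_N)\to(M,g)$ and a local orthonormal frame $\{e_i\}$ of $N$, let $\Phi_{sym}(u)=\int_N\{F(\|u^*g\|^2/4)+H(u)\}dv_{g_N}$, where $\|u^*g\|^2=\sum_{i,j}g(du(e_i),du(e_j))^2$; a critical point of $\Phi_{sym}$ is called an $F$-symphonic map with potential $H$. Put $\sigma_u(X)=\sum_jg(du(X),du(e_j))du(e_j)$, let $\tilde\nabla$ be the induced connection on $u^{-1}TM$, and $\langle\tilde\nabla V,\sigma_u\rangle=\sum_ig(\tilde\nabla_{e_i}V,\sigma_u(e_i))$. The index form on vector fields $V$ along $u$ is $$ \begin{aligned} I(V,V)={}&\int_N\nabla^2H(V,V)dv_{g_N}+\int_NF''\Big(\frac{\|u^*g\|^2}{4}\Big)\langle\tilde\nabla V,\sigma_u\rangle^2dv_{g_N}\\ &+\int_NF'\Big(\frac{\|u^*g\|^2}{4}\Big)\sum_{i,j}\Big\{g(\tilde\nabla_{e_i}V,\tilde\nabla_{e_j}V)g(du(e_i),du(e_j))+g(\tilde\nabla_{e_i}V,du(e_j))^2\\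 &\qquad+g(\tilde\nabla_{e_i}V,du(e_j))g(du(e_i),\tilde\nabla_{e_j}V)+g\big(R^M(V,du(e_i))V,du(e_j)\big)g(du(e_i),du(e_j))\Big\}dv_{g_N}, \end{aligned} $$ with $R^M$ normalized so that $g(R^M(X,Y)Y,X)$ is the sectional curvature for orthonormal $X,Y$. The map $u$ is $\Phi_{sym}$-stable if $I(V,V)\ge0$ for every nonzero vector field $V$ along $u$.
   Formalization: N is assumed connected (otherwise a map with different constants on different components is a counterexample), and for non-compact N, stability means that I(V,V) exists as an extended real and is nonnegative for every smooth nonzero V. *)

theory Defs
  imports "HOL-Analysis.Analysis"
begin

section \<open>Smoothness in Euclidean spaces\<close>

text \<open>On an open set of a Euclidean space, \<open>Ck_on k\<close> is the usual class of \<open>k\<close> times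
  continuously differentiable maps.\<close>

primrec Ck_on ::
    "nat \<Rightarrow> ('a::real_normed_vector \<Rightarrow> 'b::real_normed_vector) \<Rightarrow> 'a set \<Rightarrow> bool" where
  "Ck_on 0 f S \<longleftrightarrow> continuous_on S f"
| "Ck_on (Suc k) f S \<longleftrightarrow> (\<forall>x\<in>S. f differentiable (at x)) \<and>
     (\<forall>v. Ck_on k (\<lambda>x. frechet_derivative f (at x) v) S)"

definition smooth_on ::
    "('a::real_normed_vector \<Rightarrow> 'b::real_normed_vector) \<Rightarrow> 'a set \<Rightarrow> bool" where
  "smooth_on f S \<longleftrightarrow> (\<forall>k. Ck_on k f S)"

definition dird ::
    "('a::real_normed_vector \<Rightarrow> 'b::real_normed_vector) \<Rightarrow> 'a \<Rightarrow> 'a \<Rightarrow> 'b" where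
  "dird f x v = frechet_derivative f (at x) v"


section \<open>Riemannian manifolds\<close>

text \<open>
  A chart is a pair of its domain and its coordinate map.  The points of a manifold are all
  elements of a type \<open>'a\<close>.  For every point \<open>p\<close> one chart \<open>chart_at M p\<close> around \<open>p\<close> is
  singled out by choice, and a tangent vector at \<open>p\<close> is represented by its components with
  respect to that chart; hence each tangent space is \<open>real^'k\<close> as a vector space.
  Since the chosen chart varies with \<open>p\<close>, smoothness of a tensor or of a vector field is
  always expressed after transporting it into one fixed chart of the atlas
  (\<open>to_chart\<close>, \<open>from_chart\<close>).
\<close>

type_synonym ('a, 'k) chart = "'a set \<times> ('a \<Rightarrow> real^'k)"

record ('a, 'k) rmfd =
  charts :: "('a, 'k) chart set"
  metric :: "'a \<Rightarrow> real^'k \<Rightarrow> real^'k \<Rightarrow> real"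

definition chart_inv :: "('a, 'k::finite) chart \<Rightarrow> real^'k \<Rightarrow> 'a" where
  "chart_inv c = inv_into (fst c) (snd c)"

definition smooth_atlas :: "('a::topological_space, 'k::finite) chart set \<Rightarrow> bool" where
  "smooth_atlas A \<longleftrightarrow>
     (\<forall>c\<in>A. open (fst c) \<and> open (snd c ` fst c) \<and>
        homeomorphism (fst c) (snd c ` fst c) (snd c) (chart_inv c)) \<and>
     (\<Union>c\<in>A. fst c) = UNIV \<and>
     (\<forall>c\<in>A. \<forall>d\<in>A. smooth_on (snd d \<circ> chart_inv c) (snd c ` (fst c \<inter> fst d)))"

definition chart_at :: "('a, 'k::finite) rmfd \<Rightarrow> 'a \<Rightarrow> ('a, 'k) chart" where
  "chart_at M p = (SOME c. c \<in> charts M \<and> p \<in> fst c)"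

definition coord :: "('a, 'k::finite) rmfd \<Rightarrow> 'a \<Rightarrow> real^'k" where
  "coord M p = snd (chart_at M p) p"

definition to_chart ::
    "('a, 'k::finite) rmfd \<Rightarrow> ('a, 'k) chart \<Rightarrow> 'a \<Rightarrow> real^'k \<Rightarrow> real^'k" where
  "to_chart M c p v = dird (snd c \<circ> chart_inv (chart_at M p)) (coord M p) v"

definition from_chart ::
    "('a, 'k::finite) rmfd \<Rightarrow> ('a, 'k) chart \<Rightarrow> 'a \<Rightarrow> real^'k \<Rightarrow> real^'k" where
  "from_chart M c p v = dird (snd (chart_at M p) \<circ> chart_inv c) (snd c p) v"

definition metric_in ::
    "('a, 'k::finite) rmfd \<Rightarrow> ('a, 'k) chart \<Rightarrow> real^'k \<Rightarrow> real^'k \<Rightarrow> real^'k \<Rightarrow> real" where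
  "metric_in M c x v w =
     (let p = chart_inv c x in metric M p (from_chart M c p v) (from_chart M c p w))"

text \<open>Boundaryless; connectedness is not included.\<close>

definition riemannian_manifold ::
    "('a::{t2_space, second_countable_topology}, 'k::finite) rmfd \<Rightarrow> bool" where
  "riemannian_manifold M \<longleftrightarrow>
     smooth_atlas (charts M) \<and>
     (\<forall>p. bilinear (metric M p) \<and> (\<forall>v w. metric M p v w = metric M p w v) \<and>
          (\<forall>v. v \<noteq> 0 \<longrightarrow> metric M p v v > 0)) \<and>
     (\<forall>c\<in>charts M. \<forall>v w. smooth_on (\<lambda>x. metric_in M c x v w) (snd c ` fst c))"

definition gram :: "('a, 'k::finite) rmfd \<Rightarrow> ('a, 'k) chart \<Rightarrow> real^'k \<Rightarrow> real^'k^'k" where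
  "gram M c x = (\<chi> i j. metric_in M c x (axis i 1) (axis j 1))"

definition riemannian_volume ::
    "('a::topological_space, 'k::finite) rmfd \<Rightarrow> 'a measure \<Rightarrow> bool" where
  "riemannian_volume M \<mu> \<longleftrightarrow> sets \<mu> = sets borel \<and>
     (\<forall>c\<in>charts M. \<forall>X\<in>sets borel. X \<subseteq> fst c \<longrightarrow>
        emeasure \<mu> X =
          (\<integral>\<^sup>+x. ennreal (sqrt (det (gram M c x))) * indicator (snd c ` X) x \<partial>lborel))"

text \<open>As the index type is the one of the coordinates, an orthonormal family of this form is a
  basis of the tangent space.  The expressions below that use \<open>frame_at\<close> are independent of the
  choice of the orthonormal basis.\<close>

definition orthonormal_frame ::
    "('a, 'k::finite) rmfd \<Rightarrow> 'a \<Rightarrow> ('k \<Rightarrow> real^'k) \<Rightarrow> bool" where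
  "orthonormal_frame M p e \<longleftrightarrow> (\<forall>i j. metric M p (e i) (e j) = (if i = j then 1 else 0))"

definition frame_at :: "('a, 'k::finite) rmfd \<Rightarrow> 'a \<Rightarrow> 'k \<Rightarrow> real^'k" where
  "frame_at M p = (SOME e. orthonormal_frame M p e)"


section \<open>Levi-Civita connection and curvature\<close>

text \<open>\<open>christoffel1 M c x v w z\<close> is \<open>g(\<nabla>\<^bsub>v\<^esub> w, z)\<close> at \<open>x\<close> for vector fields \<open>v, w, z\<close> that are
  constant in the chart \<open>c\<close> (Koszul formula); \<open>christoffel M c x v w\<close> is \<open>\<nabla>\<^bsub>v\<^esub> w\<close> itself, that is
  \<open>\<Gamma>\<^sup>k\<^sub>i\<^sub>j v\<^sup>i w\<^sup>j\<close>.\<close>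

definition christoffel1 ::
    "('a, 'k::finite) rmfd \<Rightarrow> ('a, 'k) chart \<Rightarrow> real^'k \<Rightarrow> real^'k \<Rightarrow> real^'k \<Rightarrow> real^'k \<Rightarrow> real" where
  "christoffel1 M c x v w z =
     (dird (\<lambda>y. metric_in M c y w z) x v + dird (\<lambda>y. metric_in M c y v z) x w
        - dird (\<lambda>y. metric_in M c y v w) x z) / 2"

definition christoffel ::
    "('a, 'k::finite) rmfd \<Rightarrow> ('a, 'k) chart \<Rightarrow> real^'k \<Rightarrow> real^'k \<Rightarrow> real^'k \<Rightarrow> real^'k" where
  "christoffel M c x v w = matrix_inv (gram M c x) *v (\<chi> l. christoffel1 M c x v w (axis l 1))"

definition gamma_at :: "('a, 'k::finite) rmfd \<Rightarrow> 'a \<Rightarrow> real^'k \<Rightarrow> real^'k \<Rightarrow> real^'k" where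
  "gamma_at M p = christoffel M (chart_at M p) (coord M p)"

text \<open>\<open>R(v,w)z = \<nabla>\<^bsub>v\<^esub>\<nabla>\<^bsub>w\<^esub>z - \<nabla>\<^bsub>w\<^esub>\<nabla>\<^bsub>v\<^esub>z - \<nabla>\<^bsub>[v,w]\<^esub>z\<close>, so that \<open>g(R(v,w)w,v)\<close> is the sectional
  curvature for orthonormal \<open>v, w\<close>.\<close>

definition curvature ::
    "('a, 'k::finite) rmfd \<Rightarrow> 'a \<Rightarrow> real^'k \<Rightarrow> real^'k \<Rightarrow> real^'k \<Rightarrow> real^'k" where
  "curvature M p v w z =
     (let \<Gamma> = christoffel M (chart_at M p); x = coord M p in
        dird (\<lambda>y. \<Gamma> y w z) x v - dird (\<lambda>y. \<Gamma> y v z) x w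
        + \<Gamma> x v (\<Gamma> x w z) - \<Gamma> x w (\<Gamma> x v z))"


section \<open>Functions on a manifold with values in a Euclidean space\<close>

definition mfd_Ck :: "nat \<Rightarrow> ('a, 'k::finite) rmfd \<Rightarrow> ('a \<Rightarrow> 'b::real_normed_vector) \<Rightarrow> bool" where
  "mfd_Ck k M f \<longleftrightarrow> (\<forall>c\<in>charts M. Ck_on k (f \<circ> chart_inv c) (snd c ` fst c))"

definition diff_fun ::
    "('a, 'k::finite) rmfd \<Rightarrow> ('a \<Rightarrow> 'b::real_normed_vector) \<Rightarrow> 'a \<Rightarrow> real^'k \<Rightarrow> 'b" where
  "diff_fun M f p v = dird (f \<circ> chart_inv (chart_at M p)) (coord M p) v"

text \<open>\<open>\<nabla>\<^sup>2f(v,w) = v(w f) - (\<nabla>\<^bsub>v\<^esub>w)f\<close>\<close>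

definition cov_hessian ::
    "('a, 'k::finite) rmfd \<Rightarrow> ('a \<Rightarrow> 'b::real_normed_vector) \<Rightarrow> 'a \<Rightarrow> real^'k \<Rightarrow> real^'k \<Rightarrow> 'b" where
  "cov_hessian M f p v w =
     (let h = f \<circ> chart_inv (chart_at M p) in
        dird (\<lambda>y. dird h y w) (coord M p) v - diff_fun M f p (gamma_at M p v w))"

definition isometric_immersion :: "('a, 'k::finite) rmfd \<Rightarrow> ('a \<Rightarrow> real^'r) \<Rightarrow> bool" where
  "isometric_immersion M \<iota> \<longleftrightarrow> (\<forall>k. mfd_Ck k M \<iota>) \<and>
     (\<forall>p v w. diff_fun M \<iota> p v \<bullet> diff_fun M \<iota> p w = metric M p v w)"

text \<open>Gauss formula: \<open>B(v,w)\<close> is the flat derivative of \<open>d\<iota>(w)\<close> along \<open>v\<close> minus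
  \<open>d\<iota>(\<nabla>\<^bsub>v\<^esub>w)\<close>.\<close>

definition second_ff ::
    "('a, 'k::finite) rmfd \<Rightarrow> ('a \<Rightarrow> real^'r) \<Rightarrow> 'a \<Rightarrow> real^'k \<Rightarrow> real^'k \<Rightarrow> real^'r" where
  "second_ff M \<iota> p v w = cov_hessian M \<iota> p v w"


section \<open>\<open>\<Phi>\<close>-superstrongly unstable manifolds\<close>

definition ssu_form :: "('a, 'k::finite) rmfd \<Rightarrow> ('a \<Rightarrow> real^'r) \<Rightarrow> 'a \<Rightarrow> real^'k \<Rightarrow> real" where
  "ssu_form M \<iota> p X =
     (let e = frame_at M p; B = second_ff M \<iota> p in
        \<Sum>i\<in>UNIV. 4 * (B X (e i) \<bullet> B X (e i)) - B X X \<bullet> B (e i) (e i))"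

definition unit_bundle :: "('a, 'k::finite) rmfd \<Rightarrow> ('a \<times> (real^'k)) set" where
  "unit_bundle M = {(x, X). metric M x X X = 1}"

text \<open>A manifold is \<open>\<Phi>\<close>-SSU iff such a \<open>\<iota>\<close> exists for some dimension of the ambient space.\<close>

definition realizes_Phi_SSU :: "('a, 'k::finite) rmfd \<Rightarrow> ('a \<Rightarrow> real^'r) \<Rightarrow> bool" where
  "realizes_Phi_SSU M \<iota> \<longleftrightarrow> CARD('k) < CARD('r) \<and> isometric_immersion M \<iota> \<and>
     (\<forall>(x, X)\<in>unit_bundle M. ssu_form M \<iota> x X < 0)"

definition ssu_ratios :: "('a, 'k::finite) rmfd \<Rightarrow> ('a \<Rightarrow> real^'r) \<Rightarrow> real set" where
  "ssu_ratios M \<iota> =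
     {- ssu_form M \<iota> x X / (8 * norm (second_ff M \<iota> x X X) * norm (second_ff M \<iota> y Y Y)) | x X y Y.
        (x, X) \<in> unit_bundle M \<and> (y, Y) \<in> unit_bundle M}"

definition ssu_const :: "('a, 'k::finite) rmfd \<Rightarrow> ('a \<Rightarrow> real^'r) \<Rightarrow> real" where
  "ssu_const M \<iota> = Inf (ssu_ratios M \<iota>)"


section \<open>Maps between manifolds and vector fields along maps\<close>

definition smooth_map ::
    "('n::topological_space, 'k::finite) rmfd \<Rightarrow> ('m::topological_space, 'l::finite) rmfd \<Rightarrow>
     ('n \<Rightarrow> 'm) \<Rightarrow> bool" where
  "smooth_map N M u \<longleftrightarrow> continuous_on UNIV u \<and>
     (\<forall>c\<in>charts N. \<forall>d\<in>charts M.
        smooth_on (snd d \<circ> u \<circ> chart_inv c) (snd c ` (fst c \<inter> u -` fst d)))"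

definition diff_map ::
    "('n, 'k::finite) rmfd \<Rightarrow> ('m, 'l::finite) rmfd \<Rightarrow> ('n \<Rightarrow> 'm) \<Rightarrow> 'n \<Rightarrow> real^'k \<Rightarrow> real^'l" where
  "diff_map N M u p v =
     dird (snd (chart_at M (u p)) \<circ> u \<circ> chart_inv (chart_at N p)) (coord N p) v"

text \<open>A vector field along \<open>u\<close> is a function \<open>V\<close> where \<open>V p\<close> is a tangent vector of \<open>M\<close> at
  \<open>u p\<close>.\<close>

definition field_in ::
    "('n, 'k::finite) rmfd \<Rightarrow> ('m, 'l::finite) rmfd \<Rightarrow> ('n \<Rightarrow> 'm) \<Rightarrow> ('n \<Rightarrow> real^'l) \<Rightarrow>
     ('n, 'k) chart \<Rightarrow> ('m, 'l) chart \<Rightarrow> real^'k \<Rightarrow> real^'l" where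
  "field_in N M u V c d x = (let p = chart_inv c x in to_chart M d (u p) (V p))"

definition smooth_field_along ::
    "('n, 'k::finite) rmfd \<Rightarrow> ('m, 'l::finite) rmfd \<Rightarrow> ('n \<Rightarrow> 'm) \<Rightarrow> ('n \<Rightarrow> real^'l) \<Rightarrow> bool" where
  "smooth_field_along N M u V \<longleftrightarrow>
     (\<forall>c\<in>charts N. \<forall>d\<in>charts M.
        smooth_on (field_in N M u V c d) (snd c ` (fst c \<inter> u -` fst d)))"

text \<open>The induced connection on the pull-back bundle:
  \<open>pullback_nabla N M u V p v\<close> is \<open>\<nabla>\<^bsub>v\<^esub> V\<close>.\<close>

definition pullback_nabla ::
    "('n, 'k::finite) rmfd \<Rightarrow> ('m, 'l::finite) rmfd \<Rightarrow> ('n \<Rightarrow> 'm) \<Rightarrow> ('n \<Rightarrow> real^'l) \<Rightarrow>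
     'n \<Rightarrow> real^'k \<Rightarrow> real^'l" where
  "pullback_nabla N M u V p v =
     dird (field_in N M u V (chart_at N p) (chart_at M (u p))) (coord N p) v
     + gamma_at M (u p) (diff_map N M u p v) (V p)"


section \<open>\<open>F\<close>-symphonic maps with potential\<close>

text \<open>\<open>norm_pullback_sq\<close> is \<open>\<parallel>u\<^sup>*g\<parallel>\<^sup>2\<close>.\<close>

definition norm_pullback_sq ::
    "('n, 'k::finite) rmfd \<Rightarrow> ('m, 'l::finite) rmfd \<Rightarrow> ('n \<Rightarrow> 'm) \<Rightarrow> 'n \<Rightarrow> real" where
  "norm_pullback_sq N M u p =
     (let e = frame_at N p; du = diff_map N M u p in
        \<Sum>i\<in>UNIV. \<Sum>j\<in>UNIV. (metric M (u p) (du (e i)) (du (e j)))\<^sup>2)"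

definition sigma_map ::
    "('n, 'k::finite) rmfd \<Rightarrow> ('m, 'l::finite) rmfd \<Rightarrow> ('n \<Rightarrow> 'm) \<Rightarrow> 'n \<Rightarrow> real^'k \<Rightarrow> real^'l" where
  "sigma_map N M u p X =
     (let e = frame_at N p; du = diff_map N M u p in
        \<Sum>j\<in>UNIV. metric M (u p) (du X) (du (e j)) *\<^sub>R du (e j))"

definition energy_density ::
    "('n, 'k::finite) rmfd \<Rightarrow> ('m, 'l::finite) rmfd \<Rightarrow> (real \<Rightarrow> real) \<Rightarrow> ('m \<Rightarrow> real) \<Rightarrow>
     ('n \<Rightarrow> 'm) \<Rightarrow> 'n \<Rightarrow> real" where
  "energy_density N M F H u p = F (norm_pullback_sq N M u p / 4) + H (u p)"

text \<open>A smooth variation \<open>U\<close> of \<open>u\<close> with support in the compact set \<open>K\<close>.\<close>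

definition variation_on ::
    "('n::topological_space, 'k::finite) rmfd \<Rightarrow> ('m::topological_space, 'l::finite) rmfd \<Rightarrow>
     ('n \<Rightarrow> 'm) \<Rightarrow> 'n set \<Rightarrow> real \<Rightarrow> (real \<Rightarrow> 'n \<Rightarrow> 'm) \<Rightarrow> bool" where
  "variation_on N M u K \<epsilon> U \<longleftrightarrow>
     compact K \<and> 0 < \<epsilon> \<and> U 0 = u \<and> (\<forall>t\<in>{-\<epsilon><..<\<epsilon>}. \<forall>p. p \<notin> K \<longrightarrow> U t p = u p) \<and>
     continuous_on ({-\<epsilon><..<\<epsilon>} \<times> UNIV) (\<lambda>(t, p). U t p) \<and>
     (\<forall>c\<in>charts N. \<forall>d\<in>charts M.
        smooth_on (\<lambda>(t, x). snd d (U t (chart_inv c x)))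
          {(t, x). t \<in> {-\<epsilon><..<\<epsilon>} \<and> x \<in> snd c ` fst c \<and> U t (chart_inv c x) \<in> fst d})"

text \<open>Critical points of \<open>\<Phi>\<^sub>s\<^sub>y\<^sub>m\<close>.  As the total energy may be infinite if \<open>N\<close> is not compact,
  variations are compactly supported and only the energy of the support is compared, as usual.
  For compact \<open>N\<close> this covers all smooth variations, with \<open>K = UNIV\<close>.\<close>

definition F_symphonic ::
    "('n::topological_space, 'k::finite) rmfd \<Rightarrow> 'n measure \<Rightarrow>
     ('m::topological_space, 'l::finite) rmfd \<Rightarrow> (real \<Rightarrow> real) \<Rightarrow> ('m \<Rightarrow> real) \<Rightarrow>
     ('n \<Rightarrow> 'm) \<Rightarrow> bool" where
  "F_symphonic N \<mu> M F H u \<longleftrightarrow> smooth_map N M u \<and>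
     (\<forall>K \<epsilon> U. variation_on N M u K \<epsilon> U \<longrightarrow>
        ((\<lambda>t. LINT p:K|\<mu>. energy_density N M F H (U t) p) has_real_derivative 0) (at 0))"


section \<open>Index form and stability\<close>

text \<open>\<open>F1\<close> and \<open>F2\<close> stand for the first and second derivative of \<open>F\<close>.\<close>

definition C2_halfline :: "(real \<Rightarrow> real) \<Rightarrow> (real \<Rightarrow> real) \<Rightarrow> (real \<Rightarrow> real) \<Rightarrow> bool" where
  "C2_halfline F F1 F2 \<longleftrightarrow>
     (\<forall>t\<ge>0. (F has_real_derivative F1 t) (at t within {0..}) \<and>
            (F1 has_real_derivative F2 t) (at t within {0..})) \<and>
     continuous_on {0..} F2"

definition index_density ::
    "('n, 'k::finite) rmfd \<Rightarrow> ('m, 'l::finite) rmfd \<Rightarrow> (real \<Rightarrow> real) \<Rightarrow> (real \<Rightarrow> real) \<Rightarrow>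
     ('m \<Rightarrow> real) \<Rightarrow> ('n \<Rightarrow> 'm) \<Rightarrow> ('n \<Rightarrow> real^'l) \<Rightarrow> 'n \<Rightarrow> real" where
  "index_density N M F1 F2 H u V p =
     (let e = frame_at N p; g = metric M (u p); t = norm_pullback_sq N M u p / 4;
          d = (\<lambda>i. diff_map N M u p (e i));
          D = (\<lambda>i. pullback_nabla N M u V p (e i));
          R = curvature M (u p)
      in cov_hessian M H (u p) (V p) (V p)
         + F2 t * (\<Sum>i\<in>UNIV. g (D i) (sigma_map N M u p (e i)))\<^sup>2
         + F1 t * (\<Sum>i\<in>UNIV. \<Sum>j\<in>UNIV.
             g (D i) (D j) * g (d i) (d j) + (g (D i) (d j))\<^sup>2
             + g (D i) (d j) * g (d i) (D j)
             + g (R (V p) (d i) (V p)) (d j) * g (d i) (d j)))"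

text \<open>For compact \<open>N\<close> the density is integrable and the index form is its ordinary Lebesgue
  integral.  In general it is an extended real number, which is meaningful if the positive or
  the negative part of the density has a finite integral.  A nonnegative value needs the
  latter, hence the first condition on the index form in \<open>Phi_sym_stable\<close>.\<close>

definition index_neg_part ::
    "('n, 'k::finite) rmfd \<Rightarrow> 'n measure \<Rightarrow> ('m, 'l::finite) rmfd \<Rightarrow> (real \<Rightarrow> real) \<Rightarrow>
     (real \<Rightarrow> real) \<Rightarrow> ('m \<Rightarrow> real) \<Rightarrow> ('n \<Rightarrow> 'm) \<Rightarrow> ('n \<Rightarrow> real^'l) \<Rightarrow> ennreal" where
  "index_neg_part N \<mu> M F1 F2 H u V =
     (\<integral>\<^sup>+p. ennreal (- index_density N M F1 F2 H u V p) \<partial>\<mu>)"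

definition index_form ::
    "('n, 'k::finite) rmfd \<Rightarrow> 'n measure \<Rightarrow> ('m, 'l::finite) rmfd \<Rightarrow> (real \<Rightarrow> real) \<Rightarrow>
     (real \<Rightarrow> real) \<Rightarrow> ('m \<Rightarrow> real) \<Rightarrow> ('n \<Rightarrow> 'm) \<Rightarrow> ('n \<Rightarrow> real^'l) \<Rightarrow> ereal" where
  "index_form N \<mu> M F1 F2 H u V =
     enn2ereal (\<integral>\<^sup>+p. ennreal (index_density N M F1 F2 H u V p) \<partial>\<mu>)
     - enn2ereal (index_neg_part N \<mu> M F1 F2 H u V)"

definition Phi_sym_stable ::
    "('n, 'k::finite) rmfd \<Rightarrow> 'n measure \<Rightarrow> ('m, 'l::finite) rmfd \<Rightarrow> (real \<Rightarrow> real) \<Rightarrow>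
     (real \<Rightarrow> real) \<Rightarrow> ('m \<Rightarrow> real) \<Rightarrow> ('n \<Rightarrow> 'm) \<Rightarrow> bool" where
  "Phi_sym_stable N \<mu> M F1 F2 H u \<longleftrightarrow>
     (\<forall>V. smooth_field_along N M u V \<and> V \<noteq> (\<lambda>_. 0) \<longrightarrow>
        index_neg_part N \<mu> M F1 F2 H u V < \<infinity> \<and> 0 \<le> index_form N \<mu> M F1 F2 H u V)"

end

theory Submission
  imports Defs
begin

text \<open>
  For a vector \<open>E\<close> of the ambient \<open>\<real>\<^sup>r\<close> test stability with \<open>V\<^sub>E\<close>, the tangential projection of
  \<open>E\<close> along \<open>u\<close>, and sum over the standard basis.  Since \<open>g(\<nabla>\<^sub>X V\<^sub>E, Y) = \<langle>B(du X, Y), E\<rangle>\<close>, the Gauss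
  equation expresses the sum of the index densities through \<open>B\<close>.  With \<open>S = du du\<^sup>T\<close>, regarded as an
  operator on \<open>\<real>\<^sup>r\<close>, the \<open>F'\<close> term is at most \<open>F' \<Sum>\<^sub>b Q(S b)\<close>, because \<open>tr(SBSB) \<le> tr(S\<^sup>2B\<^sup>2)\<close>,
  and the \<open>F''\<close> term is \<open>F'' |\<Sum>\<^sub>b B(S b, S b)|\<^sup>2\<close>, which the definition of \<open>a\<close> and \<open>t F'' < a F'\<close> bound
  by \<open>-F'/2 \<Sum>\<^sub>b Q(S b)\<close>; here \<open>4t = \<parallel>u\<^sup>*g\<parallel>\<^sup>2 = \<Sum>\<^sub>b |S b|\<^sup>2\<close>.  So the sum is negative wherever \<open>du \<noteq> 0\<close>, and
  by stability \<open>du\<close> vanishes almost everywhere, hence everywhere.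

  The Hessian of the potential is nonpositive and may be dropped before integrating, and \<open>S\<close> needs no
  eigenbasis.  Extending \<open>B\<close> to \<open>\<real>\<^sup>r\<close> by the tangential projection replaces frames of \<open>M\<close> by the
  standard basis and makes continuity on \<open>M\<close> expressible without choosing charts.
\<close>

section \<open>Calculus of \<open>C\<^sup>k\<close> maps\<close>

text \<open>Orthonormal frames are pointwise choices without any continuity, so integrands built
  from them are not visibly measurable. All of them are rewritten through the sums of <du(e_i), b>
  <du(e_i), c> over i, for ambient vectors b and c, which are continuous whatever frame is chosen.

  Summing over an ambient basis works because Parseval turns the squared components <B, E>^2 into
  |B|^2. The 4 in Q is 2 + 2: one 2 from |\<nabla>V|^2 and the curvature, the other from the two
  remaining terms, which agree by the symmetry of B. The minimum a, applied to all pairs S b, S c,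
  bounds 8 a (\<Sum> |B(S b, S b)|)^2 by 4 t \<Sum> -Q(S b); this is the origin of the factor 1/2.

  As N may be noncompact, index forms are extended reals and cannot simply be added; finite negative
  parts allow positive and negative integrals to be summed separately. Strict negativity needs F' >
  0 for t > 0, which comes from monotonicity together with t F'' < a F'.\<close>

lemma dird_eqI: "(f has_derivative f') (at x) \<Longrightarrow> dird f x = f'"
  using frechet_derivative_at[of f f' x] by (auto simp: dird_def fun_eq_iff)

lemma has_derivative_dird: "f differentiable (at x) \<Longrightarrow> (f has_derivative dird f x) (at x)"
  using frechet_derivative_works[of f "at x"] by (simp add: dird_def[abs_def])

lemma linear_dird: "f differentiable (at x) \<Longrightarrow> linear (dird f x)"
  using has_derivative_dird has_derivative_linear by blast

text \<open>Differentiability is not assumed: both functions have the same derivatives at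
  \<open>x\<close>, so the choice operator inside \<open>frechet_derivative\<close> returns the same
  value for both.\<close>

lemma dird_cong_open:
  assumes "open S" "x \<in> S" "\<And>y. y \<in> S \<Longrightarrow> f y = g y"
  shows "dird f x = dird g x"
proof -
  have "(f has_derivative D) (at x) \<longleftrightarrow> (g has_derivative D) (at x)" for D
    using has_derivative_transform_within_open[of f D x UNIV S g]
      has_derivative_transform_within_open[of g D x UNIV S f] assms by auto
  then show ?thesis
    by (simp add: dird_def fun_eq_iff frechet_derivative_def)
qed

lemma differentiable_cong_open:
  assumes "f differentiable (at x)" "open S" "x \<in> S" "\<And>y. y \<in> S \<Longrightarrow> f y = g y"
  shows "g differentiable (at x)"
  using assms has_derivative_transform_within_open[of f _ x UNIV S g]
  unfolding differentiable_def by blast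

lemma dird_compose:
  assumes "g differentiable (at x)" "f differentiable (at (g x))"
  shows "dird (\<lambda>y. f (g y)) x v = dird f (g x) (dird g x v)"
proof -
  have "((\<lambda>y. f (g y)) has_derivative (\<lambda>v. dird f (g x) (dird g x v))) (at x)"
    by (rule has_derivative_compose[OF has_derivative_dird[OF assms(1)] has_derivative_dird[OF assms(2)]])
  from dird_eqI[OF this] show ?thesis by simp
qed

lemma Ck_on_Suc:
  "Ck_on (Suc k) f S \<longleftrightarrow> (\<forall>x\<in>S. f differentiable (at x)) \<and> (\<forall>v. Ck_on k (\<lambda>x. dird f x v) S)"
  by (simp add: dird_def)

declare Ck_on.simps(2) [simp del]

lemma Ck_on_cong:
  assumes "open S" "\<And>x. x \<in> S \<Longrightarrow> f x = g x" "Ck_on k f S"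
  shows "Ck_on k g S"
  using assms(2,3)
proof (induction k arbitrary: f g)
  case 0
  then show ?case by (simp cong: continuous_on_cong)
next
  case (Suc k)
  have "g differentiable (at x)" if "x \<in> S" for x
  proof (rule differentiable_cong_open[OF _ assms(1) that Suc.prems(1)])
    show "f differentiable (at x)" using Suc.prems(2) that unfolding Ck_on_Suc by blast
  qed
  moreover have "Ck_on k (\<lambda>x. dird g x v) S" for v
  proof (rule Suc.IH)
    show "dird f x v = dird g x v" if "x \<in> S" for x
      using dird_cong_open[OF assms(1) that] Suc.prems(1) by metis
  qed (use Suc.prems(2) in \<open>auto simp: Ck_on_Suc\<close>)
  ultimately show ?case by (auto simp: Ck_on_Suc)
qed

lemma Ck_on_differentiable: "Ck_on (Suc k) f S \<Longrightarrow> x \<in> S \<Longrightarrow> f differentiable (at x)"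
  by (auto simp: Ck_on_Suc)

lemma Ck_on_dird: "Ck_on (Suc k) f S \<Longrightarrow> Ck_on k (\<lambda>x. dird f x v) S"
  by (auto simp: Ck_on_Suc)

lemma Ck_on_SucD: "Ck_on (Suc k) f S \<Longrightarrow> Ck_on k f S"
proof (induction k arbitrary: f)
  case 0
  then show ?case
    by (auto simp: Ck_on_Suc intro!: differentiable_imp_continuous_on
        differentiable_at_imp_differentiable_on)
next
  case (Suc k)
  have "Ck_on k (\<lambda>x. dird f x v) S" for v
    by (rule Suc.IH[OF Ck_on_dird[OF Suc.prems]])
  then show ?case using Ck_on_differentiable[OF Suc.prems] by (simp add: Ck_on_Suc[of k f S])
qed

lemma Ck_on_imp_continuous: "Ck_on k f S \<Longrightarrow> continuous_on S f"
  by (induction k) (auto dest: Ck_on_SucD)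

lemma smooth_on_Ck: "smooth_on f S \<Longrightarrow> Ck_on k f S"
  by (simp add: smooth_on_def)

lemma smooth_on_differentiable: "smooth_on f S \<Longrightarrow> x \<in> S \<Longrightarrow> f differentiable (at x)"
  using smooth_on_Ck Ck_on_differentiable by blast

lemma Ck_on_const: "Ck_on k (\<lambda>x. c) S"
  by (induction k arbitrary: c) (simp_all add: Ck_on_Suc dird_def)

lemma Ck_on_add:
  assumes "open S" "Ck_on k f S" "Ck_on k g S"
  shows "Ck_on k (\<lambda>x. f x + g x) S"
  using assms(2,3)
proof (induction k arbitrary: f g)
  case 0
  then show ?case by (simp add: continuous_on_add)
next
  case (Suc k)
  have der: "((\<lambda>x. f x + g x) has_derivative (\<lambda>v. dird f x v + dird g x v)) (at x)" if "x \<in> S" for x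
    using Suc.prems that by (intro has_derivative_add has_derivative_dird) (auto simp: Ck_on_Suc)
  have "Ck_on k (\<lambda>x. dird (\<lambda>x. f x + g x) x v) S" for v
    by (rule Ck_on_cong[OF assms(1) _ Suc.IH, of "\<lambda>x. dird f x v" "\<lambda>x. dird g x v"])
      (use Suc.prems dird_eqI[OF der] in \<open>auto simp: Ck_on_Suc\<close>)
  then show ?case using der by (auto simp: Ck_on_Suc differentiable_def)
qed

lemma Ck_on_bilinear:
  assumes "bounded_bilinear b" "Ck_on k f S" "Ck_on k g S" "open S"
  shows "Ck_on k (\<lambda>x. b (f x) (g x)) S"
  using assms(2,3)
proof (induction k arbitrary: f g)
  case 0
  then show ?case by (simp add: bounded_bilinear.continuous_on[OF assms(1)])
next
  case (Suc k)
  have der: "((\<lambda>x. b (f x) (g x)) has_derivative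
      (\<lambda>v. b (f x) (dird g x v) + b (dird f x v) (g x))) (at x)" if "x \<in> S" for x
    using Suc.prems that
    by (intro bounded_bilinear.FDERIV[OF assms(1)] has_derivative_dird) (auto simp: Ck_on_Suc)
  have "Ck_on k (\<lambda>x. dird (\<lambda>x. b (f x) (g x)) x v) S" for v
    by (rule Ck_on_cong[OF assms(4) _ Ck_on_add[OF assms(4) Suc.IH Suc.IH], of f "\<lambda>x. dird g x v" "\<lambda>x. dird f x v" g])
      (use dird_eqI[OF der] Ck_on_dird[OF Suc.prems(1)] Ck_on_dird[OF Suc.prems(2)]
          Ck_on_SucD[OF Suc.prems(1)] Ck_on_SucD[OF Suc.prems(2)] in auto)
  then show ?case using der by (auto simp: Ck_on_Suc differentiable_def)
qed

lemmas Ck_on_scaleR = Ck_on_bilinear[OF bounded_bilinear_scaleR]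
lemmas Ck_on_mult = Ck_on_bilinear[OF bounded_bilinear_mult]
lemmas Ck_on_inner = Ck_on_bilinear[OF bounded_bilinear_inner]

lemma Ck_on_sum:
  assumes "open S" "\<And>i. i \<in> I \<Longrightarrow> Ck_on k (f i) S"
  shows "Ck_on k (\<lambda>x. \<Sum>i\<in>I. f i x) S"
  using assms(2)
  by (induction I rule: infinite_finite_induct) (auto intro: Ck_on_const Ck_on_add assms(1))

lemma Ck_on_prod:
  fixes f :: "'i \<Rightarrow> 'a::real_normed_vector \<Rightarrow> real"
  assumes "open S" "\<And>i. i \<in> I \<Longrightarrow> Ck_on k (f i) S"
  shows "Ck_on k (\<lambda>x. \<Prod>i\<in>I. f i x) S"
  using assms(2)
  by (induction I rule: infinite_finite_induct) (auto intro: Ck_on_const Ck_on_mult assms(1))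

text \<open>The derivative -f'/f^2 contains the reciprocal again, but one order lower, so the
  induction closes on the same \<open>f\<close>.\<close>

lemma Ck_on_inverse:
  fixes f :: "'a::real_normed_vector \<Rightarrow> real"
  assumes "open S" "Ck_on k f S" "\<And>x. x \<in> S \<Longrightarrow> f x \<noteq> 0"
  shows "Ck_on k (\<lambda>x. inverse (f x)) S"
  using assms(2)
proof (induction k)
  case 0
  then show ?case using assms(3) by (auto intro: continuous_on_inverse)
next
  case (Suc k)
  have der: "((\<lambda>x. inverse (f x)) has_derivative
      (\<lambda>v. - (inverse (f x) * dird f x v * inverse (f x)))) (at x)" if "x \<in> S" for x
    using Suc.prems that assms(3) by (intro Deriv.has_derivative_inverse has_derivative_dird) (auto simp: Ck_on_Suc)
  have "Ck_on k (\<lambda>x. (-1) * (inverse (f x) * dird f x v * inverse (f x))) S" for v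
    using Suc.IH[OF Ck_on_SucD[OF Suc.prems]] Ck_on_dird[OF Suc.prems] assms(1)
    by (intro Ck_on_mult Ck_on_const)
  then have "Ck_on k (\<lambda>x. dird (\<lambda>x. inverse (f x)) x v) S" for v
    by (rule Ck_on_cong[OF assms(1), rotated]) (use dird_eqI[OF der] in auto)
  then show ?case using der by (auto simp: Ck_on_Suc differentiable_def)
qed

text \<open>\<open>Ck_on\<close> controls derivatives in fixed directions only. This expansion
  reduces a direction that varies with the point, as in the chain rule, to fixed ones.\<close>

lemma dird_basis_sum:
  fixes f :: "'a::euclidean_space \<Rightarrow> 'b::real_normed_vector"
  assumes "f differentiable (at x)"
  shows "dird f x v = (\<Sum>i\<in>Basis. (v \<bullet> i) *\<^sub>R dird f x i)"
proof -
  have "dird f x (\<Sum>i\<in>Basis. (v \<bullet> i) *\<^sub>R i) = (\<Sum>i\<in>Basis. (v \<bullet> i) *\<^sub>R dird f x i)"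
    using linear_dird[OF assms] by (simp add: linear_sum linear_scale)
  then show ?thesis by (simp add: euclidean_representation)
qed

lemma Ck_on_compose:
  fixes f :: "'b::euclidean_space \<Rightarrow> 'c::real_normed_vector"
    and g :: "'a::real_normed_vector \<Rightarrow> 'b"
  assumes "open S" "open T" "Ck_on k f T" "Ck_on k g S" "\<And>x. x \<in> S \<Longrightarrow> g x \<in> T"
  shows "Ck_on k (\<lambda>x. f (g x)) S"
  using assms(3,4)
proof (induction k arbitrary: f)
  case 0
  then show ?case using assms(5) by (auto intro: continuous_on_compose2)
next
  case (Suc k)
  have d: "g differentiable (at x)" "f differentiable (at (g x))" if "x \<in> S" for x
    using Suc.prems that assms(5) by (auto simp: Ck_on_Suc)
  have "(\<lambda>x. f (g x)) differentiable (at x)" if "x \<in> S" for x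
    using differentiable_chain_at[OF d[OF that]] by (simp add: o_def)
  moreover have "Ck_on k (\<lambda>x. \<Sum>i\<in>Basis. (dird g x v \<bullet> i) *\<^sub>R dird f (g x) i) S" for v
    using Suc.prems assms(1)
    by (intro Ck_on_sum Ck_on_scaleR Ck_on_inner Ck_on_const Suc.IH) (auto dest: Ck_on_SucD Ck_on_dird)
  then have "Ck_on k (\<lambda>x. dird (\<lambda>x. f (g x)) x v) S" for v
    by (rule Ck_on_cong[OF assms(1), rotated]) (simp add: d dird_compose flip: dird_basis_sum)
  ultimately show ?case by (auto simp: Ck_on_Suc)
qed

lemma Ck_on_dird_field:
  fixes f :: "'b::euclidean_space \<Rightarrow> 'c::real_normed_vector"
  assumes "open S" "Ck_on (Suc k) f S" "Ck_on k v S"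
  shows "Ck_on k (\<lambda>x. dird f x (v x)) S"
proof -
  have "Ck_on k (\<lambda>x. \<Sum>i\<in>Basis. (v x \<bullet> i) *\<^sub>R dird f x i) S"
    using assms by (intro Ck_on_sum Ck_on_scaleR Ck_on_inner Ck_on_const Ck_on_dird)
  then show ?thesis
    by (rule Ck_on_cong[OF assms(1), rotated])
      (simp add: Ck_on_differentiable[OF assms(2)] flip: dird_basis_sum)
qed

lemma Ck_on_vec_lambda:
  fixes f :: "'a::real_normed_vector \<Rightarrow> 'n::finite \<Rightarrow> real"
  assumes "open S" "\<And>i. Ck_on k (\<lambda>x. f x i) S"
  shows "Ck_on k (\<lambda>x. \<chi> i. f x i) S"
proof -
  have "(\<chi> i. f x i) = (\<Sum>i\<in>UNIV. f x i *\<^sub>R axis i 1)" for x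
    by (simp add: vec_eq_iff sum_component axis_def if_distrib cong: if_cong)
  moreover have "Ck_on k (\<lambda>x. \<Sum>i\<in>UNIV. f x i *\<^sub>R axis i (1::real)) S"
    using assms by (intro Ck_on_sum Ck_on_scaleR Ck_on_const)
  ultimately show ?thesis by simp
qed

lemma Ck_on_det:
  fixes A :: "'a::real_normed_vector \<Rightarrow> real^'n::finite^'n"
  assumes "open S" "\<And>i j. Ck_on k (\<lambda>x. A x $ i $ j) S"
  shows "Ck_on k (\<lambda>x. det (A x)) S"
  unfolding det_def using assms by (intro Ck_on_sum Ck_on_mult Ck_on_const Ck_on_prod)

lemma matrix_inv_mult_solves:
  fixes A :: "real^'n::finite^'n"
  assumes "det A \<noteq> 0"
  shows "A *v (matrix_inv A *v b) = b"
proof -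
  have "A ** matrix_inv A = mat 1"
    using assms someI_ex[of "\<lambda>B. A ** B = mat 1 \<and> B ** A = mat 1"]
    unfolding matrix_inv_def invertible_det_nz[symmetric] invertible_def by blast
  then show ?thesis by (simp add: matrix_vector_mul_assoc)
qed

text \<open>By Cramer's rule each component is a quotient of two determinants, and these are
  polynomials in the entries of \<open>A\<close> and \<open>b\<close>.\<close>

lemma Ck_on_matrix_inv_mult:
  fixes A :: "'a::real_normed_vector \<Rightarrow> real^'n::finite^'n"
  assumes "open S" "\<And>i j. Ck_on k (\<lambda>x. A x $ i $ j) S" "\<And>i. Ck_on k (\<lambda>x. b x $ i) S"
    "\<And>x. x \<in> S \<Longrightarrow> det (A x) \<noteq> 0"
  shows "Ck_on k (\<lambda>x. matrix_inv (A x) *v b x) S"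
proof -
  have "Ck_on k (\<lambda>x. det (\<chi> i j. if j = l then b x $ i else A x $ i $ j)) S" for l
  proof (rule Ck_on_det[OF assms(1)])
    show "Ck_on k (\<lambda>x. (\<chi> i j. if j = l then b x $ i else A x $ i $ j) $ a $ c) S" for a c
      using assms by (cases "c = l") simp_all
  qed
  then have "Ck_on k (\<lambda>x. \<chi> l. det (\<chi> i j. if j = l then b x $ i else A x $ i $ j) * inverse (det (A x))) S"
    using Ck_on_inverse[OF assms(1) Ck_on_det[OF assms(1,2)] assms(4)] assms(1)
    by (intro Ck_on_vec_lambda Ck_on_mult)
  then show ?thesis
    by (rule Ck_on_cong[OF assms(1), rotated])
      (use assms(4) cramer matrix_inv_mult_solves in \<open>force simp: divide_inverse\<close>)
qed

section \<open>Inner products in coordinates\<close>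

lemma has_real_derivative_along_line:
  fixes f :: "'a::real_normed_vector \<Rightarrow> real"
  assumes "f differentiable (at (x + s *\<^sub>R v))"
  shows "((\<lambda>s. f (x + s *\<^sub>R v)) has_real_derivative dird f (x + s *\<^sub>R v) v) (at s)"
proof -
  have "((\<lambda>s. x + s *\<^sub>R v) has_derivative (\<lambda>r. r *\<^sub>R v)) (at s)"
    by (auto intro!: derivative_eq_intros)
  from has_derivative_compose[OF this has_derivative_dird[OF assms]]
  have "((\<lambda>s. f (x + s *\<^sub>R v)) has_derivative (\<lambda>r. dird f (x + s *\<^sub>R v) (r *\<^sub>R v))) (at s)" .
  moreover have "(\<lambda>r. dird f (x + s *\<^sub>R v) (r *\<^sub>R v)) = (*) (dird f (x + s *\<^sub>R v) v)"
    by (rule ext) (simp add: linear_scale[OF linear_dird[OF assms]])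
  ultimately show ?thesis by (simp add: has_field_derivative_def)
qed

text \<open>Mean value theorem twice: for the increment of \<open>f\<close> by
  \<open>t *\<^sub>R w\<close>, as a function along \<open>v\<close>, and then for the
  \<open>v\<close>-derivative along \<open>w\<close>. The left side is symmetric in \<open>v\<close>
  and \<open>w\<close>, the right side is not.\<close>

lemma second_difference_mvt:
  fixes f :: "'a::real_normed_vector \<Rightarrow> real"
  assumes "Ck_on 2 f S" "0 < t"
    and inS: "\<And>r s. 0 \<le> r \<Longrightarrow> r \<le> t \<Longrightarrow> 0 \<le> s \<Longrightarrow> s \<le> t \<Longrightarrow> x + r *\<^sub>R v + s *\<^sub>R w \<in> S"
  shows "\<exists>r s. 0 < r \<and> r < t \<and> 0 < s \<and> s < t \<and>
    f (x + t *\<^sub>R v + t *\<^sub>R w) - f (x + t *\<^sub>R v) - f (x + t *\<^sub>R w) + f x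
      = t * t * dird (\<lambda>z. dird f z v) (x + r *\<^sub>R v + s *\<^sub>R w) w"
proof -
  have C: "Ck_on (Suc 1) f S" using assms(1) by (simp add: numeral_2_eq_2)
  have C1: "Ck_on (Suc 0) (\<lambda>z. dird f z v) S" using Ck_on_dird[OF C] by simp
  have "\<exists>r>0. r < t \<and> (f (x + t *\<^sub>R w + t *\<^sub>R v) - f (x + t *\<^sub>R v)) - (f (x + t *\<^sub>R w + 0 *\<^sub>R v) - f (x + 0 *\<^sub>R v))
     = (t - 0) * (dird f (x + t *\<^sub>R w + r *\<^sub>R v) v - dird f (x + r *\<^sub>R v) v)"
  proof (rule MVT2[OF assms(2)])
    fix r assume r: "0 \<le> r" "r \<le> t"
    have "x + t *\<^sub>R w + r *\<^sub>R v \<in> S" "x + r *\<^sub>R v \<in> S"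
      using inS[of r t] inS[of r 0] r assms(2) by (auto simp: algebra_simps)
    then show "((\<lambda>r. f (x + t *\<^sub>R w + r *\<^sub>R v) - f (x + r *\<^sub>R v)) has_real_derivative
        dird f (x + t *\<^sub>R w + r *\<^sub>R v) v - dird f (x + r *\<^sub>R v) v) (at r)"
      by (intro DERIV_diff has_real_derivative_along_line Ck_on_differentiable[OF C])
  qed
  then obtain r where r: "0 < r" "r < t"
    and e1: "f (x + t *\<^sub>R v + t *\<^sub>R w) - f (x + t *\<^sub>R v) - f (x + t *\<^sub>R w) + f x
      = t * (dird f (x + r *\<^sub>R v + t *\<^sub>R w) v - dird f (x + r *\<^sub>R v) v)"
    by (auto simp: algebra_simps)
  have "\<exists>s>0. s < t \<and> dird f (x + r *\<^sub>R v + t *\<^sub>R w) v - dird f (x + r *\<^sub>R v + 0 *\<^sub>R w) v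
     = (t - 0) * dird (\<lambda>z. dird f z v) (x + r *\<^sub>R v + s *\<^sub>R w) w"
    by (rule MVT2[OF assms(2)])
      (use inS r in \<open>auto intro!: has_real_derivative_along_line[where f = "\<lambda>z. dird f z v"]
          Ck_on_differentiable[OF C1]\<close>)
  then obtain s where "0 < s" "s < t" "dird f (x + r *\<^sub>R v + t *\<^sub>R w) v - dird f (x + r *\<^sub>R v) v
      = t * dird (\<lambda>z. dird f z v) (x + r *\<^sub>R v + s *\<^sub>R w) w"
    by auto
  then show ?thesis using e1 r by (intro exI[of _ r] exI[of _ s]) simp
qed

text \<open>Both mixed derivatives, at points close to \<open>x\<close>, are mean values of the same
  symmetric second difference. By continuity they cannot differ at \<open>x\<close>: each is within
  half the supposed gap of its value there.\<close>

lemma dird_commute_real: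
  fixes f :: "'a::real_normed_vector \<Rightarrow> real"
  assumes "open S" "Ck_on 2 f S" "x \<in> S"
  shows "dird (\<lambda>z. dird f z w) x v = dird (\<lambda>z. dird f z v) x w"
proof (rule ccontr)
  define a where "a = (\<lambda>y. dird (\<lambda>z. dird f z w) y v)"
  define b where "b = (\<lambda>y. dird (\<lambda>z. dird f z v) y w)"
  assume "dird (\<lambda>z. dird f z w) x v \<noteq> dird (\<lambda>z. dird f z v) x w"
  then have ne: "0 < \<bar>a x - b x\<bar> / 2" by (simp add: a_def b_def)
  have C: "Ck_on (Suc (Suc 0)) f S" using assms(2) by (simp add: numeral_2_eq_2)
  have "continuous_on S a" "continuous_on S b"
    using Ck_on_imp_continuous[OF Ck_on_dird[OF Ck_on_dird[OF C]]] by (auto simp: a_def b_def)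
  then obtain d1 d2 where d1: "d1 > 0" "\<And>y. y \<in> S \<Longrightarrow> dist y x < d1 \<Longrightarrow> dist (a y) (a x) < \<bar>a x - b x\<bar> / 2"
    and d2: "d2 > 0" "\<And>y. y \<in> S \<Longrightarrow> dist y x < d2 \<Longrightarrow> dist (b y) (b x) < \<bar>a x - b x\<bar> / 2"
    using ne assms(3) unfolding continuous_on_iff by metis
  obtain d0 where d0: "d0 > 0" "ball x d0 \<subseteq> S"
    using assms(1,3) open_contains_ball by blast
  define d where "d = min d0 (min d1 d2)"
  \<comment> \<open>Puts the parallelogram spanned by \<open>t *\<^sub>R v\<close> and
    \<open>t *\<^sub>R w\<close> inside the ball of radius \<open>d\<close>; the summand 1 keeps the
    denominator positive for \<open>v = w = 0\<close>.\<close>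
  define t where "t = d / (norm v + norm w + 1)"
  have d: "d > 0" using d0 d1 d2 by (simp add: d_def)
  have pos: "norm v + norm w + 1 > 0" by (simp add: add_nonneg_pos)
  then have t: "t > 0" using d by (simp add: t_def)
  have tb: "t * (norm v + norm w) < d"
    using d pos by (simp add: t_def field_simps)
  have near: "dist (x + (r *\<^sub>R v + s *\<^sub>R w)) x < d" if "0 \<le> r" "r \<le> t" "0 \<le> s" "s \<le> t" for r s
  proof -
    have "norm (r *\<^sub>R v + s *\<^sub>R w) \<le> r * norm v + s * norm w"
      using that norm_triangle_ineq[of "r *\<^sub>R v" "s *\<^sub>R w"] by simp
    also have "\<dots> \<le> t * norm v + t * norm w"
      using that by (intro add_mono mult_right_mono) auto
    finally show ?thesis using tb by (simp add: dist_norm algebra_simps)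
  qed
  have inS: "x + r *\<^sub>R v + s *\<^sub>R w \<in> S" "x + s *\<^sub>R w + r *\<^sub>R v \<in> S"
    if "0 \<le> r" "r \<le> t" "0 \<le> s" "s \<le> t" for r s
    using near[OF that] d0(2) by (auto simp: d_def dist_commute add_ac subset_iff)
  obtain r s where rs: "0 < r" "r < t" "0 < s" "s < t"
    "f (x + t *\<^sub>R v + t *\<^sub>R w) - f (x + t *\<^sub>R v) - f (x + t *\<^sub>R w) + f x = t * t * b (x + r *\<^sub>R v + s *\<^sub>R w)"
    using second_difference_mvt[OF assms(2) t inS(1)] unfolding b_def by blast
  obtain r' s' where rs': "0 < r'" "r' < t" "0 < s'" "s' < t"
    "f (x + t *\<^sub>R w + t *\<^sub>R v) - f (x + t *\<^sub>R w) - f (x + t *\<^sub>R v) + f x = t * t * a (x + r' *\<^sub>R w + s' *\<^sub>R v)"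
    using second_difference_mvt[OF assms(2) t, of x w v] inS(2) unfolding a_def by blast
  have "t * t * b (x + r *\<^sub>R v + s *\<^sub>R w) = t * t * a (x + r' *\<^sub>R w + s' *\<^sub>R v)"
    using rs(5) rs'(5) by (simp add: algebra_simps)
  then have eq: "b (x + r *\<^sub>R v + s *\<^sub>R w) = a (x + r' *\<^sub>R w + s' *\<^sub>R v)"
    using t by simp
  have "dist (b (x + r *\<^sub>R v + s *\<^sub>R w)) (b x) < \<bar>a x - b x\<bar> / 2"
    using rs near[of r s] inS by (intro d2(2)) (auto simp: d_def add_ac)
  moreover have "dist (a (x + r' *\<^sub>R w + s' *\<^sub>R v)) (a x) < \<bar>a x - b x\<bar> / 2"
    using rs' near[of s' r'] inS(2)[of s' r'] by (intro d1(2)) (auto simp: d_def add_ac)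
  ultimately show False using eq by (simp add: dist_real_def abs_if split: if_splits)
qed

lemma dird_inner_const:
  assumes "f differentiable (at x)"
  shows "(\<lambda>y. f y \<bullet> e) differentiable (at x)" "dird (\<lambda>y. f y \<bullet> e) x v = dird f x v \<bullet> e"
proof -
  have "((\<lambda>y. f y \<bullet> e) has_derivative (\<lambda>v. dird f x v \<bullet> e)) (at x)"
    by (rule has_derivative_inner_left[OF has_derivative_dird[OF assms]])
  from dird_eqI[OF this] this
  show "(\<lambda>y. f y \<bullet> e) differentiable (at x)" "dird (\<lambda>y. f y \<bullet> e) x v = dird f x v \<bullet> e"
    by (auto simp: differentiable_def)
qed

lemma dird_commute:
  fixes f :: "'a::real_normed_vector \<Rightarrow> 'b::real_inner"
  assumes "open S" "Ck_on 2 f S" "x \<in> S"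
  shows "dird (\<lambda>z. dird f z w) x v = dird (\<lambda>z. dird f z v) x w"
proof -
  have C: "Ck_on (Suc (Suc 0)) f S" using assms(2) by (simp add: numeral_2_eq_2)
  have "dird (\<lambda>z. dird (\<lambda>y. f y \<bullet> e) z w) x v = dird (\<lambda>z. dird f z w) x v \<bullet> e" for v w e
  proof -
    have "dird (\<lambda>z. dird (\<lambda>y. f y \<bullet> e) z w) x v = dird (\<lambda>z. dird f z w \<bullet> e) x v"
      using dird_cong_open[OF assms(1,3), of "\<lambda>z. dird (\<lambda>y. f y \<bullet> e) z w" "\<lambda>z. dird f z w \<bullet> e"]
        dird_inner_const(2)[OF Ck_on_differentiable[OF C]] by simp
    then show ?thesis
      by (simp add: dird_inner_const(2)[OF Ck_on_differentiable[OF Ck_on_dird[OF C] assms(3)]])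
  qed
  moreover have "Ck_on 2 (\<lambda>y. f y \<bullet> e) S" for e
    using assms by (intro Ck_on_inner Ck_on_const)
  ultimately have "dird (\<lambda>z. dird f z w) x v \<bullet> e = dird (\<lambda>z. dird f z v) x w \<bullet> e" for e
    using dird_commute_real[OF assms(1) _ assms(3)] by metis
  then show ?thesis by (metis inner_diff_left inner_eq_zero_iff eq_iff_diff_eq_0)
qed

section \<open>Positive definite forms, orthonormal bases and duality\<close>

definition inner_form :: "(real^'k::finite \<Rightarrow> real^'k \<Rightarrow> real) \<Rightarrow> bool" where
  "inner_form g \<longleftrightarrow> bilinear g \<and> (\<forall>v w. g v w = g w v) \<and> (\<forall>v. v \<noteq> 0 \<longrightarrow> g v v > 0)"

lemma inner_formD:
  assumes "inner_form g"
  shows "bilinear g" "g v w = g w v" "v \<noteq> 0 \<Longrightarrow> g v v > 0" "linear (g v)" "linear (\<lambda>v. g v w)"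
  using assms by (auto simp: inner_form_def bilinear_def)

lemma inner_form_left:
  assumes "inner_form g"
  shows "g (x + y) z = g x z + g y z" "g (x - y) z = g x z - g y z" "g (r *\<^sub>R x) z = r * g x z"
    "g (\<Sum>i\<in>I. f i) z = (\<Sum>i\<in>I. g (f i) z)"
  using linear_add[OF inner_formD(5)[OF assms, of z], of x y]
    linear_diff[OF inner_formD(5)[OF assms, of z], of x y]
    linear_scale[OF inner_formD(5)[OF assms, of z], of r x]
    linear_sum[OF inner_formD(5)[OF assms, of z], of f I] by simp_all

lemma inner_form_right:
  assumes "inner_form g"
  shows "g z (x + y) = g z x + g z y" "g z (x - y) = g z x - g z y" "g z (r *\<^sub>R x) = r * g z x"
    "g z (\<Sum>i\<in>I. f i) = (\<Sum>i\<in>I. g z (f i))"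
  using inner_form_left[OF assms] inner_formD(2)[OF assms] by simp_all

lemma inner_form_eq_0: "inner_form g \<Longrightarrow> g v v = 0 \<longleftrightarrow> v = 0"
  using inner_formD(1,3)[of g] bilinear_lzero by (metis less_irrefl)

lemma inner_form_linear_inj:
  assumes "linear L" "inj L"
  shows "inner_form (\<lambda>v w. (L v :: 'b::real_inner) \<bullet> L w)"
proof -
  have "L v \<noteq> 0" if "v \<noteq> 0" for v
    using assms that by (metis linear_injective_0)
  then show ?thesis
    using assms(1) by (auto simp: inner_form_def bilinear_def inner_commute linear_iff inner_add_left inner_add_right)
qed

lemma inner_form_ext:
  assumes "inner_form g" "\<And>s. g v s = g w s"
  shows "v = w"
proof -
  have "g (v - w) (v - w) = 0"
    using assms(2)[of "v - w"] linear_diff[OF inner_formD(5)[OF assms(1)]] by simp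
  then show ?thesis using inner_form_eq_0[OF assms(1)] by simp
qed

text \<open>Gram-Schmidt for the form \<open>g\<close>, one index at a time: as long as an index is
  missing, the vectors found so far span a proper subspace.\<close>

lemma exists_orthonormal_basis:
  fixes g :: "real^'k::finite \<Rightarrow> real^'k \<Rightarrow> real"
  assumes "inner_form g"
  shows "\<exists>e::'k \<Rightarrow> real^'k. \<forall>i j. g (e i) (e j) = (if i = j then 1 else 0)"
proof -
  note g = inner_formD[OF assms]
  have "finite I \<Longrightarrow> \<exists>e::'k \<Rightarrow> real^'k. \<forall>i\<in>I. \<forall>j\<in>I. g (e i) (e j) = (if i = j then 1 else 0)" for I
  proof (induction I rule: finite_induct)
    case (insert a I)
    then obtain e :: "'k \<Rightarrow> real^'k" where e: "\<forall>i\<in>I. \<forall>j\<in>I. g (e i) (e j) = (if i = j then 1 else 0)"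
      by blast
    have "dim (e ` I) \<le> card (e ` I)"
      using insert by (intro dim_le_card') simp
    also have "\<dots> \<le> card I" using insert by (simp add: card_image_le)
    also have "card I < card (insert a I)" using insert by simp
    also have "\<dots> \<le> CARD('k)" by (intro card_mono) auto
    finally have "span (e ` I) \<noteq> UNIV" using dim_eq_full[of "e ` I"] by auto
    then obtain w where w: "w \<notin> span (e ` I)" by auto
    define w' where "w' = w - (\<Sum>j\<in>I. g w (e j) *\<^sub>R e j)"
    have "(\<Sum>j\<in>I. g w (e j) *\<^sub>R e j) \<in> span (e ` I)"
      by (intro span_sum span_scale span_base) auto
    then have w'0: "w' \<noteq> 0" using w by (auto simp: w'_def)
    have orth: "g w' (e i) = 0" if "i \<in> I" for i
    proof -
      have "g w' (e i) = g w (e i) - (\<Sum>j\<in>I. g w (e j) * g (e j) (e i))"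
        by (simp add: w'_def inner_form_left[OF assms])
      also have "(\<Sum>j\<in>I. g w (e j) * g (e j) (e i)) = (\<Sum>j\<in>I. if i = j then g w (e j) else 0)"
        using e that by (intro sum.cong) auto
      finally show ?thesis using insert.hyps that by simp
    qed
    define r where "r = 1 / sqrt (g w' w')"
    have r: "r * (r * g w' w') = 1" using g(3)[OF w'0] by (simp add: r_def field_simps)
    have sc: "g (r *\<^sub>R x) y = r * g x y" "g x (r *\<^sub>R y) = r * g x y" for x y
      by (simp_all add: inner_form_left[OF assms] inner_form_right[OF assms])
    have "\<forall>i\<in>insert a I. \<forall>j\<in>insert a I. g ((e(a := r *\<^sub>R w')) i) ((e(a := r *\<^sub>R w')) j) = (if i = j then 1 else 0)"
      using insert.hyps e orth r g(2) by (auto simp: sc)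
    then show ?case by blast
  qed auto
  from this[of UNIV] show ?thesis by auto
qed

text \<open>The map from coordinates to combinations of the \<open>e i\<close> is injective, since
  \<open>g\<close> recovers the coordinates, and hence surjective by equality of dimensions.\<close>

lemma orthonormal_expansion:
  fixes e :: "'k::finite \<Rightarrow> real^'k"
  assumes "inner_form g" "\<And>i j. g (e i) (e j) = (if i = j then 1 else 0)"
  shows "v = (\<Sum>i\<in>UNIV. g v (e i) *\<^sub>R e i)"
proof -
  define T where "T = (\<lambda>x::real^'k. \<Sum>i\<in>UNIV. x $ i *\<^sub>R e i)"
  have lin: "linear T"
    by (rule linearI) (simp_all add: T_def scaleR_left_distrib sum.distrib scaleR_sum_right)
  have c: "g (T x) (e i) = x $ i" for x i
    by (simp add: T_def inner_form_left[OF assms(1)] assms(2) if_distrib cong: if_cong)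
  have "inj T" by (rule injI) (metis c vec_eq_iff)
  then have "surj T" using linear_injective_imp_surjective[OF lin] by simp
  then obtain x where "v = T x" by (metis surjD)
  then show ?thesis by (simp add: c) (simp add: T_def)
qed

lemma gram_mult_component:
  assumes "bilinear g"
  shows "((\<chi> i j. g (axis i 1) (axis j 1)) *v x) $ i = g (axis i 1) (x::real^'k::finite)"
proof -
  have "g (axis i 1) (\<Sum>j\<in>UNIV. x $ j *\<^sub>R axis j 1) = (\<Sum>j\<in>UNIV. x $ j * g (axis i 1) (axis j 1))"
    using assms by (simp add: bilinear_def linear_sum linear_scale)
  moreover have "(\<Sum>j\<in>UNIV. x $ j *\<^sub>R axis j 1) = x"
    by (simp add: vec_eq_iff sum_component axis_def if_distrib cong: if_cong)
  ultimately show ?thesis by (simp add: matrix_vector_mult_def mult.commute)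
qed

lemma linear_axis_sum:
  fixes f :: "real^'k::finite \<Rightarrow> 'b::real_vector"
  assumes "linear f"
  shows "f x = (\<Sum>i\<in>UNIV. x $ i *\<^sub>R f (axis i 1))"
proof -
  have "(\<Sum>j\<in>UNIV. x $ j *\<^sub>R axis j 1) = x"
    by (simp add: vec_eq_iff sum_component axis_def if_distrib cong: if_cong)
  then show ?thesis using assms by (metis (no_types, lifting) linear_scale linear_sum sum.cong)
qed

text \<open>With an orthonormal basis as the columns of \<open>E\<close>, the product
  \<open>transpose E ** (G ** E)\<close> is the identity, so det G (det E)^2 = 1.\<close>

lemma det_gram_pos:
  fixes g :: "real^'k::finite \<Rightarrow> real^'k \<Rightarrow> real"
  assumes "inner_form g"
  shows "det (\<chi> i j. g (axis i 1) (axis j 1)) > 0"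
proof -
  define G :: "real^'k^'k" where "G = (\<chi> i j. g (axis i 1) (axis j 1))"
  obtain e :: "'k \<Rightarrow> real^'k" where e: "\<forall>i j. g (e i) (e j) = (if i = j then 1 else 0)"
    using exists_orthonormal_basis[OF assms] by blast
  define E :: "real^'k^'k" where "E = (\<chi> i j. e j $ i)"
  have col: "(\<chi> i. E $ i $ j) = e j" for j by (simp add: E_def vec_eq_iff)
  have "(transpose E ** (G ** E)) $ i $ j = (if i = j then 1 else 0)" for i j
  proof -
    have "(G ** E) $ k $ j = g (axis k 1) (e j)" for k
      using gram_mult_component[OF inner_formD(1)[OF assms], of "e j" k]
      by (simp add: matrix_matrix_mult_def matrix_vector_mult_def G_def E_def)
    moreover have "(transpose E ** (G ** E)) $ i $ j = (\<Sum>k\<in>UNIV. e i $ k * (G ** E) $ k $ j)"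
      unfolding matrix_matrix_mult_def[of "transpose E"] by (simp add: transpose_def E_def)
    ultimately have "(transpose E ** (G ** E)) $ i $ j = (\<Sum>k\<in>UNIV. e i $ k *\<^sub>R g (axis k 1) (e j))"
      by simp
    also have "\<dots> = g (e i) (e j)"
      using linear_axis_sum[OF inner_formD(5)[OF assms], of "e i" "e j"] by simp
    finally show ?thesis using e by simp
  qed
  then have "transpose E ** (G ** E) = mat 1" by (simp add: vec_eq_iff mat_def)
  then have "det E * (det G * det E) = 1" by (metis det_I det_mul det_transpose)
  then have "det G * (det E * det E) = 1" by (simp add: mult_ac)
  then have "det G > 0"
    by (metis mult_nonpos_nonneg not_less zero_le_square zero_less_one)
  then show ?thesis by (simp add: G_def)
qed

text \<open>Riesz representation in coordinates: the inverse Gram matrix raises the index of the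
  covector \<open>\<phi>\<close>.\<close>

lemma gram_inverse_represents:
  fixes g :: "real^'k::finite \<Rightarrow> real^'k \<Rightarrow> real"
  assumes "inner_form g" "linear \<phi>"
  shows "g (matrix_inv (\<chi> i j. g (axis i 1) (axis j 1)) *v (\<chi> l. \<phi> (axis l 1))) s = \<phi> s"
proof -
  let ?z = "matrix_inv (\<chi> i j. g (axis i 1) (axis j 1)) *v (\<chi> l. \<phi> (axis l 1))"
  have "g (axis i 1) ?z = \<phi> (axis i 1)" for i
    using gram_mult_component[OF inner_formD(1)[OF assms(1)], of ?z i]
      matrix_inv_mult_solves[of "\<chi> i j. g (axis i 1) (axis j 1)" "\<chi> l. \<phi> (axis l 1)"]
      det_gram_pos[OF assms(1)] by simp
  then have "g ?z s = (\<Sum>i\<in>UNIV. s $ i *\<^sub>R \<phi> (axis i 1))"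
    using linear_axis_sum[OF inner_formD(4)[OF assms(1)], of ?z s] inner_formD(2)[OF assms(1), of ?z]
    by simp
  then show ?thesis using linear_axis_sum[OF assms(2), of s] by simp
qed

text \<open>For an injective linear map this is the pseudo-inverse.\<close>

definition pinv :: "(real^'k::finite \<Rightarrow> 'b::real_inner) \<Rightarrow> 'b \<Rightarrow> real^'k" where
  "pinv L \<xi> = matrix_inv (\<chi> i j. L (axis i 1) \<bullet> L (axis j 1)) *v (\<chi> l. \<xi> \<bullet> L (axis l 1))"

text \<open>The normal equations: \<open>L (pinv L \<xi>)\<close> is the orthogonal projection of
  \<open>\<xi>\<close> to the range of \<open>L\<close>.\<close>

lemma pinv_inner:
  assumes "linear L" "inj L"
  shows "L (pinv L \<xi>) \<bullet> L s = \<xi> \<bullet> L s"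
  unfolding pinv_def
  by (rule gram_inverse_represents[OF inner_form_linear_inj[OF assms]])
    (use assms(1) in \<open>auto simp: linear_iff inner_add_right\<close>)

lemma pinv_unique:
  assumes "linear L" "inj L" "\<And>s. L v \<bullet> L s = \<xi> \<bullet> L s"
  shows "pinv L \<xi> = v"
  using inner_form_ext[OF inner_form_linear_inj[OF assms(1,2)]] pinv_inner[OF assms(1,2)] assms(3)
  by metis

lemma pinv_image [simp]: "linear L \<Longrightarrow> inj L \<Longrightarrow> pinv L (L v) = v"
  by (rule pinv_unique) auto

lemma linear_pinv: "linear (pinv L)"
proof -
  have "(\<chi> l. (x + y) \<bullet> L (axis l 1)) = (\<chi> l. x \<bullet> L (axis l 1)) + (\<chi> l. y \<bullet> L (axis l 1))"
    "(\<chi> l. (r *\<^sub>R x) \<bullet> L (axis l 1)) = r *\<^sub>R (\<chi> l. x \<bullet> L (axis l 1))" for x y r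
    by (simp_all add: vec_eq_iff inner_add_left)
  then show ?thesis
    unfolding pinv_def
    by (intro linearI) (simp_all add: matrix_vector_right_distrib vec.scale scaleR_matrix_vector_assoc
        matrix_vector_mult_scaleR)
qed

section \<open>Charts\<close>

locale riemannian =
  fixes M :: "('a::{t2_space, second_countable_topology}, 'k::finite) rmfd"
  assumes riem: "riemannian_manifold M"
begin

lemma inner_form_metric: "inner_form (metric M p)"
  using riem by (auto simp: riemannian_manifold_def inner_form_def)

lemma chart_open: "c \<in> charts M \<Longrightarrow> open (fst c)" "c \<in> charts M \<Longrightarrow> open (snd c ` fst c)"
  using riem by (auto simp: riemannian_manifold_def smooth_atlas_def)

lemma chart_homeomorphism:
  "c \<in> charts M \<Longrightarrow> homeomorphism (fst c) (snd c ` fst c) (snd c) (chart_inv c)"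
  using riem by (auto simp: riemannian_manifold_def smooth_atlas_def)

lemma chart_inv_left [simp]: "c \<in> charts M \<Longrightarrow> p \<in> fst c \<Longrightarrow> chart_inv c (snd c p) = p"
  using chart_homeomorphism by (auto simp: homeomorphism_def)

lemma continuous_on_chart: "c \<in> charts M \<Longrightarrow> continuous_on (fst c) (snd c)"
  and continuous_on_chart_inv: "c \<in> charts M \<Longrightarrow> continuous_on (snd c ` fst c) (chart_inv c)"
  using chart_homeomorphism by (auto simp: homeomorphism_def)

lemma charts_cover: "\<exists>c\<in>charts M. p \<in> fst c"
proof -
  have "p \<in> (\<Union>c\<in>charts M. fst c)"
    using riem by (simp add: riemannian_manifold_def smooth_atlas_def)
  then show ?thesis by blast
qed

lemma chart_at [simp]: "chart_at M p \<in> charts M" "p \<in> fst (chart_at M p)"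
  using someI_ex[of "\<lambda>c. c \<in> charts M \<and> p \<in> fst c"] charts_cover[of p]
  unfolding chart_at_def by blast+

lemma coord_in [simp]: "coord M p \<in> snd (chart_at M p) ` fst (chart_at M p)"
  by (simp add: coord_def)

lemma chart_inv_coord [simp]: "chart_inv (chart_at M p) (coord M p) = p"
  by (simp add: coord_def)

lemma chart_image_eq:
  assumes "c \<in> charts M" "A \<subseteq> fst c"
  shows "snd c ` A = {y \<in> snd c ` fst c. chart_inv c y \<in> A}"
  using assms by (auto simp: subset_iff image_iff)

lemma open_chart_image:
  assumes "c \<in> charts M" "open A" "A \<subseteq> fst c"
  shows "open (snd c ` A)"
  unfolding chart_image_eq[OF assms(1,3)]
  using continuous_open_preimage[OF continuous_on_chart_inv[OF assms(1)] chart_open(2)[OF assms(1)] assms(2)]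
  by (simp add: vimage_def Int_def)

lemma transition_smooth:
  assumes "c \<in> charts M" "d \<in> charts M"
  shows "smooth_on (snd d \<circ> chart_inv c) (snd c ` (fst c \<inter> fst d))"
  using riem assms by (auto simp: riemannian_manifold_def smooth_atlas_def)

lemma open_overlap: "c \<in> charts M \<Longrightarrow> d \<in> charts M \<Longrightarrow> open (snd c ` (fst c \<inter> fst d))"
  by (intro open_chart_image) (auto simp: chart_open)

lemma transition_differentiable:
  assumes "c \<in> charts M" "d \<in> charts M" "p \<in> fst c" "p \<in> fst d"
  shows "(snd d \<circ> chart_inv c) differentiable (at (snd c p))"
  using transition_smooth[OF assms(1,2)] assms by (auto intro: smooth_on_differentiable)

lemma chart_change:
  assumes "c \<in> charts M" "d \<in> charts M" "p \<in> fst c" "p \<in> fst d"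
    and f: "(f \<circ> chart_inv d) differentiable (at (snd d p))"
  shows "(f \<circ> chart_inv c) differentiable (at (snd c p))" (is ?A)
    and "dird (f \<circ> chart_inv c) (snd c p) v =
      dird (f \<circ> chart_inv d) (snd d p) (dird (snd d \<circ> chart_inv c) (snd c p) v)" (is ?B)
proof -
  let ?T = "snd d \<circ> chart_inv c"
  have f': "(f \<circ> chart_inv d) differentiable (at (?T (snd c p)))" using f assms by simp
  have T: "?T differentiable (at (snd c p))" using transition_differentiable assms by blast
  have eq: "(f \<circ> chart_inv d) (?T y) = (f \<circ> chart_inv c) y" if "y \<in> snd c ` (fst c \<inter> fst d)" for y
    using that assms by auto
  have p: "snd c p \<in> snd c ` (fst c \<inter> fst d)" using assms by auto
  show ?A
    by (rule differentiable_cong_open[OF _ open_overlap[OF assms(1,2)] p eq])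
      (use differentiable_chain_at[OF T f'] in \<open>simp add: o_def\<close>)
  have "dird (\<lambda>y. (f \<circ> chart_inv d) (?T y)) (snd c p) = dird (f \<circ> chart_inv c) (snd c p)"
    by (rule dird_cong_open[OF open_overlap[OF assms(1,2)] p eq])
  with dird_compose[OF T f'] show ?B using assms by (simp add: o_def)
qed

lemma transition_inverse:
  assumes "c \<in> charts M" "d \<in> charts M" "p \<in> fst c" "p \<in> fst d"
  shows "dird (snd c \<circ> chart_inv d) (snd d p) (dird (snd d \<circ> chart_inv c) (snd c p) v) = v"
proof -
  have "dird (snd c \<circ> chart_inv c) (snd c p) = dird (\<lambda>y. y) (snd c p)"
    by (rule dird_cong_open[OF chart_open(2)[OF assms(1)]]) (use assms in auto)
  then have "dird (snd c \<circ> chart_inv c) (snd c p) v = v" by (simp add: dird_def)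
  then show ?thesis
    using chart_change(2)[OF assms transition_differentiable] assms by metis
qed

lemma to_from_chart [simp]:
  assumes "c \<in> charts M" "p \<in> fst c"
  shows "to_chart M c p (from_chart M c p v) = v" "from_chart M c p (to_chart M c p v) = v"
  using transition_inverse[OF assms(1) chart_at(1) assms(2) chart_at(2)]
    transition_inverse[OF chart_at(1) assms(1) chart_at(2) assms(2)]
  by (simp_all add: to_chart_def from_chart_def coord_def)

lemma linear_to_chart: "c \<in> charts M \<Longrightarrow> p \<in> fst c \<Longrightarrow> linear (to_chart M c p)"
  and linear_from_chart: "c \<in> charts M \<Longrightarrow> p \<in> fst c \<Longrightarrow> linear (from_chart M c p)"
  unfolding to_chart_def[abs_def] from_chart_def[abs_def] coord_def
  by (auto intro!: linear_dird transition_differentiable)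

lemma diff_fun_chart:
  assumes "c \<in> charts M" "p \<in> fst c" "(f \<circ> chart_inv c) differentiable (at (snd c p))"
  shows "diff_fun M f p v = dird (f \<circ> chart_inv c) (snd c p) (to_chart M c p v)"
    and "dird (f \<circ> chart_inv c) (snd c p) v = diff_fun M f p (from_chart M c p v)"
proof -
  show "diff_fun M f p v = dird (f \<circ> chart_inv c) (snd c p) (to_chart M c p v)" for v
    unfolding diff_fun_def to_chart_def coord_def
    by (rule chart_change(2)) (use assms in auto)
  from this[of "from_chart M c p v"]
  show "dird (f \<circ> chart_inv c) (snd c p) v = diff_fun M f p (from_chart M c p v)"
    using assms by simp
qed

lemma metric_in_chart:
  assumes "c \<in> charts M" "p \<in> fst c"
  shows "metric_in M c (snd c p) v w = metric M p (from_chart M c p v) (from_chart M c p w)"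
    and "metric M p v w = metric_in M c (snd c p) (to_chart M c p v) (to_chart M c p w)"
  using assms by (simp_all add: metric_in_def)

lemma inner_form_metric_in:
  assumes "c \<in> charts M" "y \<in> snd c ` fst c"
  shows "inner_form (metric_in M c y)"
proof -
  obtain p where p: "p \<in> fst c" "y = snd c p" using assms by auto
  note lin = linear_from_chart[OF assms(1) p(1)]
  have "from_chart M c p v \<noteq> 0" if "v \<noteq> 0" for v
    using that to_from_chart(1)[OF assms(1) p(1), of v] linear_0[OF linear_to_chart[OF assms(1) p(1)]]
    by metis
  then show ?thesis
    using assms(1) p inner_formD(2,3)[OF inner_form_metric]
    by (auto simp: inner_form_def bilinear_def linear_iff metric_in_chart(1) linear_add[OF lin]
        linear_scale[OF lin] inner_form_left[OF inner_form_metric] inner_form_right[OF inner_form_metric])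
qed

lemma smooth_metric_in: "c \<in> charts M \<Longrightarrow> smooth_on (\<lambda>y. metric_in M c y v w) (snd c ` fst c)"
  using riem by (simp add: riemannian_manifold_def)

lemma frame_at: "metric M p (frame_at M p i) (frame_at M p j) = (if i = j then 1 else 0)"
proof -
  have "orthonormal_frame M p (frame_at M p)"
    unfolding frame_at_def
    using someI_ex[of "orthonormal_frame M p"] exists_orthonormal_basis[OF inner_form_metric]
    unfolding orthonormal_frame_def by blast
  then show ?thesis by (simp add: orthonormal_frame_def)
qed

lemma frame_at_expansion: "v = (\<Sum>i\<in>UNIV. metric M p v (frame_at M p i) *\<^sub>R frame_at M p i)"
  by (rule orthonormal_expansion[OF inner_form_metric frame_at])

lemma continuous_on_UNIV_chartI:
  assumes "\<And>c. c \<in> charts M \<Longrightarrow> continuous_on (snd c ` fst c) (f \<circ> chart_inv c)"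
  shows "continuous_on UNIV f"
proof -
  have "continuous_on (\<Union>(fst ` charts M)) f"
  proof (rule continuous_on_open_Union)
    fix S assume "S \<in> fst ` charts M"
    then obtain c where c: "c \<in> charts M" "S = fst c" by blast
    then show "open S" by (simp add: chart_open)
    have "continuous_on (fst c) (\<lambda>p. (f \<circ> chart_inv c) (snd c p))"
      by (rule continuous_on_compose2[OF assms[OF c(1)] continuous_on_chart[OF c(1)]]) auto
    then show "continuous_on S f"
      unfolding c(2) by (rule continuous_on_cong[THEN iffD1, rotated 2]) (use c in auto)
  qed
  moreover have "\<Union>(fst ` charts M) = UNIV" using charts_cover by blast
  ultimately show ?thesis by simp
qed

end

lemma dird_inner:
  fixes f g :: "'a::real_normed_vector \<Rightarrow> 'b::real_inner"
  assumes "f differentiable (at x)" "g differentiable (at x)"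
  shows "dird (\<lambda>y. f y \<bullet> g y) x v = f x \<bullet> dird g x v + dird f x v \<bullet> g x"
  using dird_eqI[OF has_derivative_inner[OF has_derivative_dird[OF assms(1)] has_derivative_dird[OF assms(2)]]]
  by simp

lemma dird_sum_scaleR:
  fixes f :: "'i \<Rightarrow> 'a::real_normed_vector \<Rightarrow> real" and g :: "'i \<Rightarrow> 'a \<Rightarrow> 'b::real_normed_vector"
  assumes "\<And>i. i \<in> I \<Longrightarrow> f i differentiable (at x)" "\<And>i. i \<in> I \<Longrightarrow> g i differentiable (at x)"
  shows "dird (\<lambda>y. \<Sum>i\<in>I. f i y *\<^sub>R g i y) x v =
    (\<Sum>i\<in>I. f i x *\<^sub>R dird (g i) x v + dird (f i) x v *\<^sub>R g i x)"
proof -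
  have "((\<lambda>y. \<Sum>i\<in>I. f i y *\<^sub>R g i y) has_derivative
    (\<lambda>v. \<Sum>i\<in>I. f i x *\<^sub>R dird (g i) x v + dird (f i) x v *\<^sub>R g i x)) (at x)"
    by (intro has_derivative_sum has_derivative_scaleR has_derivative_dird assms)
  from dird_eqI[OF this] show ?thesis by simp
qed

lemma dird_const [simp]: "dird (\<lambda>y. c) x v = 0"
  by (simp add: dird_def)

text \<open>Product rule for a field of linear maps. It is assumed differentiable only on each fixed
  vector, so the argument is expanded in \<open>Basis\<close> first.\<close>

lemma dird_linear_field:
  fixes A :: "'a::real_normed_vector \<Rightarrow> 'c::euclidean_space \<Rightarrow> 'b::real_normed_vector"
  assumes "open S" "x \<in> S" "\<And>y. y \<in> S \<Longrightarrow> linear (A y)" "\<And>e. (\<lambda>y. A y e) differentiable (at x)"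
    and \<gamma>: "\<gamma> differentiable (at x)"
  shows "dird (\<lambda>y. A y (\<gamma> y)) x v = dird (\<lambda>y. A y (\<gamma> x)) x v + A x (dird \<gamma> x v)"
    and "dird (\<lambda>y. A y e) x v = (\<Sum>i\<in>Basis. (e \<bullet> i) *\<^sub>R dird (\<lambda>y. A y i) x v)"
proof -
  have exp: "A y e = (\<Sum>i\<in>Basis. (e \<bullet> i) *\<^sub>R A y i)" if "y \<in> S" for y e
  proof -
    have "A y (\<Sum>i\<in>Basis. (e \<bullet> i) *\<^sub>R i) = (\<Sum>i\<in>Basis. (e \<bullet> i) *\<^sub>R A y i)"
      using assms(3)[OF that] by (simp add: linear_sum linear_scale)
    then show ?thesis by (simp add: euclidean_representation)
  qed
  have const: "dird (\<lambda>y. A y e) x v = (\<Sum>i\<in>Basis. (e \<bullet> i) *\<^sub>R dird (\<lambda>y. A y i) x v)" for e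
  proof -
    have "dird (\<lambda>y. A y e) x v = dird (\<lambda>y. \<Sum>i\<in>Basis. (e \<bullet> i) *\<^sub>R A y i) x v"
      using dird_cong_open[OF assms(1,2) exp[of _ e]] by (rule fun_cong)
    then show ?thesis using assms(4) by (simp add: dird_sum_scaleR)
  qed
  then show "dird (\<lambda>y. A y e) x v = (\<Sum>i\<in>Basis. (e \<bullet> i) *\<^sub>R dird (\<lambda>y. A y i) x v)" .
  have "dird (\<lambda>y. A y (\<gamma> y)) x v = dird (\<lambda>y. \<Sum>i\<in>Basis. (\<gamma> y \<bullet> i) *\<^sub>R A y i) x v"
    using dird_cong_open[OF assms(1,2) exp] by (rule fun_cong)
  also have "\<dots> = (\<Sum>i\<in>Basis. (\<gamma> x \<bullet> i) *\<^sub>R dird (\<lambda>y. A y i) x v) + (\<Sum>i\<in>Basis. (dird \<gamma> x v \<bullet> i) *\<^sub>R A x i)"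
    by (subst dird_sum_scaleR) (use assms(4) \<gamma> in \<open>auto simp: dird_inner_const sum.distrib\<close>)
  finally show "dird (\<lambda>y. A y (\<gamma> y)) x v = dird (\<lambda>y. A y (\<gamma> x)) x v + A x (dird \<gamma> x v)"
    using exp[OF assms(2), of "dird \<gamma> x v"] const[of "\<gamma> x"] by argo
qed

section \<open>Isometric immersions\<close>

locale immersed = riemannian M
  for M :: "('a::{t2_space, second_countable_topology}, 'k::finite) rmfd" +
  fixes \<iota> :: "'a \<Rightarrow> real^'r::finite"
  assumes immersion: "isometric_immersion M \<iota>"
begin

abbreviation L :: "'a \<Rightarrow> real^'k \<Rightarrow> real^'r" where "L \<equiv> diff_fun M \<iota>"

lemma Ck_immersion: "c \<in> charts M \<Longrightarrow> Ck_on k (\<iota> \<circ> chart_inv c) (snd c ` fst c)"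
  using immersion by (simp add: isometric_immersion_def mfd_Ck_def)

lemma immersion_differentiable:
  "c \<in> charts M \<Longrightarrow> y \<in> snd c ` fst c \<Longrightarrow> (\<iota> \<circ> chart_inv c) differentiable (at y)"
  using Ck_immersion Ck_on_differentiable by blast

lemma inner_L: "L p v \<bullet> L p w = metric M p v w"
  using immersion by (simp add: isometric_immersion_def)

lemma linear_L: "linear (L p)"
  unfolding diff_fun_def[abs_def] by (intro linear_dird immersion_differentiable) simp_all

lemma inj_L: "inj (L p)"
proof -
  have "v = 0" if "L p v = 0" for v
    using inner_L[of p v v] that inner_form_eq_0[OF inner_form_metric, of p v] by simp
  then show ?thesis using linear_injective_0[OF linear_L] by blast
qed

lemma L_chart:
  assumes "c \<in> charts M" "p \<in> fst c"
  shows "L p v = dird (\<iota> \<circ> chart_inv c) (snd c p) (to_chart M c p v)"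
    and "dird (\<iota> \<circ> chart_inv c) (snd c p) v = L p (from_chart M c p v)"
  using diff_fun_chart[OF assms immersion_differentiable] assms by auto

lemma inner_dird_immersion:
  assumes "c \<in> charts M" "y \<in> snd c ` fst c"
  shows "dird (\<iota> \<circ> chart_inv c) y v \<bullet> dird (\<iota> \<circ> chart_inv c) y w = metric_in M c y v w"
  using assms by (auto simp: L_chart(2) inner_L metric_in_chart(1))

lemma linear_dird_immersion:
  "c \<in> charts M \<Longrightarrow> y \<in> snd c ` fst c \<Longrightarrow> linear (dird (\<iota> \<circ> chart_inv c) y)"
  by (intro linear_dird immersion_differentiable)

lemma inj_dird_immersion:
  assumes "c \<in> charts M" "y \<in> snd c ` fst c"
  shows "inj (dird (\<iota> \<circ> chart_inv c) y)"
proof -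
  have "v = 0" if "dird (\<iota> \<circ> chart_inv c) y v = 0" for v
    using inner_dird_immersion[OF assms, of v v] that inner_form_eq_0[OF inner_form_metric_in[OF assms], of v]
    by simp
  then show ?thesis using linear_injective_0[OF linear_dird_immersion[OF assms]] by blast
qed

text \<open>The adjoint of the isometry \<open>L p\<close>: the tangential part of an ambient
  vector, as a vector of the tangent space. Along a map, \<open>tang (u p) E\<close> is the test
  field of the constant vector \<open>E\<close>.\<close>

definition tang :: "'a \<Rightarrow> real^'r \<Rightarrow> real^'k" where "tang p = pinv (L p)"

definition proj :: "'a \<Rightarrow> real^'r \<Rightarrow> real^'r" where "proj p \<xi> = L p (tang p \<xi>)"

lemma tang_L [simp]: "tang p (L p v) = v"
  by (simp add: tang_def linear_L inj_L)

lemma proj_L [simp]: "proj p (L p v) = L p v"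
  by (simp add: proj_def)

lemma inner_proj_L: "proj p \<xi> \<bullet> L p v = \<xi> \<bullet> L p v"
  by (simp add: proj_def tang_def pinv_inner linear_L inj_L)

lemma linear_tang: "linear (tang p)"
  by (simp add: tang_def linear_pinv)

lemma linear_proj: "linear (proj p)"
  using linear_compose[OF linear_tang linear_L, of p p] by (simp add: o_def proj_def[abs_def])

lemma tang_proj [simp]: "tang p (proj p \<xi>) = tang p \<xi>"
  by (simp add: proj_def)

lemma proj_proj [simp]: "proj p (proj p \<xi>) = proj p \<xi>"
  by (simp add: proj_def)

lemma inner_proj: "proj p \<xi> \<bullet> \<eta> = \<xi> \<bullet> proj p \<eta>"
  using inner_proj_L[of p \<xi> "tang p \<eta>"] inner_proj_L[of p \<eta> "tang p \<xi>"]
  by (simp add: proj_def inner_commute)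

text \<open>\<open>tang\<close> refers to the chart chosen at \<open>p\<close>. Here it is carried
  to an arbitrary fixed chart, in which smoothness can be stated; both sides solve the same normal
  equations.\<close>

lemma tang_chart:
  assumes "c \<in> charts M" "p \<in> fst c"
  shows "to_chart M c p (tang p \<xi>) = pinv (dird (\<iota> \<circ> chart_inv c) (snd c p)) \<xi>"
  using assms inner_proj_L[of p \<xi>]
  by (intro pinv_unique[symmetric])
    (auto simp: linear_dird_immersion inj_dird_immersion L_chart(2) proj_def)

lemma proj_chart:
  assumes "c \<in> charts M" "y \<in> snd c ` fst c"
  shows "proj (chart_inv c y) \<xi> =
    dird (\<iota> \<circ> chart_inv c) y (pinv (dird (\<iota> \<circ> chart_inv c) y) \<xi>)"
  using assms by (auto simp: proj_def L_chart(1) tang_chart)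

lemma Ck_pinv:
  assumes c: "c \<in> charts M" and \<xi>: "Ck_on k \<xi> (snd c ` fst c)"
  shows "Ck_on k (\<lambda>y. pinv (dird (\<iota> \<circ> chart_inv c) y) (\<xi> y)) (snd c ` fst c)"
  unfolding pinv_def
proof (rule Ck_on_matrix_inv_mult[OF chart_open(2)[OF c]])
  fix y assume y: "y \<in> snd c ` fst c"
  show "det (\<chi> i j. dird (\<iota> \<circ> chart_inv c) y (axis i 1) \<bullet> dird (\<iota> \<circ> chart_inv c) y (axis j 1)) \<noteq> 0"
    using det_gram_pos[OF inner_form_linear_inj[OF linear_dird_immersion[OF c y] inj_dird_immersion[OF c y]]]
    by simp
qed (auto intro!: Ck_on_inner Ck_on_dird Ck_immersion chart_open \<xi> c)

lemma Ck_proj: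
  assumes c: "c \<in> charts M" and \<xi>: "Ck_on k \<xi> (snd c ` fst c)"
  shows "Ck_on k (\<lambda>y. proj (chart_inv c y) (\<xi> y)) (snd c ` fst c)"
proof -
  have "Ck_on k (\<lambda>y. dird (\<iota> \<circ> chart_inv c) y (pinv (dird (\<iota> \<circ> chart_inv c) y) (\<xi> y))) (snd c ` fst c)"
    by (intro Ck_on_dird_field Ck_immersion Ck_pinv c \<xi> chart_open)
  then show ?thesis
    by (rule Ck_on_cong[OF chart_open(2)[OF c], rotated]) (simp only: proj_chart[OF c])
qed

lemma proj_chart_differentiable:
  assumes "c \<in> charts M" "y \<in> snd c ` fst c"
  shows "(\<lambda>y. proj (chart_inv c y) \<xi>) differentiable (at y)"
  using Ck_on_differentiable[OF Ck_proj[OF assms(1) Ck_on_const] assms(2)] .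

section \<open>Second derivatives of the immersion and the Levi-Civita connection\<close>

definition hess :: "('a, 'k) chart \<Rightarrow> real^'k \<Rightarrow> real^'k \<Rightarrow> real^'k \<Rightarrow> real^'r" where
  "hess c y v w = dird (\<lambda>z. dird (\<iota> \<circ> chart_inv c) z w) y v"

lemma hess_commute:
  assumes "c \<in> charts M" "y \<in> snd c ` fst c"
  shows "hess c y v w = hess c y w v"
  unfolding hess_def by (rule dird_commute[OF chart_open(2)[OF assms(1)] Ck_immersion[OF assms(1)] assms(2)])

lemma dird_immersion_differentiable:
  assumes "c \<in> charts M" "y \<in> snd c ` fst c"
  shows "(\<lambda>z. dird (\<iota> \<circ> chart_inv c) z w) differentiable (at y)"
  by (rule Ck_on_differentiable[OF Ck_on_dird[OF Ck_immersion[OF assms(1)]] assms(2)])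

lemma linear_hess:
  assumes "c \<in> charts M" "y \<in> snd c ` fst c"
  shows "linear (\<lambda>v. hess c y v w)" "linear (hess c y v)"
proof -
  show lin: "linear (\<lambda>v. hess c y v w)" for w
    unfolding hess_def by (intro linear_dird dird_immersion_differentiable assms)
  \<comment> \<open>Linearity in the inner direction is obtained from linearity in the outer one by
    symmetry.\<close>
  have "hess c y v = (\<lambda>w. hess c y w v)"
    using hess_commute[OF assms] by blast
  with lin[of v] show "linear (hess c y v)" by simp
qed

lemma dird_metric_in:
  assumes "c \<in> charts M" "y \<in> snd c ` fst c"
  shows "dird (\<lambda>y. metric_in M c y v w) y s =
    dird (\<iota> \<circ> chart_inv c) y v \<bullet> hess c y s w + hess c y s v \<bullet> dird (\<iota> \<circ> chart_inv c) y w"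
proof -
  have "dird (\<lambda>y. metric_in M c y v w) y s =
      dird (\<lambda>y. dird (\<iota> \<circ> chart_inv c) y v \<bullet> dird (\<iota> \<circ> chart_inv c) y w) y s"
    by (rule fun_cong[OF dird_cong_open[OF chart_open(2)[OF assms(1)] assms(2)]])
      (simp only: inner_dird_immersion[OF assms(1)])
  then show ?thesis
    by (simp add: dird_inner dird_immersion_differentiable[OF assms] hess_def)
qed

text \<open>In the Koszul formula each derivative of the metric is a sum of two products with second
  derivatives of the immersion. Four of the six terms cancel and the other two agree, so the
  connection is the tangential part of flat differentiation.\<close>

lemma christoffel_eq:
  assumes "c \<in> charts M" "y \<in> snd c ` fst c"
  shows "christoffel M c y v w = pinv (dird (\<iota> \<circ> chart_inv c) y) (hess c y v w)"
proof -
  have "christoffel1 M c y v w z = hess c y v w \<bullet> dird (\<iota> \<circ> chart_inv c) y z" for z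
    unfolding christoffel1_def dird_metric_in[OF assms]
    by (simp add: inner_commute hess_commute[OF assms, of w v] hess_commute[OF assms, of z])
  then show ?thesis
    unfolding christoffel_def pinv_def gram_def inner_dird_immersion[OF assms] by simp
qed

lemma dird_christoffel:
  assumes "c \<in> charts M" "y \<in> snd c ` fst c"
  shows "dird (\<iota> \<circ> chart_inv c) y (christoffel M c y v w) = proj (chart_inv c y) (hess c y v w)"
  by (simp only: christoffel_eq[OF assms] proj_chart[OF assms])

lemma L_eq: "L p = dird (\<iota> \<circ> chart_inv (chart_at M p)) (coord M p)"
  by (simp add: fun_eq_iff diff_fun_def)

abbreviation hess_at :: "'a \<Rightarrow> real^'k \<Rightarrow> real^'k \<Rightarrow> real^'r" where
  "hess_at p \<equiv> hess (chart_at M p) (coord M p)"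

lemma L_gamma: "L p (gamma_at M p v w) = proj p (hess_at p v w)"
  using dird_christoffel[of "chart_at M p" "coord M p" v w] by (simp add: gamma_at_def L_eq)

abbreviation B :: "'a \<Rightarrow> real^'k \<Rightarrow> real^'k \<Rightarrow> real^'r" where "B \<equiv> second_ff M \<iota>"

lemma second_ff_eq: "B p v w = hess_at p v w - proj p (hess_at p v w)"
  by (simp add: second_ff_def cov_hessian_def Let_def L_gamma) (simp add: hess_def)

lemma second_ff_commute: "B p v w = B p w v"
  by (simp add: second_ff_eq hess_commute[of "chart_at M p" "coord M p" v w])

lemma bilinear_second_ff: "bilinear (B p)"
proof -
  have "linear (\<lambda>v. B p v w)" for w
    unfolding second_ff_eq[abs_def]
    using linear_compose_sub[OF linear_hess(1) linear_compose[OF linear_hess(1) linear_proj]]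
    by (simp add: o_def)
  then show ?thesis
    unfolding bilinear_def using second_ff_commute[of p] by (metis (no_types, lifting) ext)
qed

lemma proj_second_ff [simp]: "proj p (B p v w) = 0"
  by (simp add: second_ff_eq linear_diff[OF linear_proj])

text \<open>Differentiate the identity saying that the projection fixes \<open>dird ?h y w\<close>:
  what the projection misses of the second derivative is the derivative of the projection itself. B
  is thus read off from \<open>proj\<close>, which involves no choice of coordinates.\<close>

lemma diff_fun_proj:
  "diff_fun M (\<lambda>q. proj q (L p w)) p v = B p v w"
proof -
  let ?c = "chart_at M p" and ?y = "coord M p"
  let ?h = "\<iota> \<circ> chart_inv ?c"
  have proj_h: "proj (chart_inv ?c y) (dird ?h y w) = dird ?h y w" if "y \<in> snd ?c ` fst ?c" for y
    using proj_chart[OF _ that] that by (simp add: linear_dird_immersion inj_dird_immersion)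
  have "dird (\<lambda>y. proj (chart_inv ?c y) (dird ?h y w)) ?y v = dird (\<lambda>y. dird ?h y w) ?y v"
    by (rule fun_cong[OF dird_cong_open[OF chart_open(2)[OF chart_at(1)] coord_in proj_h]])
  moreover have "dird (\<lambda>y. proj (chart_inv ?c y) (dird ?h y w)) ?y v
    = dird (\<lambda>y. proj (chart_inv ?c y) (dird ?h ?y w)) ?y v + proj (chart_inv ?c ?y) (dird (\<lambda>y. dird ?h y w) ?y v)"
    by (rule dird_linear_field(1)[OF chart_open(2)[OF chart_at(1)] coord_in])
      (auto intro: proj_chart_differentiable dird_immersion_differentiable linear_proj)
  ultimately show ?thesis
    by (simp add: second_ff_eq hess_def diff_fun_def o_def L_eq eq_diff_eq)
qed

definition ambient_ff :: "'a \<Rightarrow> real^'r \<Rightarrow> real^'r \<Rightarrow> real^'r" where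
  "ambient_ff p \<xi> \<eta> = B p (tang p \<xi>) (tang p \<eta>)"

lemma bilinear_ambient_ff: "bilinear (ambient_ff p)"
  using bilinear_second_ff[of p] linear_tang[of p]
  unfolding bilinear_def ambient_ff_def linear_iff by simp

lemma ambient_ff_L [simp]: "ambient_ff p (L p v) (L p w) = B p v w"
  by (simp add: ambient_ff_def)

lemma ambient_ff_commute: "ambient_ff p \<xi> \<eta> = ambient_ff p \<eta> \<xi>"
  by (simp add: ambient_ff_def second_ff_commute)

lemma Ck_proj_chart: "c \<in> charts M \<Longrightarrow> Ck_on k (\<lambda>y. proj (chart_inv c y) \<xi>) (snd c ` fst c)"
  by (intro Ck_proj Ck_on_const)

lemma continuous_on_proj: "continuous_on UNIV (\<lambda>p. proj p \<xi>)"
  by (rule continuous_on_UNIV_chartI) (use Ck_on_imp_continuous[OF Ck_proj_chart] in \<open>simp add: o_def\<close>)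

text \<open>B is defined through \<open>chart_at\<close>, which jumps with the point; as a
  derivative of \<open>proj\<close>, by \<open>diff_fun_proj\<close>, it can be computed in the
  single chart \<open>c\<close>.\<close>

lemma continuous_on_ambient_ff: "continuous_on UNIV (\<lambda>p. ambient_ff p \<xi> \<eta>)"
proof (rule continuous_on_UNIV_chartI)
  fix c assume c: "c \<in> charts M"
  let ?P = "\<lambda>y \<xi>. proj (chart_inv c y) \<xi>" and ?h = "\<iota> \<circ> chart_inv c"
  have eq: "ambient_ff (chart_inv c y) \<xi> \<eta> =
      (\<Sum>i\<in>Basis. (?P y \<eta> \<bullet> i) *\<^sub>R dird (\<lambda>z. ?P z i) y (pinv (dird ?h y) \<xi>))"
    if y: "y \<in> snd c ` fst c" for y
  proof -
    let ?p = "chart_inv c y"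
    have p: "?p \<in> fst c" "snd c ?p = y" using c y by auto
    have "ambient_ff ?p \<xi> \<eta> = diff_fun M (\<lambda>q. proj q (proj ?p \<eta>)) ?p (tang ?p \<xi>)"
      by (simp only: proj_def[of ?p \<eta>] diff_fun_proj ambient_ff_def)
    also have "\<dots> = dird (\<lambda>z. ?P z (proj ?p \<eta>)) y (pinv (dird ?h y) \<xi>)"
      using diff_fun_chart(1)[OF c p(1), of "\<lambda>q. proj q (proj ?p \<eta>)" "tang ?p \<xi>"]
        proj_chart_differentiable[OF c y] tang_chart[OF c p(1), of \<xi>] p by (simp add: o_def)
    \<comment> \<open>The projected vector inside the derivative depends on the base point;
      expanding it in \<open>Basis\<close> leaves derivatives of fixed functions.\<close>
    also have "\<dots> = (\<Sum>i\<in>Basis. (?P y \<eta> \<bullet> i) *\<^sub>R dird (\<lambda>z. ?P z i) y (pinv (dird ?h y) \<xi>))"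
      by (rule dird_linear_field(2)[OF chart_open(2)[OF c] y linear_proj proj_chart_differentiable[OF c y]
            differentiable_const])
    finally show ?thesis .
  qed
  have "Ck_on 0 (\<lambda>y. \<Sum>i\<in>Basis. (?P y \<eta> \<bullet> i) *\<^sub>R dird (\<lambda>z. ?P z i) y (pinv (dird ?h y) \<xi>)) (snd c ` fst c)"
    by (intro Ck_on_sum Ck_on_scaleR Ck_on_inner Ck_on_const Ck_on_dird_field Ck_proj_chart Ck_pinv c chart_open)
  then have "Ck_on 0 (\<lambda>y. ambient_ff (chart_inv c y) \<xi> \<eta>) (snd c ` fst c)"
    by (rule Ck_on_cong[OF chart_open(2)[OF c], rotated]) (simp only: eq)
  then show "continuous_on (snd c ` fst c) ((\<lambda>p. ambient_ff p \<xi> \<eta>) \<circ> chart_inv c)"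
    by (simp add: o_def)
qed

end

section \<open>Tangential fields and the Gauss equation\<close>

lemma Ck_on_local:
  assumes "\<And>x. x \<in> S \<Longrightarrow> \<exists>T. open T \<and> x \<in> T \<and> Ck_on k f T"
  shows "Ck_on k f S"
  using assms
proof (induction k arbitrary: f)
  case 0
  then show ?case
    by (meson Ck_on.simps(1) continuous_at_imp_continuous_on continuous_on_eq_continuous_at)
next
  case (Suc k)
  have "f differentiable (at x)" if "x \<in> S" for x
    using Suc.prems[OF that] Ck_on_differentiable by blast
  moreover have "Ck_on k (\<lambda>x. dird f x v) S" for v
  proof (rule Suc.IH)
    fix x assume "x \<in> S"
    from Suc.prems[OF this] obtain T where "open T" "x \<in> T" "Ck_on (Suc k) f T" by blast
    then show "\<exists>T. open T \<and> x \<in> T \<and> Ck_on k (\<lambda>x. dird f x v) T"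
      using Ck_on_dird[of k f T v] by blast
  qed
  ultimately show ?case by (simp add: Ck_on_Suc)
qed

context immersed
begin

lemma Ck_hess: "c \<in> charts M \<Longrightarrow> Ck_on k (\<lambda>y. hess c y v w) (snd c ` fst c)"
  unfolding hess_def by (intro Ck_on_dird Ck_immersion)

text \<open>The covariant derivative of the tangential part of an ambient field
  \<open>\<xi>\<close>, found by differentiating the normal equations. A constant
  \<open>\<xi>\<close> gives the derivative of the test fields; second derivatives of the immersion
  give the Gauss equation.\<close>

lemma pinv_field_derivative:
  assumes "Ck_on 1 \<xi> (snd (chart_at M p) ` fst (chart_at M p))"
  defines "h \<equiv> \<iota> \<circ> chart_inv (chart_at M p)" and "y0 \<equiv> coord M p"
  shows "L p (dird (\<lambda>y. pinv (dird h y) (\<xi> y)) y0 v + gamma_at M p v (tang p (\<xi> y0))) \<bullet> L p s =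
    dird \<xi> y0 v \<bullet> L p s + B p v s \<bullet> \<xi> y0"
proof -
  let ?c = "chart_at M p" and ?\<psi> = "\<lambda>y. pinv (dird h y) (\<xi> y)"
  have d\<xi>: "\<xi> differentiable (at y0)"
    using assms(1) Ck_on_differentiable[of 0 \<xi>] by (simp add: y0_def)
  have d\<psi>: "?\<psi> differentiable (at y0)"
    using Ck_pinv[OF chart_at(1) assms(1)] Ck_on_differentiable[of 0 ?\<psi>] by (simp add: h_def y0_def)
  have dh: "(\<lambda>y. dird h y w) differentiable (at y0)" for w
    unfolding h_def y0_def by (intro dird_immersion_differentiable) simp_all
  have L: "L p = dird h y0" by (simp add: L_eq h_def y0_def)
  have normal_eq: "dird h y s \<bullet> dird h y (?\<psi> y) = dird h y s \<bullet> \<xi> y" if "y \<in> snd ?c ` fst ?c" for y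
    using pinv_inner[OF linear_dird_immersion inj_dird_immersion, of ?c y "\<xi> y" s] that
    by (simp add: h_def inner_commute)
  have "dird (\<lambda>y. dird h y s \<bullet> dird h y (?\<psi> y)) y0 v = dird (\<lambda>y. dird h y s \<bullet> \<xi> y) y0 v"
    unfolding y0_def
    by (rule fun_cong[OF dird_cong_open[OF chart_open(2)[OF chart_at(1)] coord_in]]) (rule normal_eq)
  moreover have "dird (\<lambda>y. dird h y s \<bullet> \<xi> y) y0 v = dird h y0 s \<bullet> dird \<xi> y0 v + hess_at p v s \<bullet> \<xi> y0"
    using dird_inner[OF dh d\<xi>] by (simp add: hess_def h_def y0_def)
  moreover have "(\<lambda>y. dird h y (?\<psi> y)) differentiable (at y0)"
  proof -
    have "Ck_on (Suc 0) (\<lambda>y. dird h y (?\<psi> y)) (snd ?c ` fst ?c)"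
      unfolding h_def using assms(1)
      by (intro Ck_on_dird_field Ck_immersion Ck_pinv chart_open) simp_all
    from Ck_on_differentiable[OF this] show ?thesis by (simp add: y0_def)
  qed
  then have "dird (\<lambda>y. dird h y s \<bullet> dird h y (?\<psi> y)) y0 v =
      dird h y0 s \<bullet> dird (\<lambda>y. dird h y (?\<psi> y)) y0 v + hess_at p v s \<bullet> dird h y0 (?\<psi> y0)"
    using dird_inner[OF dh] by (simp add: hess_def h_def y0_def)
  moreover have "dird (\<lambda>y. dird h y (?\<psi> y)) y0 v = hess_at p v (?\<psi> y0) + dird h y0 (dird ?\<psi> y0 v)"
    unfolding hess_def h_def[symmetric] y0_def[symmetric]
    by (rule dird_linear_field(1)[OF chart_open(2)[OF chart_at(1)] coord_in[of p, folded y0_def] _ dh d\<psi>])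
      (simp add: h_def linear_dird_immersion)
  ultimately have *: "L p s \<bullet> (hess_at p v (tang p (\<xi> y0)) + L p (dird ?\<psi> y0 v)) + hess_at p v s \<bullet> proj p (\<xi> y0)
      = L p s \<bullet> dird \<xi> y0 v + hess_at p v s \<bullet> \<xi> y0"
    by (simp only: L[symmetric] proj_def tang_def)
  have "L p s \<bullet> L p (gamma_at M p v (tang p (\<xi> y0))) = L p s \<bullet> hess_at p v (tang p (\<xi> y0))"
    by (metis L_gamma inner_proj proj_L)
  moreover have "B p v s \<bullet> \<xi> y0 = hess_at p v s \<bullet> \<xi> y0 - hess_at p v s \<bullet> proj p (\<xi> y0)"
    by (simp add: second_ff_eq inner_diff_left inner_proj)
  ultimately show ?thesis using *
    by (simp add: linear_add[OF linear_L] inner_add_left inner_add_right inner_commute)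
qed

text \<open>The field \<Gamma>(w, z) is the tangential part of the second derivative of the
  immersion, so \<open>pinv_field_derivative\<close> evaluates its covariant derivative along
  \<open>v\<close>. Antisymmetrising in \<open>v\<close> and \<open>w\<close> cancels the third
  derivatives and leaves products of B.\<close>

lemma gauss_equation:
  "metric M p (curvature M p v w z) s = B p w z \<bullet> B p v s - B p v z \<bullet> B p w s"
proof -
  let ?c = "chart_at M p" and ?y = "coord M p"
  let ?h = "\<iota> \<circ> chart_inv ?c"
  let ?\<Gamma> = "christoffel M ?c"
  have key: "L p (dird (\<lambda>y. ?\<Gamma> y w z) ?y v + ?\<Gamma> ?y v (?\<Gamma> ?y w z)) \<bullet> L p s =
      dird (\<lambda>y. hess ?c y w z) ?y v \<bullet> L p s + B p v s \<bullet> hess_at p w z" for v w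
  proof -
    have "dird (\<lambda>y. ?\<Gamma> y w z) ?y = dird (\<lambda>y. pinv (dird ?h y) (hess ?c y w z)) ?y"
      by (rule dird_cong_open[OF chart_open(2)[OF chart_at(1)] coord_in]) (simp add: christoffel_eq)
    moreover have "?\<Gamma> ?y w z = tang p (hess ?c ?y w z)"
      by (simp add: christoffel_eq tang_def L_eq)
    ultimately show ?thesis
      using pinv_field_derivative[of "\<lambda>y. hess ?c y w z" p v s, OF Ck_hess[OF chart_at(1)]]
      by (simp only: gamma_at_def)
  qed
  have "dird (\<lambda>y. hess ?c y w z) ?y v = dird (\<lambda>y. hess ?c y v z) ?y w"
    unfolding hess_def
    by (rule dird_commute[OF chart_open(2)[OF chart_at(1)] Ck_on_dird[OF Ck_immersion[OF chart_at(1)]] coord_in])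
  moreover have "L p (curvature M p v w z) =
      L p (dird (\<lambda>y. ?\<Gamma> y w z) ?y v + ?\<Gamma> ?y v (?\<Gamma> ?y w z)) -
      L p (dird (\<lambda>y. ?\<Gamma> y v z) ?y w + ?\<Gamma> ?y w (?\<Gamma> ?y v z))"
    by (simp add: curvature_def Let_def linear_add[OF linear_L] linear_diff[OF linear_L])
  \<comment> \<open>B is normal, so it sees only the normal part of the second derivative.\<close>
  moreover have "B p v s \<bullet> hess_at p w z = B p v s \<bullet> B p w z" for v w
    using inner_proj[of p "B p v s" "hess_at p w z"] by (simp add: second_ff_eq[of p w z] inner_diff_right)
  ultimately show ?thesis
    unfolding inner_L[symmetric] by (simp add: inner_diff_left key) (simp add: inner_commute)
qed

end

section \<open>Maps into an immersed manifold and fields along them\<close>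

locale immersed_map = immersed M \<iota> + N: riemannian N
  for M :: "('m::{t2_space, second_countable_topology}, 'l::finite) rmfd"
    and \<iota> :: "'m \<Rightarrow> real^'r::finite"
    and N :: "('n::{t2_space, second_countable_topology}, 'k::finite) rmfd" +
  fixes u :: "'n \<Rightarrow> 'm"
  assumes smooth_u: "smooth_map N M u"
begin

lemma continuous_u: "continuous_on UNIV u"
  using smooth_u by (simp add: smooth_map_def)

lemma open_map_overlap:
  assumes "c \<in> charts N" "d \<in> charts M"
  shows "open (snd c ` (fst c \<inter> u -` fst d))"
proof (rule N.open_chart_image[OF assms(1)])
  show "open (fst c \<inter> u -` fst d)"
    by (intro open_Int open_vimage[OF _ continuous_u] N.chart_open chart_open assms)
qed auto

lemma Ck_map:
  "c \<in> charts N \<Longrightarrow> d \<in> charts M \<Longrightarrow> Ck_on k (\<lambda>y. snd d (u (chart_inv c y))) (snd c ` (fst c \<inter> u -` fst d))"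
  using smooth_u by (auto simp: smooth_map_def o_def dest!: smooth_on_Ck)

lemma Ck_compose_map:
  assumes "c \<in> charts N" "d \<in> charts M" "Ck_on k f (snd d ` fst d)"
  shows "Ck_on k (\<lambda>y. f (snd d (u (chart_inv c y)))) (snd c ` (fst c \<inter> u -` fst d))"
  by (rule Ck_on_compose[OF open_map_overlap[OF assms(1,2)] chart_open(2)[OF assms(2)] assms(3)
        Ck_map[OF assms(1,2)]]) (use assms(1) in auto)

lemma coord_in_overlap [simp]:
  "coord N p \<in> snd (chart_at N p) ` (fst (chart_at N p) \<inter> u -` fst (chart_at M (u p)))"
  by (auto simp: coord_def)

lemma map_differentiable:
  "(\<lambda>y. snd (chart_at M (u p)) (u (chart_inv (chart_at N p) y))) differentiable (at (coord N p))"
  by (rule Ck_on_differentiable[OF Ck_map coord_in_overlap]) simp_all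

lemma linear_diff_map: "linear (diff_map N M u p)"
  using linear_dird[OF map_differentiable] by (simp add: diff_map_def[abs_def] o_def)

lemma map_coord: "snd (chart_at M (u p)) (u (chart_inv (chart_at N p) (coord N p))) = coord M (u p)"
  by (simp add: coord_def)

text \<open>Composition with the immersion replaces \<open>u\<close>, which is accessible only
  through charts of M, by a map into a fixed Euclidean space.\<close>

lemma L_diff_map: "L (u p) (diff_map N M u p v) = diff_fun N (\<iota> \<circ> u) p v"
proof -
  let ?c = "chart_at N p" and ?d = "chart_at M (u p)"
  let ?U = "\<lambda>y. snd ?d (u (chart_inv ?c y))" and ?h = "\<iota> \<circ> chart_inv ?d"
  have "dird (\<lambda>y. ?h (?U y)) (coord N p) v = dird ?h (?U (coord N p)) (dird ?U (coord N p) v)"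
    by (rule dird_compose[OF map_differentiable]) (simp only: map_coord, rule immersion_differentiable, simp_all)
  moreover have "dird (\<lambda>y. ?h (?U y)) (coord N p) = dird (\<iota> \<circ> u \<circ> chart_inv ?c) (coord N p)"
    by (rule dird_cong_open[OF open_map_overlap coord_in_overlap]) auto
  ultimately show ?thesis
    by (simp add: coord_def[of M] L_eq diff_map_def diff_fun_def o_def)
qed

text \<open>The image of one chart domain of N may meet many charts of M, hence the local
  criterion.\<close>

lemma Ck_immersed_map:
  assumes c: "c \<in> charts N"
  shows "Ck_on k (\<iota> \<circ> u \<circ> chart_inv c) (snd c ` fst c)"
proof (rule Ck_on_local)
  fix y assume y: "y \<in> snd c ` fst c"
  let ?d = "chart_at M (u (chart_inv c y))"
  let ?T = "snd c ` (fst c \<inter> u -` fst ?d)"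
  have "Ck_on k (\<lambda>y. (\<iota> \<circ> chart_inv ?d) (snd ?d (u (chart_inv c y)))) ?T"
    by (intro Ck_compose_map Ck_immersion c) simp_all
  then have "Ck_on k (\<iota> \<circ> u \<circ> chart_inv c) ?T"
    by (rule Ck_on_cong[OF open_map_overlap[OF c chart_at(1)], rotated]) (use c in auto)
  moreover have "y \<in> ?T" using y c by auto
  ultimately show "\<exists>T. open T \<and> y \<in> T \<and> Ck_on k (\<iota> \<circ> u \<circ> chart_inv c) T"
    using open_map_overlap[OF c chart_at(1)] by blast
qed

lemma field_in_tang:
  assumes "c \<in> charts N" "d \<in> charts M" "y \<in> snd c ` (fst c \<inter> u -` fst d)"
  shows "field_in N M u (\<lambda>p. tang (u p) E) c d y =
    pinv (dird (\<iota> \<circ> chart_inv d) (snd d (u (chart_inv c y)))) E"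
  using assms by (auto simp: field_in_def Let_def tang_chart)

lemma smooth_field_tang: "smooth_field_along N M u (\<lambda>p. tang (u p) E)"
  unfolding smooth_field_along_def smooth_on_def
proof (intro ballI allI)
  fix c d k assume cd: "c \<in> charts N" "d \<in> charts M"
  have "Ck_on k (\<lambda>y. pinv (dird (\<iota> \<circ> chart_inv d) (snd d (u (chart_inv c y)))) E) (snd c ` (fst c \<inter> u -` fst d))"
    by (rule Ck_compose_map[OF cd Ck_pinv[OF cd(2) Ck_on_const]])
  then show "Ck_on k (field_in N M u (\<lambda>p. tang (u p) E) c d) (snd c ` (fst c \<inter> u -` fst d))"
    by (rule Ck_on_cong[OF open_map_overlap[OF cd], rotated]) (simp only: field_in_tang[OF cd])
qed

text \<open>This is \<open>pinv_field_derivative\<close> for the constant field \<open>E\<close>,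
  whose flat derivative vanishes, combined with the chain rule for \<open>u\<close>.\<close>

lemma pullback_nabla_tang:
  "metric M (u p) (pullback_nabla N M u (\<lambda>p. tang (u p) E) p v) s = B (u p) (diff_map N M u p v) s \<bullet> E"
proof -
  let ?c = "chart_at N p" and ?d = "chart_at M (u p)"
  let ?U = "\<lambda>y. snd ?d (u (chart_inv ?c y))"
  let ?\<psi> = "\<lambda>z. pinv (dird (\<iota> \<circ> chart_inv ?d) z) E"
  have "Ck_on 1 ?\<psi> (snd ?d ` fst ?d)" by (rule Ck_pinv[OF chart_at(1) Ck_on_const])
  then have "?\<psi> differentiable (at (?U (coord N p)))"
    using Ck_on_differentiable[of 0 ?\<psi>] by (simp add: map_coord)
  from dird_compose[OF map_differentiable this]
  have "dird (\<lambda>y. ?\<psi> (?U y)) (coord N p) v = dird ?\<psi> (coord M (u p)) (diff_map N M u p v)"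
    by (simp add: coord_def[of M] diff_map_def o_def)
  moreover have "dird (field_in N M u (\<lambda>p. tang (u p) E) ?c ?d) (coord N p) = dird (\<lambda>y. ?\<psi> (?U y)) (coord N p)"
    by (rule dird_cong_open[OF open_map_overlap coord_in_overlap]) (simp_all add: field_in_tang)
  ultimately have "pullback_nabla N M u (\<lambda>p. tang (u p) E) p v =
      dird ?\<psi> (coord M (u p)) (diff_map N M u p v) + gamma_at M (u p) (diff_map N M u p v) (tang (u p) E)"
    by (simp add: pullback_nabla_def)
  then show ?thesis
    using pinv_field_derivative[of "\<lambda>_. E" "u p" "diff_map N M u p v" s, OF Ck_on_const]
    by (simp add: inner_L)
qed

text \<open>Serves the case of a test field that vanishes identically, about which
  \<open>Phi_sym_stable\<close> says nothing.\<close>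

lemma pullback_nabla_zero: "pullback_nabla N M u (\<lambda>_. 0) p v = 0"
proof -
  let ?c = "chart_at N p" and ?d = "chart_at M (u p)"
  have "dird (field_in N M u (\<lambda>_. 0) ?c ?d) (coord N p) = dird (\<lambda>_. 0) (coord N p)"
    by (rule dird_cong_open[OF open_map_overlap coord_in_overlap])
      (auto simp: field_in_def linear_0[OF linear_to_chart])
  moreover have "gamma_at M (u p) w 0 = 0" for w
    using tang_L[of "u p" "gamma_at M (u p) w 0"]
    by (simp add: L_gamma linear_0[OF linear_hess(2)] linear_0[OF linear_tang])
  ultimately show ?thesis by (simp add: pullback_nabla_def)
qed

end

section \<open>Quadratic forms of a frame\<close>

lemma bilinearD:
  assumes "bilinear f"
  shows "f (x + y) z = f x z + f y z" "f w (p + q) = f w p + f w q"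
    "f (r *\<^sub>R x) z = r *\<^sub>R f x z" "f w (r *\<^sub>R p) = r *\<^sub>R f w p"
    "f (\<Sum>i\<in>I. g i) z = (\<Sum>i\<in>I. f (g i) z)" "f w (\<Sum>i\<in>I. h i) = (\<Sum>i\<in>I. f w (h i))"
  using assms linear_sum[of "\<lambda>x. f x z" g I] linear_sum[of "f w" h I]
  by (auto simp: bilinear_ladd bilinear_radd bilinear_lmul bilinear_rmul bilinear_def)

lemma bilinear_sum_scaleR:
  assumes "bilinear f"
  shows "f (\<Sum>i\<in>I. x i *\<^sub>R a i) (\<Sum>j\<in>J. y j *\<^sub>R c j) =
    (\<Sum>i\<in>I. \<Sum>j\<in>J. (x i * y j) *\<^sub>R f (a i) (c j))"
proof -
  have "f (\<Sum>i\<in>I. x i *\<^sub>R a i) (\<Sum>j\<in>J. y j *\<^sub>R c j) =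
      (\<Sum>i\<in>I. x i *\<^sub>R f (a i) (\<Sum>j\<in>J. y j *\<^sub>R c j))"
    by (simp only: bilinearD(3,5)[OF assms])
  also have "\<dots> = (\<Sum>i\<in>I. \<Sum>j\<in>J. (x i * y j) *\<^sub>R f (a i) (c j))"
    by (simp only: bilinearD(4,6)[OF assms] scaleR_sum_right scaleR_scaleR)
  finally show ?thesis .
qed

lemma bilinear_Basis_sum:
  fixes f :: "'a::euclidean_space \<Rightarrow> 'b::euclidean_space \<Rightarrow> 'c::real_vector"
  assumes "bilinear f"
  shows "f x y = (\<Sum>b\<in>Basis. \<Sum>c\<in>Basis. ((x \<bullet> b) * (y \<bullet> c)) *\<^sub>R f b c)"
proof -
  show ?thesis
    using bilinear_sum_scaleR[OF assms, of "\<lambda>b. x \<bullet> b" "\<lambda>b. b" Basis "\<lambda>b. y \<bullet> b" "\<lambda>b. b" Basis]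
    by (simp add: euclidean_representation)
qed

text \<open>The right side contains the vectors \<open>a i\<close> only through the matrix of sums
  of (a i \<bullet> b) (a i \<bullet> d), which for the image of an orthonormal frame does not
  depend on the frame. Continuity can be proved for it although frames are chosen
  discontinuously.\<close>

lemma double_frame_sum:
  fixes a :: "'i \<Rightarrow> 'a::euclidean_space" and f h :: "'a \<Rightarrow> 'a \<Rightarrow> real"
  assumes "bilinear f" "bilinear h"
  shows "(\<Sum>i\<in>I. \<Sum>j\<in>I. f (a i) (a j) * h (a i) (a j)) =
    (\<Sum>b\<in>Basis. \<Sum>c\<in>Basis. \<Sum>d\<in>Basis. \<Sum>e\<in>Basis.
      f b c * h d e * (\<Sum>i\<in>I. (a i \<bullet> b) * (a i \<bullet> d)) * (\<Sum>j\<in>I. (a j \<bullet> c) * (a j \<bullet> e)))"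
    (is "?l = ?r")
proof -
  let ?t = "\<lambda>i j b c d e. ((a i \<bullet> b) * (a j \<bullet> c) * f b c) * ((a i \<bullet> d) * (a j \<bullet> e) * h d e)"
  have "?l = (\<Sum>i\<in>I. \<Sum>j\<in>I. \<Sum>b\<in>Basis. \<Sum>c\<in>Basis. \<Sum>d\<in>Basis. \<Sum>e\<in>Basis. ?t i j b c d e)"
    by (subst bilinear_Basis_sum[OF assms(1)], subst bilinear_Basis_sum[OF assms(2)])
      (simp only: real_scaleR_def sum_distrib_right, simp only: sum_distrib_left)
  also have "\<dots> = (\<Sum>b\<in>Basis. \<Sum>c\<in>Basis. \<Sum>d\<in>Basis. \<Sum>e\<in>Basis. \<Sum>i\<in>I. \<Sum>j\<in>I. ?t i j b c d e)"
    by (simp only: sum.swap[where A = I and B = Basis])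
  also have "\<dots> = ?r"
    by (simp add: sum_distrib_left sum_distrib_right mult_ac)
  finally show ?thesis .
qed

definition frame_op :: "('i::finite \<Rightarrow> 'a::euclidean_space) \<Rightarrow> 'a \<Rightarrow> 'a" where
  "frame_op a b = (\<Sum>i\<in>UNIV. (a i \<bullet> b) *\<^sub>R a i)"

text \<open>Parseval over the standard basis. It does the work of diagonalising the Gram matrix: a
  double sum with Gram coefficients becomes a diagonal sum.\<close>

lemma sum_gram_bilinear:
  fixes a :: "'i::finite \<Rightarrow> 'a::euclidean_space" and f :: "'a \<Rightarrow> 'a \<Rightarrow> 'b::real_vector"
  assumes "bilinear f"
  shows "(\<Sum>i\<in>UNIV. \<Sum>j\<in>UNIV. (a i \<bullet> a j) *\<^sub>R f (a i) (a j)) =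
    (\<Sum>b\<in>Basis. f (frame_op a b) (frame_op a b))"
proof -
  have "(\<Sum>b\<in>Basis. f (frame_op a b) (frame_op a b)) =
      (\<Sum>b\<in>Basis. \<Sum>i\<in>UNIV. \<Sum>j\<in>UNIV. ((a i \<bullet> b) * (a j \<bullet> b)) *\<^sub>R f (a i) (a j))"
    by (simp only: frame_op_def bilinear_sum_scaleR[OF assms])
  also have "\<dots> = (\<Sum>i\<in>UNIV. \<Sum>j\<in>UNIV. \<Sum>b\<in>Basis. ((a i \<bullet> b) * (a j \<bullet> b)) *\<^sub>R f (a i) (a j))"
    by (simp only: sum.swap[where A = Basis and B = UNIV])
  also have "\<dots> = (\<Sum>i\<in>UNIV. \<Sum>j\<in>UNIV. (a i \<bullet> a j) *\<^sub>R f (a i) (a j))"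
    by (simp only: scaleR_sum_left[symmetric] euclidean_inner[symmetric])
  finally show ?thesis by simp
qed

text \<open>In matrix form, with \<open>S = frame_op a\<close>, \<open>tr (S b S b) \<le> tr (S\<^sup>2 b\<^sup>2)\<close>, which is \<open>\<parallel>S b - b S\<parallel>\<^sup>2 \<ge> 0\<close>.\<close>

lemma sum_norm_bilinear_le:
  fixes a :: "'i::finite \<Rightarrow> 'a::euclidean_space" and f :: "'a \<Rightarrow> 'a \<Rightarrow> 'b::real_inner"
  assumes "bilinear f" "\<And>x y. f x y = f y x"
  shows "(\<Sum>i\<in>UNIV. \<Sum>j\<in>UNIV. (norm (f (a i) (a j)))\<^sup>2) \<le>
    (\<Sum>b\<in>Basis. \<Sum>c\<in>Basis. (norm (f (frame_op a b) c))\<^sup>2)"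
proof -
  let ?W = "\<lambda>b c. f (frame_op a b) c"
  have exp: "(\<Sum>c\<in>Basis. (x \<bullet> c) *\<^sub>R f y c) = f y x" for x y
  proof -
    have "f y (\<Sum>c\<in>Basis. (x \<bullet> c) *\<^sub>R c) = (\<Sum>c\<in>Basis. (x \<bullet> c) *\<^sub>R f y c)"
      by (simp add: bilinearD[OF assms(1)])
    then show ?thesis by (simp add: euclidean_representation)
  qed
  have "?W b c \<bullet> ?W c b =
      (\<Sum>i\<in>UNIV. \<Sum>j\<in>UNIV. ((a j \<bullet> c) *\<^sub>R f (a i) c) \<bullet> ((a i \<bullet> b) *\<^sub>R f (a j) b))" for b c
  proof -
    have "?W b c \<bullet> ?W c b = (\<Sum>i\<in>UNIV. ((a i \<bullet> b) *\<^sub>R f (a i) c) \<bullet> ?W c b)"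
      by (simp only: frame_op_def[of a b] bilinearD(3,5)[OF assms(1)] inner_sum_left)
    also have "\<dots> = (\<Sum>i\<in>UNIV. \<Sum>j\<in>UNIV. ((a i \<bullet> b) *\<^sub>R f (a i) c) \<bullet> ((a j \<bullet> c) *\<^sub>R f (a j) b))"
      by (simp only: frame_op_def bilinearD(3,5)[OF assms(1)] inner_sum_right)
    finally show ?thesis by (simp add: mult.left_commute)
  qed
  then have "(\<Sum>b\<in>Basis. \<Sum>c\<in>Basis. ?W b c \<bullet> ?W c b) =
      (\<Sum>b\<in>Basis. \<Sum>c\<in>Basis. \<Sum>i\<in>UNIV. \<Sum>j\<in>UNIV. ((a j \<bullet> c) *\<^sub>R f (a i) c) \<bullet> ((a i \<bullet> b) *\<^sub>R f (a j) b))"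
    by (simp only:)
  also have "\<dots> = (\<Sum>i\<in>UNIV. \<Sum>j\<in>UNIV. \<Sum>b\<in>Basis. \<Sum>c\<in>Basis. ((a j \<bullet> c) *\<^sub>R f (a i) c) \<bullet> ((a i \<bullet> b) *\<^sub>R f (a j) b))"
    by (simp only: sum.swap[where A = Basis and B = UNIV])
  also have "\<dots> = (\<Sum>i\<in>UNIV. \<Sum>j\<in>UNIV. (\<Sum>c\<in>Basis. (a j \<bullet> c) *\<^sub>R f (a i) c) \<bullet> (\<Sum>b\<in>Basis. (a i \<bullet> b) *\<^sub>R f (a j) b))"
    by (simp only: inner_sum_left inner_sum_right)
  also have "\<dots> = (\<Sum>i\<in>UNIV. \<Sum>j\<in>UNIV. (norm (f (a i) (a j)))\<^sup>2)"
    by (simp only: exp assms(2)[of "a _" "a _"] power2_norm_eq_inner)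
  finally have eq: "(\<Sum>b\<in>Basis. \<Sum>c\<in>Basis. ?W b c \<bullet> ?W c b) = (\<Sum>i\<in>UNIV. \<Sum>j\<in>UNIV. (norm (f (a i) (a j)))\<^sup>2)" .
  have "(\<Sum>b\<in>Basis. \<Sum>c\<in>Basis. 2 * (?W b c \<bullet> ?W c b)) \<le> (\<Sum>b\<in>Basis. \<Sum>c\<in>Basis. (norm (?W b c))\<^sup>2 + (norm (?W c b))\<^sup>2)"
  proof (intro sum_mono)
    fix b c
    show "2 * (?W b c \<bullet> ?W c b) \<le> (norm (?W b c))\<^sup>2 + (norm (?W c b))\<^sup>2"
      using inner_ge_zero[of "?W b c - ?W c b"]
      by (simp add: inner_diff_left inner_diff_right power2_norm_eq_inner inner_commute)
  qed
  moreover have "(\<Sum>b\<in>Basis. \<Sum>c\<in>Basis. (norm (?W c b))\<^sup>2) = (\<Sum>b\<in>Basis. \<Sum>c\<in>Basis. (norm (?W b c))\<^sup>2)"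
    by (rule sum.swap)
  ultimately show ?thesis by (simp add: eq sum.distrib flip: sum_distrib_left)
qed

section \<open>The \<Phi>-SSU form on ambient vectors\<close>

context immersed
begin

definition ambient_ssu :: "'a \<Rightarrow> real^'r \<Rightarrow> real" where
  "ambient_ssu p \<xi> = (\<Sum>b\<in>Basis. 4 * (ambient_ff p \<xi> b \<bullet> ambient_ff p \<xi> b) - ambient_ff p \<xi> \<xi> \<bullet> ambient_ff p b b)"

text \<open>As \<open>tang p\<close> is the adjoint of an isometry, a trace over the ambient basis
  is a trace over a tangent frame, normal directions contributing nothing.\<close>

lemma trace_tang:
  fixes f :: "real^'k \<Rightarrow> real^'k \<Rightarrow> real"
  assumes "bilinear f"
  shows "(\<Sum>b\<in>Basis. f (tang p b) (tang p b)) = (\<Sum>i\<in>UNIV. f (frame_at M p i) (frame_at M p i))"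
proof -
  let ?e = "frame_at M p"
  have "tang p b = (\<Sum>i\<in>UNIV. (b \<bullet> L p (?e i)) *\<^sub>R ?e i)" for b
    using frame_at_expansion[of "tang p b" p] inner_proj_L[of p b]
    by (simp add: proj_def inner_L)
  then have "(\<Sum>b\<in>Basis. f (tang p b) (tang p b)) =
      (\<Sum>b\<in>Basis. \<Sum>i\<in>UNIV. \<Sum>j\<in>UNIV. ((L p (?e i) \<bullet> b) * (L p (?e j) \<bullet> b)) *\<^sub>R f (?e i) (?e j))"
    by (simp only: bilinear_sum_scaleR[OF assms] inner_commute[of _ "L p _"])
  also have "\<dots> = (\<Sum>i\<in>UNIV. \<Sum>j\<in>UNIV. \<Sum>b\<in>Basis. ((L p (?e i) \<bullet> b) * (L p (?e j) \<bullet> b)) *\<^sub>R f (?e i) (?e j))"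
    by (simp only: sum.swap[where A = Basis and B = UNIV])
  also have "\<dots> = (\<Sum>i\<in>UNIV. \<Sum>j\<in>UNIV. (L p (?e i) \<bullet> L p (?e j)) * f (?e i) (?e j))"
    by (simp only: scaleR_sum_left[symmetric] euclidean_inner[symmetric]) simp
  also have "\<dots> = (\<Sum>i\<in>UNIV. f (?e i) (?e i))"
    by (simp add: inner_L frame_at if_distrib[of "\<lambda>x. x * _"] cong: if_cong)
  finally show ?thesis .
qed

lemma ssu_form_eq: "ssu_form M \<iota> p X = ambient_ssu p (L p X)"
proof -
  note bl = bilinearD[OF bilinear_second_ff[of p]]
  have "bilinear (\<lambda>v w. 4 * (B p X v \<bullet> B p X w) - B p X X \<bullet> B p v w)"
    unfolding bilinear_def linear_iff by (simp add: bl inner_add_left inner_add_right algebra_simps)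
  from trace_tang[OF this, of p] show ?thesis
    unfolding ssu_form_def ambient_ssu_def by (simp add: Let_def ambient_ff_def)
qed

lemma unit_bundle_iff: "(p, X) \<in> unit_bundle M \<longleftrightarrow> norm (L p X) = 1"
  by (simp add: unit_bundle_def norm_eq_1 inner_L)

lemma ambient_ssu_scale: "ambient_ssu p (r *\<^sub>R \<xi>) = r\<^sup>2 * ambient_ssu p \<xi>"
  unfolding ambient_ssu_def
  by (simp add: bilinearD[OF bilinear_ambient_ff] sum_distrib_left power2_eq_square algebra_simps)

lemma norm_ambient_ff_scale: "norm (ambient_ff p (r *\<^sub>R \<xi>) (r *\<^sub>R \<xi>)) = r\<^sup>2 * norm (ambient_ff p \<xi> \<xi>)"
  by (simp add: bilinearD[OF bilinear_ambient_ff] power2_eq_square)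

text \<open>Vectors in \<open>unit_bundle\<close> are components in a chart that changes with the
  point, so that set has no useful topology; its image under the differential of the immersion has
  one.\<close>

definition tangent_sphere :: "('a \<times> (real^'r)) set" where
  "tangent_sphere = {(p, \<xi>). proj p \<xi> = \<xi> \<and> norm \<xi> = 1}"

lemma tangent_sphere_eq: "tangent_sphere = (\<lambda>(p, X). (p, L p X)) ` unit_bundle M"
proof -
  have "(p, \<xi>) \<in> (\<lambda>(p, X). (p, L p X)) ` unit_bundle M" if "proj p \<xi> = \<xi>" "norm \<xi> = 1" for p \<xi>
  proof (rule image_eqI)
    show "(p, \<xi>) = (case (p, tang p \<xi>) of (p, X) \<Rightarrow> (p, L p X))"
      using that(1) by (simp add: proj_def)
    show "(p, tang p \<xi>) \<in> unit_bundle M"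
      using that by (simp add: unit_bundle_iff proj_def)
  qed
  then show ?thesis
    by (auto simp: tangent_sphere_def unit_bundle_iff)
qed

lemma tangent_sphere_nonempty: "tangent_sphere \<noteq> {}"
proof -
  have "(p, frame_at M p i) \<in> unit_bundle M" for p i
    by (simp add: unit_bundle_def frame_at)
  then have "unit_bundle M \<noteq> {}" by blast
  then show ?thesis by (simp add: tangent_sphere_eq)
qed

lemma continuous_on_bilinear_family:
  fixes f :: "'c::topological_space \<Rightarrow> real^'r \<Rightarrow> real^'r \<Rightarrow> 'b::real_normed_vector"
  assumes "\<And>p. bilinear (f p)" "\<And>\<xi> \<eta>. continuous_on S (\<lambda>p. f p \<xi> \<eta>)"
    and "continuous_on S x" "continuous_on S y"
  shows "continuous_on S (\<lambda>p. f p (x p) (y p))"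
  unfolding bilinear_Basis_sum[OF assms(1), of _ "x _" "y _"]
  using assms by (intro continuous_intros)

lemma continuous_on_ambient_ff_pair:
  assumes "continuous_on S x" "continuous_on S y" "continuous_on S (z::_ \<Rightarrow> 'a)"
  shows "continuous_on S (\<lambda>s. ambient_ff (z s) (x s) (y s))"
  by (rule continuous_on_bilinear_family[OF bilinear_ambient_ff _ assms(1,2)])
    (rule continuous_on_compose2[OF continuous_on_ambient_ff assms(3)], simp)

lemma continuous_on_ambient_ssu: "continuous_on S (\<lambda>s. ambient_ssu (fst s) (snd s))"
  unfolding ambient_ssu_def by (intro continuous_intros continuous_on_ambient_ff_pair)

text \<open>A closed subset of the product of M with the unit sphere. Writing the projection out in
  \<open>Basis\<close> makes it jointly continuous, given continuity for each fixed vector.\<close>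

lemma compact_tangent_sphere:
  assumes "compact (UNIV :: 'a set)"
  shows "compact tangent_sphere"
proof -
  have exp: "(\<Sum>b\<in>Basis. (\<xi> \<bullet> b) *\<^sub>R proj p b) = proj p \<xi>" for p \<xi>
  proof -
    have "proj p (\<Sum>b\<in>Basis. (\<xi> \<bullet> b) *\<^sub>R b) = (\<Sum>b\<in>Basis. (\<xi> \<bullet> b) *\<^sub>R proj p b)"
      by (simp add: linear_sum[OF linear_proj] linear_scale[OF linear_proj])
    then show ?thesis by (simp add: euclidean_representation)
  qed
  have eq: "tangent_sphere =
      (UNIV \<times> sphere 0 1) \<inter> {s. (\<Sum>b\<in>Basis. (snd s \<bullet> b) *\<^sub>R proj (fst s) b) = snd s}"
    by (auto simp: tangent_sphere_def exp)
  have "continuous_on UNIV (\<lambda>s::'a \<times> (real^'r). proj (fst s) b)" for b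
    by (rule continuous_on_compose2[OF continuous_on_proj]) (auto intro: continuous_intros)
  then have "closed {s::'a \<times> (real^'r). (\<Sum>b\<in>Basis. (snd s \<bullet> b) *\<^sub>R proj (fst s) b) = snd s}"
    by (intro closed_Collect_eq continuous_intros)
  then show ?thesis
    unfolding eq using assms by (intro compact_Int_closed compact_Times) auto
qed

end

section \<open>The constant a on a compact manifold\<close>

locale Phi_SSU = immersed M \<iota>
  for M :: "('a::{t2_space, second_countable_topology}, 'k::finite) rmfd"
    and \<iota> :: "'a \<Rightarrow> real^'r::finite" +
  assumes compact_M: "compact (UNIV :: 'a set)"
    and ssu_neg: "(p, X) \<in> unit_bundle M \<Longrightarrow> ssu_form M \<iota> p X < 0"
begin

lemma ambient_ssu_neg_unit: "(p, \<xi>) \<in> tangent_sphere \<Longrightarrow> ambient_ssu p \<xi> < 0"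
  using ssu_neg by (auto simp: tangent_sphere_eq ssu_form_eq)

text \<open>If B(\<xi>, \<xi>) were 0, only the nonnegative part of Q would survive, against Q < 0.
  So the ratios defining a have positive denominators.\<close>

lemma ambient_ff_nonzero_unit:
  assumes "(p, \<xi>) \<in> tangent_sphere"
  shows "norm (ambient_ff p \<xi> \<xi>) > 0"
proof -
  have "ambient_ssu p \<xi> \<ge> 0" if "ambient_ff p \<xi> \<xi> = 0"
    unfolding ambient_ssu_def by (simp add: that sum_nonneg)
  then show ?thesis using ambient_ssu_neg_unit[OF assms] by fastforce
qed

lemma ssu_ratios_eq:
  "ssu_ratios M \<iota> = (\<lambda>(s, r). - ambient_ssu (fst s) (snd s) /
      (8 * norm (ambient_ff (fst s) (snd s) (snd s)) * norm (ambient_ff (fst r) (snd r) (snd r)))) ` (tangent_sphere \<times> tangent_sphere)"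
    (is "_ = ?\<rho> ` _")
proof
  show "ssu_ratios M \<iota> \<subseteq> ?\<rho> ` (tangent_sphere \<times> tangent_sphere)"
  proof
    fix z assume "z \<in> ssu_ratios M \<iota>"
    then obtain x X y Y where z: "z = - ssu_form M \<iota> x X / (8 * norm (B x X X) * norm (B y Y Y))"
      "(x, X) \<in> unit_bundle M" "(y, Y) \<in> unit_bundle M"
      by (auto simp: ssu_ratios_def)
    then have "z = ?\<rho> ((x, L x X), (y, L y Y))" by (simp add: ssu_form_eq)
    moreover have "(x, L x X) \<in> tangent_sphere" "(y, L y Y) \<in> tangent_sphere"
      using z by (auto simp: tangent_sphere_eq)
    ultimately show "z \<in> ?\<rho> ` (tangent_sphere \<times> tangent_sphere)" by blast
  qed
  show "?\<rho> ` (tangent_sphere \<times> tangent_sphere) \<subseteq> ssu_ratios M \<iota>"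
    unfolding tangent_sphere_eq ssu_ratios_def by (force simp: ssu_form_eq)
qed

text \<open>The ratio is continuous on a nonempty compact set of pairs, so its infimum is a
  minimum.\<close>

lemma ssu_const_attained: "ssu_const M \<iota> \<in> ssu_ratios M \<iota>"
  and ssu_const_le: "s \<in> ssu_ratios M \<iota> \<Longrightarrow> ssu_const M \<iota> \<le> s"
proof -
  let ?\<rho> = "\<lambda>(s, r). - ambient_ssu (fst s) (snd s) /
      (8 * norm (ambient_ff (fst s) (snd s) (snd s)) * norm (ambient_ff (fst r) (snd r) (snd r)))"
  let ?K = "tangent_sphere \<times> tangent_sphere"
  have "continuous_on ?K ?\<rho>"
    unfolding case_prod_beta
    by (intro continuous_intros continuous_on_ambient_ff_pair continuous_on_compose2[OF continuous_on_ambient_ssu, where t = UNIV])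
      (use ambient_ff_nonzero_unit in auto)
  moreover have "compact ?K" "?K \<noteq> {}"
    using compact_tangent_sphere[OF compact_M] tangent_sphere_nonempty by (auto intro: compact_Times)
  ultimately have "\<exists>m\<in>?K. \<forall>y\<in>?K. ?\<rho> m \<le> ?\<rho> y" by (intro continuous_attains_inf)
  then obtain m where m: "m \<in> ?K" "\<And>y. y \<in> ?K \<Longrightarrow> ?\<rho> m \<le> ?\<rho> y" by blast
  have "ssu_const M \<iota> = ?\<rho> m"
    unfolding ssu_const_def ssu_ratios_eq using m by (intro cInf_eq_minimum) auto
  then show "ssu_const M \<iota> \<in> ssu_ratios M \<iota>"
    and "s \<in> ssu_ratios M \<iota> \<Longrightarrow> ssu_const M \<iota> \<le> s"
    unfolding ssu_ratios_eq using m by auto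
qed

lemma ssu_const_pos: "0 < ssu_const M \<iota>"
proof -
  obtain p \<xi> q \<eta> where "(p, \<xi>) \<in> tangent_sphere" "(q, \<eta>) \<in> tangent_sphere"
    and "ssu_const M \<iota> = - ambient_ssu p \<xi> / (8 * norm (ambient_ff p \<xi> \<xi>) * norm (ambient_ff q \<eta> \<eta>))"
    using ssu_const_attained unfolding ssu_ratios_eq by auto
  then show ?thesis
    using ambient_ssu_neg_unit[of p \<xi>] ambient_ff_nonzero_unit[of p \<xi>] ambient_ff_nonzero_unit[of q \<eta>]
    by (simp only: divide_pos_pos mult_pos_pos neg_0_less_iff_less zero_less_numeral)
qed

lemma normalize_tangent:
  assumes "proj p \<xi> = \<xi>" "\<xi> \<noteq> 0"
  shows "(p, \<xi> /\<^sub>R norm \<xi>) \<in> tangent_sphere"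
  using assms by (simp add: tangent_sphere_def linear_scale[OF linear_proj])

lemma ambient_ssu_neg:
  assumes "proj p \<xi> = \<xi>" "\<xi> \<noteq> 0"
  shows "ambient_ssu p \<xi> < 0"
  using ambient_ssu_neg_unit[OF normalize_tangent[OF assms]] assms(2)
  by (auto simp: ambient_ssu_scale mult_less_0_iff)

text \<open>The definition of a with both base points equal to \<open>p\<close>, made homogeneous.
  Zero vectors are allowed, so that it applies to every \<open>frame_op a b\<close>.\<close>

lemma ssu_inequality:
  assumes "proj p \<xi> = \<xi>" "proj p \<eta> = \<eta>"
  shows "8 * ssu_const M \<iota> * (norm (ambient_ff p \<xi> \<xi>) * norm (ambient_ff p \<eta> \<eta>)) \<le> - ambient_ssu p \<xi> * (norm \<eta>)\<^sup>2"
proof (cases "\<xi> = 0 \<or> \<eta> = 0")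
  case True
  have "ambient_ff p 0 0 = 0" "ambient_ssu p 0 = 0"
    using norm_ambient_ff_scale[of p 0 0] ambient_ssu_scale[of p 0 0] by simp_all
  then show ?thesis using True by auto
next
  case False
  let ?x = "\<xi> /\<^sub>R norm \<xi>" and ?y = "\<eta> /\<^sub>R norm \<eta>"
  have xy: "(p, ?x) \<in> tangent_sphere" "(p, ?y) \<in> tangent_sphere"
    using assms False by (auto intro: normalize_tangent)
  have "- ambient_ssu p ?x / (8 * norm (ambient_ff p ?x ?x) * norm (ambient_ff p ?y ?y)) \<in> ssu_ratios M \<iota>"
    unfolding ssu_ratios_eq by (rule image_eqI[of _ _ "((p, ?x), (p, ?y))"]) (use xy in auto)
  from ssu_const_le[OF this] ambient_ff_nonzero_unit[OF xy(1)] ambient_ff_nonzero_unit[OF xy(2)]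
  have "8 * ssu_const M \<iota> * (norm (ambient_ff p ?x ?x) * norm (ambient_ff p ?y ?y)) \<le> - ambient_ssu p ?x"
    by (simp add: field_simps)
  then have "(norm \<xi>)\<^sup>2 * (norm \<eta>)\<^sup>2 * (8 * ssu_const M \<iota> * (norm (ambient_ff p ?x ?x) * norm (ambient_ff p ?y ?y)))
      \<le> (norm \<xi>)\<^sup>2 * (norm \<eta>)\<^sup>2 * - ambient_ssu p ?x"
    by (intro mult_left_mono) auto
  then show ?thesis
    using False by (simp add: norm_ambient_ff_scale ambient_ssu_scale power_inverse field_simps)
qed

end

section \<open>Summing the index form over an ambient basis\<close>

context immersed
begin

text \<open>For V = \<open>tang p E\<close> and tangent \<xi>, \<eta> the sum over
  \<open>Basis\<close> is the inner product of the derivatives of V along \<xi> and \<eta>, by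
  Parseval; the other two terms are g(R(V, \<xi>) V, \<eta>), by the Gauss equation.\<close>

definition shape_form :: "'a \<Rightarrow> real^'r \<Rightarrow> real^'r \<Rightarrow> real^'r \<Rightarrow> real" where
  "shape_form p E \<xi> \<eta> = (\<Sum>b\<in>Basis. (ambient_ff p \<xi> b \<bullet> E) * (ambient_ff p \<eta> b \<bullet> E))
     + ambient_ff p \<xi> E \<bullet> ambient_ff p \<eta> E - ambient_ff p E E \<bullet> ambient_ff p \<xi> \<eta>"

text \<open>The index density of the field of \<open>E\<close> without the Hessian of the potential;
  \<open>f1\<close> and \<open>f2\<close> stand for F' and F''. The factor 2 merges two terms that
  agree by the symmetry of B.\<close>

definition frame_index :: "'a \<Rightarrow> ('i::finite \<Rightarrow> real^'r) \<Rightarrow> real \<Rightarrow> real \<Rightarrow> real^'r \<Rightarrow> real" where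
  "frame_index p a f1 f2 E =
     f2 * (\<Sum>i\<in>UNIV. \<Sum>j\<in>UNIV. (a i \<bullet> a j) * (ambient_ff p (a i) (a j) \<bullet> E))\<^sup>2
     + f1 * ((\<Sum>i\<in>UNIV. \<Sum>j\<in>UNIV. (a i \<bullet> a j) * shape_form p E (a i) (a j))
        + 2 * (\<Sum>i\<in>UNIV. \<Sum>j\<in>UNIV. (ambient_ff p (a i) (a j) \<bullet> E) * (ambient_ff p (a i) (a j) \<bullet> E)))"

lemma bilinear_shape_form: "bilinear (shape_form p E)"
  unfolding shape_form_def[abs_def] bilinear_def linear_iff
  by (simp add: bilinearD[OF bilinear_ambient_ff] inner_add_left inner_add_right sum.distrib sum_distrib_left algebra_simps)

lemma bilinear_ambient_ff_inner: "bilinear (\<lambda>\<xi> \<eta>. ambient_ff p \<xi> \<eta> \<bullet> E)"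
  unfolding bilinear_def linear_iff
  by (simp add: bilinearD[OF bilinear_ambient_ff] inner_add_left)

lemma bilinear_inner: "bilinear (\<lambda>x y :: 'c::real_inner. x \<bullet> y)"
  unfolding bilinear_def linear_iff by (simp add: inner_add_left inner_add_right)

lemma sum_shape_form:
  "(\<Sum>E\<in>Basis. shape_form p E \<xi> \<eta>) =
    2 * (\<Sum>b\<in>Basis. ambient_ff p \<xi> b \<bullet> ambient_ff p \<eta> b) - (\<Sum>b\<in>Basis. ambient_ff p b b) \<bullet> ambient_ff p \<xi> \<eta>"
proof -
  have "(\<Sum>E\<in>Basis. \<Sum>b\<in>Basis. (ambient_ff p \<xi> b \<bullet> E) * (ambient_ff p \<eta> b \<bullet> E)) = (\<Sum>b\<in>Basis. ambient_ff p \<xi> b \<bullet> ambient_ff p \<eta> b)"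
    by (subst sum.swap) (simp only: euclidean_inner[symmetric])
  then show ?thesis
    by (simp add: shape_form_def sum.distrib sum_subtractf inner_sum_left)
qed

text \<open>\<open>sum_shape_form\<close> supplies 2 |B|^2 and the trace term of Q;
  \<open>sum_norm_bilinear_le\<close> trades the remaining squares for another 2 |B|^2. Together
  they make up the coefficient 4 of Q.\<close>

lemma sum_frame_index_le:
  fixes a :: "'i::finite \<Rightarrow> real^'r"
  assumes "0 \<le> f1"
  defines "Y \<equiv> frame_op a"
  shows "(\<Sum>E\<in>Basis. frame_index p a f1 f2 E) \<le>
    f2 * (norm (\<Sum>b\<in>Basis. ambient_ff p (Y b) (Y b)))\<^sup>2 + f1 * (\<Sum>b\<in>Basis. ambient_ssu p (Y b))"
proof -
  have sq: "(\<Sum>E\<in>Basis. (x \<bullet> E) * (x \<bullet> E)) = (norm x)\<^sup>2" for x :: "real^'r"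
    by (simp only: euclidean_inner[symmetric] power2_norm_eq_inner)
  let ?T = "\<Sum>b\<in>Basis. ambient_ff p (Y b) (Y b)"
  have "(\<Sum>i\<in>UNIV. \<Sum>j\<in>UNIV. (a i \<bullet> a j) * (ambient_ff p (a i) (a j) \<bullet> E)) = ?T \<bullet> E" for E
    unfolding Y_def sum_gram_bilinear[OF bilinear_ambient_ff, symmetric] by (simp add: inner_sum_left)
  then have 1: "(\<Sum>E\<in>Basis. (\<Sum>i\<in>UNIV. \<Sum>j\<in>UNIV. (a i \<bullet> a j) * (ambient_ff p (a i) (a j) \<bullet> E))\<^sup>2) = (norm ?T)\<^sup>2"
    by (simp only: power2_eq_square[of "_ \<bullet> _"] sq)
  let ?k = "\<lambda>\<xi> \<eta>. 2 * (\<Sum>b\<in>Basis. ambient_ff p \<xi> b \<bullet> ambient_ff p \<eta> b) - (\<Sum>b\<in>Basis. ambient_ff p b b) \<bullet> ambient_ff p \<xi> \<eta>"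
  have "(\<Sum>i\<in>UNIV. \<Sum>j\<in>UNIV. (a i \<bullet> a j) * shape_form p E (a i) (a j)) = (\<Sum>b\<in>Basis. shape_form p E (Y b) (Y b))" for E
    using sum_gram_bilinear[OF bilinear_shape_form, of a p E] by (simp add: Y_def)
  then have 2: "(\<Sum>E\<in>Basis. \<Sum>i\<in>UNIV. \<Sum>j\<in>UNIV. (a i \<bullet> a j) * shape_form p E (a i) (a j)) = (\<Sum>b\<in>Basis. ?k (Y b) (Y b))"
    by (simp only: sum.swap[of _ Basis Basis] sum_shape_form)
  have "(\<Sum>E\<in>Basis. \<Sum>i\<in>UNIV. \<Sum>j\<in>UNIV. (ambient_ff p (a i) (a j) \<bullet> E) * (ambient_ff p (a i) (a j) \<bullet> E)) =
      (\<Sum>i\<in>UNIV. \<Sum>j\<in>UNIV. (norm (ambient_ff p (a i) (a j)))\<^sup>2)"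
    by (simp only: sum.swap[where A = Basis and B = UNIV] sq)
  also have "\<dots> \<le> (\<Sum>b\<in>Basis. \<Sum>c\<in>Basis. (norm (ambient_ff p (Y b) c))\<^sup>2)"
    unfolding Y_def by (rule sum_norm_bilinear_le[OF bilinear_ambient_ff ambient_ff_commute])
  finally have 3: "(\<Sum>E\<in>Basis. \<Sum>i\<in>UNIV. \<Sum>j\<in>UNIV. (ambient_ff p (a i) (a j) \<bullet> E) * (ambient_ff p (a i) (a j) \<bullet> E))
      \<le> (\<Sum>b\<in>Basis. \<Sum>c\<in>Basis. (norm (ambient_ff p (Y b) c))\<^sup>2)" .
  have "?k \<xi> \<xi> + 2 * (\<Sum>c\<in>Basis. (norm (ambient_ff p \<xi> c))\<^sup>2) = ambient_ssu p \<xi>" for \<xi>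
    by (simp add: ambient_ssu_def power2_norm_eq_inner sum_subtractf inner_sum_right inner_commute flip: sum_distrib_left)
  then have 4: "(\<Sum>b\<in>Basis. ?k (Y b) (Y b)) + 2 * (\<Sum>b\<in>Basis. \<Sum>c\<in>Basis. (norm (ambient_ff p (Y b) c))\<^sup>2) = (\<Sum>b\<in>Basis. ambient_ssu p (Y b))"
    by (simp only: sum_distrib_left[of _ _ Basis] sum.distrib[symmetric])
  have "(\<Sum>E\<in>Basis. frame_index p a f1 f2 E) = f2 * (norm ?T)\<^sup>2 + f1 * ((\<Sum>b\<in>Basis. ?k (Y b) (Y b))
      + 2 * (\<Sum>E\<in>Basis. \<Sum>i\<in>UNIV. \<Sum>j\<in>UNIV. (ambient_ff p (a i) (a j) \<bullet> E) * (ambient_ff p (a i) (a j) \<bullet> E)))"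
    unfolding frame_index_def 1[symmetric] 2[symmetric] sum.distrib sum_distrib_left[symmetric] ..
  also have "\<dots> \<le> f2 * (norm ?T)\<^sup>2 + f1 * ((\<Sum>b\<in>Basis. ?k (Y b) (Y b))
      + 2 * (\<Sum>b\<in>Basis. \<Sum>c\<in>Basis. (norm (ambient_ff p (Y b) c))\<^sup>2))"
    using 3 assms(1) by (intro add_left_mono mult_left_mono) auto
  finally show ?thesis by (simp only: 4)
qed

lemma proj_frame_op:
  assumes "\<And>i. proj p (a i) = a i"
  shows "proj p (frame_op a b) = frame_op a b"
  by (simp add: frame_op_def linear_sum[OF linear_proj] linear_scale[OF linear_proj] assms)

end

context Phi_SSU
begin

lemma sum_frame_index_neg:
  fixes a :: "'i::finite \<Rightarrow> real^'r"
  assumes a: "\<And>i. proj p (a i) = a i" and t: "t = (\<Sum>i\<in>UNIV. \<Sum>j\<in>UNIV. (a i \<bullet> a j)\<^sup>2) / 4" "t > 0"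
    and f: "0 < f1" "t * f2 < ssu_const M \<iota> * f1"
  shows "(\<Sum>E\<in>Basis. frame_index p a f1 f2 E) < 0"
proof -
  let ?Y = "frame_op a"
  let ?\<alpha> = "ssu_const M \<iota>"
  define T where "T = (\<Sum>b\<in>Basis. ambient_ff p (?Y b) (?Y b))"
  define X where "X = (\<Sum>b\<in>Basis. norm (ambient_ff p (?Y b) (?Y b)))"
  define G where "G = (\<Sum>b\<in>Basis. - ambient_ssu p (?Y b))"
  have tang: "proj p (?Y b) = ?Y b" for b by (rule proj_frame_op[OF a])
  \<comment> \<open>\<open>sum_gram_bilinear\<close> for the inner product itself: the Gram
    coefficients get squared.\<close>
  have Y2: "(\<Sum>b\<in>Basis. (norm (?Y b))\<^sup>2) = 4 * t"
    using sum_gram_bilinear[OF bilinear_inner, of a] t(1)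
    by (simp add: power2_norm_eq_inner power2_eq_square[of "_ \<bullet> _"])
  then obtain b where b: "b \<in> Basis" "?Y b \<noteq> 0"
    using t(2) by (metis (no_types, lifting) mult_pos_pos norm_zero sum.neutral zero_eq_power2 zero_less_numeral less_irrefl)
  have nonneg: "0 \<le> - ambient_ssu p (?Y b)" for b
    using ambient_ssu_neg[OF tang, of b] norm_ambient_ff_scale[of p 0 0] ambient_ssu_scale[of p 0 0] by (cases "?Y b = 0") auto
  have "G > 0"
    unfolding G_def using b ambient_ssu_neg[OF tang b(2)] nonneg by (intro sum_pos2[of _ b]) auto
  \<comment> \<open>Pairing every \<open>b\<close> with every \<open>c\<close> yields the square of
    \<open>X\<close> on the left and \<open>G\<close> times the sum \<open>Y2\<close> on the right.
    The proportion of 8 to 4 is what leaves half of \<open>G\<close> to spare.\<close>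
  have "8 * ?\<alpha> * X\<^sup>2 = (\<Sum>b\<in>Basis. \<Sum>c\<in>Basis. 8 * ?\<alpha> * (norm (ambient_ff p (?Y b) (?Y b)) * norm (ambient_ff p (?Y c) (?Y c))))"
    by (simp only: X_def power2_eq_square sum_product, simp only: sum_distrib_left)
  also have "\<dots> \<le> (\<Sum>b\<in>Basis. \<Sum>c\<in>Basis. - ambient_ssu p (?Y b) * (norm (?Y c))\<^sup>2)"
    by (intro sum_mono ssu_inequality tang)
  also have "\<dots> = G * (4 * t)"
    unfolding Y2[symmetric] G_def by (simp only: sum_product)
  finally have X: "2 * ?\<alpha> * X\<^sup>2 \<le> G * t" by simp
  have "norm T \<le> X" unfolding T_def X_def by (rule norm_sum)
  then have TX: "(norm T)\<^sup>2 \<le> X\<^sup>2" by (rule power_mono) simp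
  \<comment> \<open>The F'' term uses up at most half of the F' term. For nonnegative
    \<open>f2\<close> the claim is first multiplied by \<open>t\<close>, as the hypothesis bounds
    \<open>t * f2\<close>.\<close>
  have "f2 * (norm T)\<^sup>2 \<le> f1 * G / 2"
  proof (cases "f2 \<ge> 0")
    case True
    have "t * (f2 * (norm T)\<^sup>2) \<le> (t * f2) * X\<^sup>2"
      using TX True t(2) by (simp add: mult_left_mono mult.assoc)
    also have "\<dots> \<le> ?\<alpha> * f1 * X\<^sup>2"
      using f(2) by (intro mult_right_mono) auto
    also have "\<dots> = f1 * (2 * ?\<alpha> * X\<^sup>2) / 2" by simp
    also have "\<dots> \<le> f1 * (G * t) / 2"
      using X f(1) by (intro divide_right_mono mult_left_mono) auto
    also have "\<dots> = t * (f1 * G / 2)" by simp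
    finally show ?thesis using t(2) by (simp only: mult_le_cancel_left_pos)
  next
    case False
    then have "f2 * (norm T)\<^sup>2 \<le> 0" by (simp add: mult_nonpos_nonneg)
    also have "0 \<le> f1 * G / 2" using \<open>G > 0\<close> f(1) by simp
    finally show ?thesis .
  qed
  moreover have "f1 * (\<Sum>b\<in>Basis. ambient_ssu p (?Y b)) = - (f1 * G)"
    by (simp add: G_def sum_negf)
  moreover have "f1 * G > 0" using \<open>G > 0\<close> f(1) by simp
  ultimately show ?thesis
    using sum_frame_index_le[of f1 p a f2] f(1) unfolding T_def by linarith
qed

end

section \<open>Integration and the volume measure\<close>

text \<open>For the index densities \<open>f i\<close> and their parts \<open>q i\<close> without
  potential, monotonicity and stability give \<integral>q^- \<le> \<integral>f^- \<le>
  \<integral>f^+ \<le> \<integral>q^+. Pointwise, the positive parts of the \<open>q i\<close> plus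
  the deficit of their sum equal the negative parts. Integrating, the deficit has integral
  0.\<close>

lemma AE_sum_eq_0:
  fixes f q :: "'i \<Rightarrow> 'a \<Rightarrow> real"
  assumes "finite I" and meas: "\<And>i. i \<in> I \<Longrightarrow> q i \<in> borel_measurable \<mu>"
    and le: "\<And>i x. i \<in> I \<Longrightarrow> f i x \<le> q i x"
    and stable: "\<And>i. i \<in> I \<Longrightarrow> (\<forall>x. q i x = 0) \<or>
      (\<integral>\<^sup>+x. ennreal (- f i x) \<partial>\<mu>) < \<infinity> \<and>
      0 \<le> enn2ereal (\<integral>\<^sup>+x. ennreal (f i x) \<partial>\<mu>) - enn2ereal (\<integral>\<^sup>+x. ennreal (- f i x) \<partial>\<mu>)"
    and nonpos: "\<And>x. (\<Sum>i\<in>I. q i x) \<le> 0"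
  shows "AE x in \<mu>. (\<Sum>i\<in>I. q i x) = 0"
proof -
  have q: "(\<integral>\<^sup>+x. ennreal (- q i x) \<partial>\<mu>) \<le> (\<integral>\<^sup>+x. ennreal (q i x) \<partial>\<mu>) \<and>
      (\<integral>\<^sup>+x. ennreal (- q i x) \<partial>\<mu>) < \<infinity>" if i: "i \<in> I" for i
    using stable[OF i]
  proof
    assume fin: "(\<integral>\<^sup>+x. ennreal (- f i x) \<partial>\<mu>) < \<infinity> \<and>
      0 \<le> enn2ereal (\<integral>\<^sup>+x. ennreal (f i x) \<partial>\<mu>) - enn2ereal (\<integral>\<^sup>+x. ennreal (- f i x) \<partial>\<mu>)"
    then have "enn2ereal (\<integral>\<^sup>+x. ennreal (- f i x) \<partial>\<mu>) \<noteq> \<infinity>"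
      by (simp add: less_top)
    then have "(\<integral>\<^sup>+x. ennreal (- f i x) \<partial>\<mu>) \<le> (\<integral>\<^sup>+x. ennreal (f i x) \<partial>\<mu>)"
      using fin ereal_le_minus[of "enn2ereal (\<integral>\<^sup>+x. ennreal (- f i x) \<partial>\<mu>)" 0]
      by (simp add: less_eq_ennreal.rep_eq)
    moreover have "(\<integral>\<^sup>+x. ennreal (- q i x) \<partial>\<mu>) \<le> (\<integral>\<^sup>+x. ennreal (- f i x) \<partial>\<mu>)"
      using le[OF i] by (intro nn_integral_mono ennreal_leI) simp
    moreover have "(\<integral>\<^sup>+x. ennreal (f i x) \<partial>\<mu>) \<le> (\<integral>\<^sup>+x. ennreal (q i x) \<partial>\<mu>)"
      using le[OF i] by (intro nn_integral_mono ennreal_leI)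
    ultimately show ?thesis using fin by (meson order.trans order.strict_trans1)
  qed simp
  define P where "P = (\<Sum>i\<in>I. \<integral>\<^sup>+x. ennreal (q i x) \<partial>\<mu>)"
  define R where "R = (\<Sum>i\<in>I. \<integral>\<^sup>+x. ennreal (- q i x) \<partial>\<mu>)"
  define Z where "Z = (\<integral>\<^sup>+x. ennreal (- (\<Sum>i\<in>I. q i x)) \<partial>\<mu>)"
  have "R \<le> P" unfolding R_def P_def using q by (intro sum_mono) auto
  have "R < \<infinity>" unfolding R_def using q assms(1) by (simp add: less_top)
  have pt: "(\<Sum>i\<in>I. ennreal (q i x)) + ennreal (- (\<Sum>i\<in>I. q i x)) = (\<Sum>i\<in>I. ennreal (- q i x))" for x
  proof -
    have "(\<Sum>i\<in>I. max 0 (q i x)) - (\<Sum>i\<in>I. max 0 (- q i x)) = (\<Sum>i\<in>I. q i x)"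
      unfolding sum_subtractf[symmetric] by (intro sum.cong) auto
    then have eq: "(\<Sum>i\<in>I. max 0 (q i x)) + - (\<Sum>i\<in>I. q i x) = (\<Sum>i\<in>I. max 0 (- q i x))" by simp
    have e: "(\<Sum>i\<in>I. ennreal (g i)) = ennreal (\<Sum>i\<in>I. max 0 (g i))" for g :: "'i \<Rightarrow> real"
    proof -
      have "ennreal x = ennreal (max 0 x)" for x by (simp add: max_def ennreal_neg)
      then have "(\<Sum>i\<in>I. ennreal (g i)) = (\<Sum>i\<in>I. ennreal (max 0 (g i)))" by (intro sum.cong) auto
      then show ?thesis by (simp add: sum_ennreal)
    qed
    show ?thesis
      unfolding e eq[symmetric] using nonpos[of x] by (intro ennreal_plus[symmetric] sum_nonneg) auto
  qed
  have "P + Z = R"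
    unfolding P_def R_def Z_def using meas
    by (simp add: nn_integral_sum[symmetric] nn_integral_add[symmetric] pt)
  \<comment> \<open>\<open>R\<close> is finite, hence so is \<open>P\<close>, and it can be
    cancelled from P + Z = R \<le> P.\<close>
  then have "Z = 0"
    using \<open>R \<le> P\<close> \<open>R < \<infinity>\<close>
    by (metis add.right_neutral add_left_mono ennreal_add_left_cancel infinity_ennreal_def le_iff_add
        less_irrefl order_antisym zero_le)
  then have "AE x in \<mu>. ennreal (- (\<Sum>i\<in>I. q i x)) = 0"
    unfolding Z_def using meas by (subst (asm) nn_integral_0_iff_AE) auto
  then show ?thesis
    by (rule AE_mp) (use nonpos in \<open>auto intro!: AE_I2 simp: ennreal_eq_0_iff order_antisym\<close>)
qed

section \<open>Positivity of F'\<close>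

lemma C2_halfline_continuous:
  assumes "C2_halfline F F1 F2"
  shows "continuous_on {0..} F1" "continuous_on {0..} F2"
  using assms by (auto simp: C2_halfline_def intro!: DERIV_continuous_on)

text \<open>Monotonicity gives F' \<ge> 0. At a zero of F' the inequality forces F'' < 0, which
  would make F' negative just to the right.\<close>

lemma derivative_pos:
  assumes "C2_halfline F F1 F2" "strict_mono_on {0..} F" "\<And>t. t > 0 \<Longrightarrow> t * F2 t < \<alpha> * F1 t" "0 < t"
  shows "F1 t > 0"
proof -
  have der: "(F has_real_derivative F1 s) (at s)" "(F1 has_real_derivative F2 s) (at s)" if "s > 0" for s
  proof -
    have "at s within {0..} = at s" using that by (intro at_within_interior) simp
    then show "(F has_real_derivative F1 s) (at s)" "(F1 has_real_derivative F2 s) (at s)"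
      using assms(1) that unfolding C2_halfline_def by (metis less_imp_le)+
  qed
  have nonneg: "F1 s \<ge> 0" if s: "s > 0" for s
  proof (rule ccontr)
    assume "\<not> F1 s \<ge> 0"
    then obtain d where d: "d > 0" "\<And>h. h > 0 \<Longrightarrow> h < d \<Longrightarrow> F (s + h) < F s"
      using DERIV_neg_dec_right[OF der(1)[OF s]] by (meson not_le)
    have "F s < F (s + d / 2)"
      using strict_mono_onD[OF assms(2), of s "s + d / 2"] s d(1) by simp
    then show False using d(2)[of "d / 2"] d(1) by simp
  qed
  have "F1 t \<noteq> 0"
  proof
    assume "F1 t = 0"
    then have "F2 t < 0" using assms(3)[OF assms(4)] assms(4) by (simp add: mult_less_0_iff)
    then obtain d where d: "d > 0" "\<And>h. h > 0 \<Longrightarrow> h < d \<Longrightarrow> F1 (t + h) < F1 t"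
      using DERIV_neg_dec_right[OF der(2)[OF assms(4)]] by blast
    have "F1 (t + d / 2) < 0" using d(2)[of "d / 2"] d(1) \<open>F1 t = 0\<close> by simp
    then show False using nonneg[of "t + d / 2"] assms(4) d(1) by simp
  qed
  then show ?thesis using nonneg[OF assms(4)] by simp
qed

section \<open>Frame-independent gradients and the Riemannian volume\<close>

context riemannian
begin

lemma Ck_gram_inverse:
  assumes "c \<in> charts M" "\<And>l. Ck_on k (\<lambda>y. b y l) (snd c ` fst c)"
  shows "Ck_on k (\<lambda>y. matrix_inv (gram M c y) *v (\<chi> l. b y l)) (snd c ` fst c)"
proof (rule Ck_on_matrix_inv_mult[OF chart_open(2)[OF assms(1)]])
  show "det (gram M c y) \<noteq> 0" if "y \<in> snd c ` fst c" for y
    using det_gram_pos[OF inner_form_metric_in[OF assms(1) that]] by (simp add: gram_def)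
qed (use assms smooth_on_Ck[OF smooth_metric_in[OF assms(1)]] in \<open>auto simp: gram_def\<close>)

text \<open>\<open>\<Sum>\<^sub>i df(e\<^sub>i) df'(e\<^sub>i)\<close> does not depend on the frame: it is \<open>df'(grad f)\<close>.\<close>

lemma sum_frame_chart:
  assumes c: "c \<in> charts M" "p \<in> fst c" and "linear \<phi>" "linear \<psi>"
  shows "(\<Sum>i\<in>UNIV. \<phi> (to_chart M c p (frame_at M p i)) * \<psi> (to_chart M c p (frame_at M p i))) =
    \<psi> (matrix_inv (gram M c (snd c p)) *v (\<chi> l. \<phi> (axis l 1)))"
proof -
  let ?e = "\<lambda>i. to_chart M c p (frame_at M p i)"
  let ?z = "matrix_inv (gram M c (snd c p)) *v (\<chi> l. \<phi> (axis l 1))"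
  have form: "inner_form (metric_in M c (snd c p))"
    using c by (intro inner_form_metric_in) auto
  have "metric_in M c (snd c p) (?e i) (?e j) = (if i = j then 1 else 0)" for i j
    by (simp add: frame_at flip: metric_in_chart(2)[OF c])
  then have "?z = (\<Sum>i\<in>UNIV. metric_in M c (snd c p) ?z (?e i) *\<^sub>R ?e i)"
    by (rule orthonormal_expansion[OF form])
  also have "\<dots> = (\<Sum>i\<in>UNIV. \<phi> (?e i) *\<^sub>R ?e i)"
    unfolding gram_def by (simp only: gram_inverse_represents[OF form assms(3)])
  finally show ?thesis
    using assms(4) by (simp add: linear_sum linear_scale)
qed

text \<open>In a chart the volume has a positive continuous density with respect to Lebesgue
  measure, and there a nonempty open set is not null.\<close>

lemma volume_open_null:
  assumes "riemannian_volume M \<mu>" "open X" "emeasure \<mu> X = 0"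
  shows "X = {}"
proof (rule ccontr)
  assume "X \<noteq> {}"
  then obtain p c where p: "p \<in> X" "c \<in> charts M" "p \<in> fst c" using charts_cover by blast
  have sets: "sets \<mu> = sets borel" using assms(1) by (simp add: riemannian_volume_def)
  define A where "A = X \<inter> fst c"
  have A: "open A" "A \<subseteq> fst c" using assms(2) chart_open(1)[OF p(2)] by (auto simp: A_def)
  let ?A = "snd c ` A" and ?d = "\<lambda>x. sqrt (det (gram M c x))"
  have oA: "open ?A" by (rule open_chart_image[OF p(2) A])
  have "emeasure \<mu> A \<le> emeasure \<mu> X"
    using assms(2) sets by (intro emeasure_mono) (auto simp: A_def)
  moreover have "emeasure \<mu> A = (\<integral>\<^sup>+x. ennreal (?d x) * indicator ?A x \<partial>lborel)"
  proof -
    have "A \<in> sets borel" using A(1) by simp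
    then show ?thesis using assms(1) p(2) A(2) unfolding riemannian_volume_def by (elim conjE) simp
  qed
  ultimately have int0: "(\<integral>\<^sup>+x. ennreal (?d x) * indicator ?A x \<partial>lborel) = 0"
    using assms(3) by simp
  have "Ck_on 0 (\<lambda>x. det (gram M c x)) (snd c ` fst c)"
    using smooth_on_Ck[OF smooth_metric_in[OF p(2)]]
    by (intro Ck_on_det chart_open(2) p(2)) (simp add: gram_def)
  then have "continuous_on ?A ?d"
    using A(2) by (intro continuous_on_real_sqrt) (auto intro: continuous_on_subset)
  then have "(\<lambda>x. indicator ?A x *\<^sub>R ?d x) \<in> borel_measurable borel"
    using oA by (intro borel_measurable_continuous_on_indicator) auto
  then have "(\<lambda>x. ennreal (indicator ?A x *\<^sub>R ?d x)) \<in> borel_measurable lborel"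
    by simp
  moreover have "ennreal (indicator ?A x *\<^sub>R ?d x) = ennreal (?d x) * indicator ?A x" for x
    by (simp add: indicator_def)
  ultimately have "AE x in lborel. ennreal (?d x) * indicator ?A x = 0"
    using int0 by (subst (asm) nn_integral_0_iff_AE) auto
  moreover have "ennreal (?d x) \<noteq> 0" if "x \<in> ?A" for x
    using det_gram_pos[OF inner_form_metric_in[OF p(2)], of x] that A(2)
    by (auto simp: gram_def ennreal_eq_0_iff)
  ultimately have "AE x in lborel. x \<notin> ?A"
    by (elim AE_mp) (intro AE_I2, auto simp: indicator_def split: if_splits)
  \<comment> \<open>Prepares the fact that a closed set containing almost every point of an open set
    contains all of it; the closed set here is empty.\<close>
  then have "AE x\<in>?A in lebesgue. x \<in> {}"
    using AE_completion by fastforce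
  moreover have "snd c p \<in> ?A" using p by (auto simp: A_def)
  ultimately show False
    using mem_closed_if_AE_lebesgue_open[OF oA closed_empty] by blast
qed

end

section \<open>The index form on projected constant fields\<close>

context immersed_map
begin

definition push_frame :: "'n \<Rightarrow> 'k \<Rightarrow> real^'r" where
  "push_frame p i = L (u p) (diff_map N M u p (frame_at N p i))"

lemma proj_push_frame [simp]: "proj (u p) (push_frame p i) = push_frame p i"
  by (simp add: push_frame_def)

lemma norm_pullback_sq_eq:
  "norm_pullback_sq N M u p = (\<Sum>i\<in>UNIV. \<Sum>j\<in>UNIV. (push_frame p i \<bullet> push_frame p j)\<^sup>2)"
  by (simp add: norm_pullback_sq_def push_frame_def inner_L Let_def)

text \<open>Every covariant derivative becomes a component of B along \<open>E\<close>, by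
  \<open>pullback_nabla_tang\<close>, and the curvature becomes a product of values of B, by
  \<open>gauss_equation\<close>.\<close>

lemma index_density_tang:
  fixes p E
  defines "V \<equiv> \<lambda>p. tang (u p) E" and "t \<equiv> norm_pullback_sq N M u p / 4"
  shows "index_density N M F1 F2 K u V p =
    cov_hessian M K (u p) (V p) (V p) + frame_index (u p) (push_frame p) (F1 t) (F2 t) E"
proof -
  let ?g = "metric M (u p)"
  let ?d = "\<lambda>i. diff_map N M u p (frame_at N p i)" and ?D = "\<lambda>i. pullback_nabla N M u V p (frame_at N p i)"
  have dd: "?g (?d i) (?d j) = push_frame p i \<bullet> push_frame p j" for i j
    by (simp add: push_frame_def inner_L)
  have D: "?g (?D i) s = B (u p) (?d i) s \<bullet> E" for i s
    unfolding V_def by (rule pullback_nabla_tang)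
  have Dd: "?g (?D i) (?d j) = ambient_ff (u p) (push_frame p i) (push_frame p j) \<bullet> E" for i j
    by (simp add: D push_frame_def)
  have sigma: "?g (?D i) (sigma_map N M u p (frame_at N p i)) =
      (\<Sum>j\<in>UNIV. (push_frame p i \<bullet> push_frame p j) * (ambient_ff (u p) (push_frame p i) (push_frame p j) \<bullet> E))" for i
    by (simp add: sigma_map_def Let_def inner_form_right[OF inner_form_metric] dd Dd)
  \<comment> \<open>Parseval in the ambient space, which avoids a frame of M: the component of
    \<open>L (u p) (?D i)\<close> along \<open>b\<close> is found by pairing \<open>?D i\<close>
    with \<open>tang (u p) b\<close>.\<close>
  have DD: "?g (?D i) (?D j) = (\<Sum>b\<in>Basis. (ambient_ff (u p) (push_frame p i) b \<bullet> E) * (ambient_ff (u p) (push_frame p j) b \<bullet> E))" for i j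
  proof -
    have "L (u p) (?D i) \<bullet> b = ambient_ff (u p) (push_frame p i) b \<bullet> E" for i b
      using inner_proj[of "u p" "L (u p) (?D i)" b] inner_L[of "u p" "?D i" "tang (u p) b"] D[of i "tang (u p) b"]
      by (simp add: proj_def[of "u p" b] ambient_ff_def push_frame_def)
    then show ?thesis
      by (subst inner_L[symmetric], subst euclidean_inner) simp
  qed
  have R: "?g (curvature M (u p) (V p) (?d i) (V p)) (?d j) =
      ambient_ff (u p) (push_frame p i) E \<bullet> ambient_ff (u p) (push_frame p j) E - ambient_ff (u p) E E \<bullet> ambient_ff (u p) (push_frame p i) (push_frame p j)" for i j
    by (simp add: gauss_equation V_def ambient_ff_def push_frame_def second_ff_commute[of _ "tang (u p) E" "?d _"])
  have sym: "?g (?d i) (?D j) = ?g (?D j) (?d i)" for i j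
    by (rule inner_formD(2)[OF inner_form_metric])
  have pt: "?g (?D i) (?D j) * ?g (?d i) (?d j) + (?g (?D i) (?d j))\<^sup>2 + ?g (?D i) (?d j) * ?g (?d i) (?D j)
      + ?g (curvature M (u p) (V p) (?d i) (V p)) (?d j) * ?g (?d i) (?d j) =
      (push_frame p i \<bullet> push_frame p j) * shape_form (u p) E (push_frame p i) (push_frame p j)
      + 2 * ((ambient_ff (u p) (push_frame p i) (push_frame p j) \<bullet> E) * (ambient_ff (u p) (push_frame p i) (push_frame p j) \<bullet> E))" for i j
    unfolding sym R DD Dd dd shape_form_def
    by (simp add: ambient_ff_commute[of "u p" "push_frame p j" "push_frame p i"] power2_eq_square algebra_simps)
  show ?thesis
    unfolding index_density_def Let_def sigma pt frame_index_def t_def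
    by (simp add: sum.distrib flip: sum_distrib_left)
qed

text \<open>For the zero field and the zero potential the index density reduces to its Hessian term;
  comparison with \<open>index_density_tang\<close> leaves 0 for the rest.\<close>

lemma frame_index_eq_0_of_tang:
  assumes "(\<lambda>p. tang (u p) E) = (\<lambda>_. 0)"
  defines "t \<equiv> \<lambda>p. norm_pullback_sq N M u p / 4"
  shows "frame_index (u p) (push_frame p) (F1 (t p)) (F2 (t p)) E = 0"
proof -
  have B0: "B q 0 v = 0" "B q v 0 = 0" for q v
    using bilinear_lzero bilinear_rzero bilinear_second_ff by blast+
  have g0: "metric M q 0 v = 0" "metric M q v 0 = 0" for q v
    using bilinear_lzero bilinear_rzero inner_formD(1)[OF inner_form_metric] by blast+
  have "index_density N M F1 F2 (\<lambda>_. 0) u (\<lambda>_. 0) p = cov_hessian M (\<lambda>_. 0) (u p) 0 0"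
    by (simp add: index_density_def Let_def pullback_nabla_zero gauss_equation B0 g0)
  then show ?thesis
    using index_density_tang[of F1 F2 "\<lambda>_. 0" E p] fun_cong[OF assms(1), of p]
    unfolding assms(1) t_def by simp
qed

section \<open>Continuity of the integrands\<close>

lemma push_frame_chart:
  assumes c: "c \<in> charts N" and p: "p \<in> fst c"
  shows "push_frame p i = dird (\<iota> \<circ> u \<circ> chart_inv c) (snd c p) (to_chart N c p (frame_at N p i))"
proof -
  have "(\<iota> \<circ> u \<circ> chart_inv c) differentiable (at (snd c p))"
    by (rule Ck_on_differentiable[OF Ck_immersed_map[OF c]]) (use p in auto)
  from N.diff_fun_chart(1)[OF c p this] show ?thesis
    by (simp add: push_frame_def L_diff_map)
qed

text \<open>By \<open>sum_frame_chart\<close> the sum is the derivative of one component of the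
  immersed map along the gradient of another, which in a chart is built from smooth data and
  contains no frame.\<close>

lemma continuous_frame_gram:
  "continuous_on UNIV (\<lambda>p. \<Sum>i\<in>UNIV. (push_frame p i \<bullet> \<xi>) * (push_frame p i \<bullet> \<eta>))"
proof (rule N.continuous_on_UNIV_chartI)
  fix c assume c: "c \<in> charts N"
  let ?W = "\<iota> \<circ> u \<circ> chart_inv c"
  let ?z = "\<lambda>y. matrix_inv (gram N c y) *v (\<chi> l. dird ?W y (axis l 1) \<bullet> \<xi>)"
  have eq: "(\<Sum>i\<in>UNIV. (push_frame (chart_inv c y) i \<bullet> \<xi>) * (push_frame (chart_inv c y) i \<bullet> \<eta>)) =
      dird ?W y (?z y) \<bullet> \<eta>" if y: "y \<in> snd c ` fst c" for y
  proof -
    have p: "chart_inv c y \<in> fst c" "snd c (chart_inv c y) = y" using c y by auto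
    have "linear (dird ?W y)"
      by (rule linear_dird[OF Ck_on_differentiable[OF Ck_immersed_map[OF c] y]])
    then have "linear (\<lambda>v. dird ?W y v \<bullet> \<zeta>)" for \<zeta>
      by (simp add: linear_iff inner_add_left)
    from N.sum_frame_chart[OF c p(1) this this] show ?thesis
      by (simp only: push_frame_chart[OF c p(1)] p(2))
  qed
  have "Ck_on 0 (\<lambda>y. dird ?W y (?z y) \<bullet> \<eta>) (snd c ` fst c)"
    by (intro Ck_on_inner Ck_on_const Ck_on_dird_field N.Ck_gram_inverse Ck_on_dird Ck_immersed_map c N.chart_open)
  then have "Ck_on 0 (\<lambda>y. \<Sum>i\<in>UNIV. (push_frame (chart_inv c y) i \<bullet> \<xi>) * (push_frame (chart_inv c y) i \<bullet> \<eta>)) (snd c ` fst c)"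
    by (rule Ck_on_cong[OF N.chart_open(2)[OF c], rotated]) (simp only: eq)
  then show "continuous_on (snd c ` fst c) ((\<lambda>p. \<Sum>i\<in>UNIV. (push_frame p i \<bullet> \<xi>) * (push_frame p i \<bullet> \<eta>)) \<circ> chart_inv c)"
    by (simp add: o_def)
qed

lemma continuous_double_frame_sum:
  assumes "\<And>p. bilinear (f p)" "\<And>p. bilinear (h p)"
    and "\<And>\<xi> \<eta>. continuous_on UNIV (\<lambda>p. f p \<xi> \<eta> :: real)" "\<And>\<xi> \<eta>. continuous_on UNIV (\<lambda>p. h p \<xi> \<eta> :: real)"
  shows "continuous_on UNIV (\<lambda>p. \<Sum>i\<in>UNIV. \<Sum>j\<in>UNIV.
    f p (push_frame p i) (push_frame p j) * h p (push_frame p i) (push_frame p j))"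
  unfolding double_frame_sum[OF assms(1,2)]
  by (intro continuous_intros continuous_frame_gram assms(3,4))

lemma continuous_norm_pullback_sq: "continuous_on UNIV (norm_pullback_sq N M u)"
  using continuous_double_frame_sum[OF bilinear_inner bilinear_inner]
  by (simp add: norm_pullback_sq_eq[abs_def] power2_eq_square continuous_on_const)

lemma continuous_ambient_ff_map: "continuous_on UNIV (\<lambda>p. ambient_ff (u p) \<xi> \<eta>)"
  by (rule continuous_on_compose2[OF continuous_on_ambient_ff continuous_u]) simp

lemma continuous_frame_index:
  assumes "continuous_on {0..} F1" "continuous_on {0..} F2"
  defines "t \<equiv> \<lambda>p. norm_pullback_sq N M u p / 4"
  shows "continuous_on UNIV (\<lambda>p. frame_index (u p) (push_frame p) (F1 (t p)) (F2 (t p)) E)"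
proof -
  have t: "continuous_on UNIV t" unfolding t_def by (intro continuous_intros continuous_norm_pullback_sq) simp
  have t0: "range t \<subseteq> {0..}"
    by (auto simp: t_def norm_pullback_sq_eq intro!: sum_nonneg)
  have "continuous_on UNIV (\<lambda>p. \<Sum>i\<in>UNIV. \<Sum>j\<in>UNIV. (push_frame p i \<bullet> push_frame p j)
      * (ambient_ff (u p) (push_frame p i) (push_frame p j) \<bullet> E))"
    by (rule continuous_double_frame_sum[OF bilinear_inner bilinear_ambient_ff_inner])
      (intro continuous_intros continuous_ambient_ff_map)+
  moreover have "continuous_on UNIV (\<lambda>p. \<Sum>i\<in>UNIV. \<Sum>j\<in>UNIV. (push_frame p i \<bullet> push_frame p j)
      * shape_form (u p) E (push_frame p i) (push_frame p j))"
    by (rule continuous_double_frame_sum[OF bilinear_inner bilinear_shape_form])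
      (unfold shape_form_def, (intro continuous_intros continuous_ambient_ff_map)+)
  moreover have "continuous_on UNIV (\<lambda>p. \<Sum>i\<in>UNIV. \<Sum>j\<in>UNIV. (ambient_ff (u p) (push_frame p i) (push_frame p j) \<bullet> E)
      * (ambient_ff (u p) (push_frame p i) (push_frame p j) \<bullet> E))"
    by (rule continuous_double_frame_sum[OF bilinear_ambient_ff_inner bilinear_ambient_ff_inner])
      (intro continuous_intros continuous_ambient_ff_map)+
  ultimately show ?thesis
    unfolding frame_index_def
    by (intro continuous_on_add continuous_on_mult continuous_on_power continuous_on_const
        continuous_on_compose2[OF assms(1) t t0] continuous_on_compose2[OF assms(2) t t0])
qed

section \<open>Maps with vanishing differential\<close>

lemma diff_map_eq_0:
  assumes "norm_pullback_sq N M u p = 0"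
  shows "diff_map N M u p v = 0"
proof -
  have "(\<Sum>i\<in>UNIV. \<Sum>j\<in>UNIV. (push_frame p i \<bullet> push_frame p j)\<^sup>2) = 0"
    using assms by (simp add: norm_pullback_sq_eq)
  then have "push_frame p i = 0" for i
    by (simp add: sum_nonneg_eq_0_iff sum_nonneg) (metis inner_eq_zero_iff)
  then have "diff_map N M u p (frame_at N p i) = 0" for i
    using injD[OF inj_L, of "u p" "diff_map N M u p (frame_at N p i)" 0]
    by (simp add: push_frame_def linear_0[OF linear_L])
  then show ?thesis
    by (subst N.frame_at_expansion[of v p])
      (simp add: linear_sum[OF linear_diff_map] linear_scale[OF linear_diff_map])
qed

text \<open>With du = 0 the map is constant in coordinates on a ball around each point, hence
  locally constant, and connectedness does the rest.\<close>

lemma constant_of_norm_pullback_eq_0: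
  assumes "\<And>p. norm_pullback_sq N M u p = 0" "connected (UNIV :: 'n set)"
  shows "\<exists>q. \<forall>p. u p = q"
proof -
  have "eventually (\<lambda>q. u p = u q) (at p)" for p
  proof -
    let ?c = "chart_at N p" and ?d = "chart_at M (u p)" and ?x = "coord N p"
    let ?T = "snd ?c ` (fst ?c \<inter> u -` fst ?d)"
    let ?U = "\<lambda>y. snd ?d (u (chart_inv ?c y))" and ?W = "\<iota> \<circ> u \<circ> chart_inv ?c" and ?h = "\<iota> \<circ> chart_inv ?d"
    have oT: "open ?T" by (rule open_map_overlap) simp_all
    have U': "(?U has_derivative (\<lambda>_. 0)) (at y)" if y: "y \<in> ?T" for y
    proof -
      let ?q = "chart_inv ?c y"
      have yc: "y \<in> snd ?c ` fst ?c" and q: "?q \<in> fst ?c" "snd ?c ?q = y" "u ?q \<in> fst ?d"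
        using y by auto
      have dU: "?U differentiable (at y)"
        by (rule Ck_on_differentiable[OF Ck_map y]) simp_all
      have Uy: "?U y \<in> snd ?d ` fst ?d" using q by auto
      \<comment> \<open>\<open>diff_map\<close> at \<open>?q\<close> uses the charts chosen for
        \<open>?q\<close> and \<open>u ?q\<close>, not those fixed at \<open>p\<close>. The detour
        through the immersed map \<open>?W\<close> removes this dependence, and injectivity of the
        differential of \<open>?h\<close> leads back to \<open>?U\<close>.\<close>
      have "dird ?U y v = 0" for v
      proof -
        have dW: "?W differentiable (at (snd ?c ?q))"
          unfolding q(2) by (rule Ck_on_differentiable[OF Ck_immersed_map yc]) simp
        have "dird ?W y v = 0"
          using N.diff_fun_chart(2)[OF _ q(1) dW, of v] diff_map_eq_0[OF assms(1)]
          by (simp add: q(2) linear_0[OF linear_L] flip: L_diff_map)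
        moreover have "dird (\<lambda>y. ?h (?U y)) y = dird ?W y"
          by (rule dird_cong_open[OF oT y]) auto
        ultimately have "dird ?h (?U y) (dird ?U y v) = 0"
          using dird_compose[OF dU immersion_differentiable[OF _ Uy], of v] by (simp add: o_def)
        then show ?thesis
          using injD[OF inj_dird_immersion[OF _ Uy], of "dird ?U y v" 0]
          by (simp add: linear_0[OF linear_dird_immersion[OF _ Uy]])
      qed
      then have "dird ?U y = (\<lambda>_. 0)" by blast
      with has_derivative_dird[OF dU] show ?thesis by simp
    qed
    obtain e where e: "e > 0" "ball ?x e \<subseteq> ?T"
      using oT coord_in_overlap open_contains_ball by metis
    have "\<exists>k. \<forall>y\<in>ball ?x e. ?U y = k"
      by (rule has_derivative_zero_constant[OF convex_ball])
        (use U' e(2) in \<open>blast intro: has_derivative_at_withinI\<close>)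
    then have Uconst: "?U y = ?U ?x" if "y \<in> ball ?x e" for y
      using that e(1) by (metis centre_in_ball)
    \<comment> \<open>The coordinate ball lies in \<open>?T\<close>, so \<open>u\<close> maps
      \<open>S\<close> into the domain of \<open>?d\<close>, where equal coordinates mean equal
      points.\<close>
    define S where "S = fst ?c \<inter> snd ?c -` ball ?x e"
    have "open S"
      unfolding S_def
      using continuous_open_preimage[OF N.continuous_on_chart[OF N.chart_at(1)] N.chart_open(1)[OF N.chart_at(1)] open_ball]
      by (simp add: vimage_def Int_def)
    moreover have "p \<in> S" using e(1) by (simp add: S_def coord_def)
    moreover have "u p = u q" if q: "q \<in> S" for q
    proof -
      have "snd ?c q \<in> ?T" using q e(2) by (auto simp: S_def)
      then have "u q \<in> fst ?d" using q by (force simp: S_def dest: N.chart_inv_left[OF N.chart_at(1)])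
      moreover have "snd ?d (u q) = snd ?d (u p)"
        using Uconst[of "snd ?c q"] q by (simp add: S_def)
      ultimately show ?thesis by (metis chart_at chart_inv_left)
    qed
    ultimately show ?thesis
      unfolding eventually_at_topological by blast
  qed
  then have "u p = u q" for p q
    by (intro connected_local_const[OF assms(2)]) auto
  then show ?thesis by blast
qed

end

section \<open>From stability to constancy\<close>

theorem theorem4p3:
  fixes M :: "('m::{t2_space, second_countable_topology}, 'l::finite) rmfd"
    and \<iota> :: "'m \<Rightarrow> real^'r"
    and N :: "('n::{t2_space, second_countable_topology}, 'k::finite) rmfd"
    and \<mu> :: "'n measure"
    and F F1 F2 :: "real \<Rightarrow> real"
    and H :: "'m \<Rightarrow> real"
    and u :: "'n \<Rightarrow> 'm"
  assumes "riemannian_manifold M" and "compact (UNIV :: 'm set)"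
    and "realizes_Phi_SSU M \<iota>"
  shows "ssu_const M \<iota> \<in> ssu_ratios M \<iota> \<and> (\<forall>s\<in>ssu_ratios M \<iota>. ssu_const M \<iota> \<le> s) \<and>
    0 < ssu_const M \<iota> \<and>
    ((\<forall>t\<ge>0. 0 \<le> F t) \<and> strict_mono_on {0..} F \<and> convex_on {0..} F \<and> C2_halfline F F1 F2 \<and>
     (\<forall>t>0. t * F2 t < ssu_const M \<iota> * F1 t) \<and>
     mfd_Ck 2 M H \<and> (\<forall>x v. cov_hessian M H x v v \<le> 0) \<and>
     riemannian_manifold N \<and> connected (UNIV :: 'n set) \<and> riemannian_volume N \<mu> \<and>
     F_symphonic N \<mu> M F H u \<and> Phi_sym_stable N \<mu> M F1 F2 H u
     \<longrightarrow> (\<exists>q. \<forall>p. u p = q))"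
proof -
  interpret Phi_SSU M \<iota>
    using assms by unfold_locales (auto simp: realizes_Phi_SSU_def)
  have "\<exists>q. \<forall>p. u p = q"
    if F: "strict_mono_on {0..} F" "C2_halfline F F1 F2" "\<forall>t>0. t * F2 t < ssu_const M \<iota> * F1 t"
      and hess: "\<forall>x v. cov_hessian M H x v v \<le> 0"
      and N: "riemannian_manifold N" "connected (UNIV :: 'n set)" "riemannian_volume N \<mu>"
      and u: "F_symphonic N \<mu> M F H u" "Phi_sym_stable N \<mu> M F1 F2 H u"
  proof -
    interpret immersed_map M \<iota> N u
      using N(1) u(1) by unfold_locales (auto simp: F_symphonic_def)
    define t where "t = (\<lambda>p. norm_pullback_sq N M u p / 4)"
    define q where "q = (\<lambda>E p. frame_index (u p) (push_frame p) (F1 (t p)) (F2 (t p)) E)"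
    define f where "f = (\<lambda>E. index_density N M F1 F2 H u (\<lambda>p. tang (u p) E))"
    have sets: "sets \<mu> = sets borel" using N(3) by (simp add: riemannian_volume_def)
    have t_eq: "t p = (\<Sum>i\<in>UNIV. \<Sum>j\<in>UNIV. (push_frame p i \<bullet> push_frame p j)\<^sup>2) / 4" for p
      by (simp add: t_def norm_pullback_sq_eq)
    have t0: "t p \<ge> 0" for p by (simp add: t_eq sum_nonneg)
    have neg: "(\<Sum>E\<in>Basis. q E p) < 0" if "t p > 0" for p
      unfolding q_def using that F derivative_pos[OF F(2,1) _ that]
      by (intro sum_frame_index_neg[OF proj_push_frame t_eq that]) auto
    \<comment> \<open>The inequality for F concerns t > 0 only; at t = 0 the summands vanish because
      du does.\<close>
    have zero: "q E p = 0" if "t p = 0" for E p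
    proof -
      have "diff_map N M u p v = 0" for v using that by (intro diff_map_eq_0) (simp add: t_def)
      then have "push_frame p i = 0" for i by (simp add: push_frame_def linear_0[OF linear_L])
      moreover have "ambient_ff (u p) 0 \<xi> = 0" for \<xi> using bilinear_lzero[OF bilinear_ambient_ff] .
      ultimately show ?thesis by (simp add: q_def frame_index_def shape_form_def)
    qed
    have "AE p in \<mu>. (\<Sum>E\<in>Basis. q E p) = 0"
    proof (rule AE_sum_eq_0[where f = f])
      show "q E \<in> borel_measurable \<mu>" for E
        unfolding measurable_cong_sets[OF sets refl] q_def t_def
        by (intro borel_measurable_continuous_onI continuous_frame_index C2_halfline_continuous[OF F(2)])
      show "f E p \<le> q E p" for E p
        unfolding f_def q_def t_def index_density_tang using hess by simp
      show "(\<forall>p. q E p = 0) \<or> (\<integral>\<^sup>+p. ennreal (- f E p) \<partial>\<mu>) < \<infinity> \<and>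
          0 \<le> enn2ereal (\<integral>\<^sup>+p. ennreal (f E p) \<partial>\<mu>) - enn2ereal (\<integral>\<^sup>+p. ennreal (- f E p) \<partial>\<mu>)" for E
      \<comment> \<open>Stability is available for fields that are not identically zero; the zero
        field falls under the first alternative.\<close>
      proof (cases "(\<lambda>p. tang (u p) E) = (\<lambda>_. 0)")
        case True
        then show ?thesis unfolding q_def t_def by (intro disjI1 allI frame_index_eq_0_of_tang)
      next
        case False
        then show ?thesis
          using u(2) smooth_field_tang[of E]
          unfolding Phi_sym_stable_def index_form_def index_neg_part_def f_def by blast
      qed
      show "(\<Sum>E\<in>Basis. q E p) \<le> 0" for p
        using neg[of p] zero[of p] t0[of p] by (cases "t p = 0") auto
    qed simp
    then have AE: "AE p in \<mu>. \<not> 0 < t p"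
      by (elim AE_mp) (use neg in \<open>force intro!: AE_I2\<close>)
    \<comment> \<open>Openness turns almost everywhere into everywhere, as the volume charges every
      nonempty open set.\<close>
    have open_pos: "open {p. 0 < t p}"
      unfolding t_def using continuous_norm_pullback_sq
      by (intro open_Collect_less continuous_intros) auto
    then have "emeasure \<mu> {p. 0 < t p} = 0"
      using AE sets sets_eq_imp_space_eq[OF sets] by (subst (asm) AE_iff_measurable) auto
    then have "{p. 0 < t p} = {}"
      by (rule N.volume_open_null[OF N(3) open_pos])
    then have "norm_pullback_sq N M u p = 0" for p
      using t0[of p] by (auto simp: t_def not_less order_antisym)
    then show ?thesis by (rule constant_of_norm_pullback_eq_0[OF _ N(2)])
  qed
  with ssu_const_attained ssu_const_le ssu_const_pos show ?thesis
    by (intro conjI ballI impI) (assumption | elim conjE)+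
qed

end
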